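(* Let $0<\alpha\le\pi/4$ and let $\mathcal N_\alpha$ be the qutrit-to-qutrit channel $\mathcal N_\alpha(\rho)=E_0\rho E_0^\dagger+E_1\rho E_1^\dagger$ with $E_0=\sin\alpha\,|0\rangle\langle1|+|1\rangle\langle2|$ and $E_1=\cos\alpha\,|2\rangle\langle1|+|1\rangle\langle0|$. Then the private capacity of $\mathcal N_\alpha$ is exactly one bit, $P(\mathcal N_\alpha)=1$. In particular, $$Q(\mathcal N_\alpha)\le\log(1+\cos\alpha)<1=P(\mathcal N_\alpha)=C(\mathcal N_\alpha)=\tfrac12C_{\mathrm E}(\mathcal N_\alpha).$$
   Context: $\log$ is base 2, $H$ is the von Neumann entropy. For a channel $\mathcal N$ with complementary channel $\mathcal N^c$ (to the environment of a Stinespring dilation): - $C(\mathcal N)=\sup_{n}\frac1n\chi(\mathcal N^{\otimes n})$ is the classical capacity, where $\chi(\mathcal N)$ is the maximum over ensembles $\{(p_i,\rho_i)\}$ of $\chi(\{p_i,\mathcal N(\rho_i)\}):=H(\sum_ip_i\mathcal N(\rho_i))-\sum_ip_iH(\mathcal N(\rho_i))$. - $P(\mathcal N)=\sup_n\frac1n\max_{\{(p_i,\rho_i)\}}\big[\chi(\{p_i,\mathcal N^{\otimes n}(\rho_i)\})-\chi(\{p_i,(\mathcal N^c)^{\otimes n}(\rho_i)\})\big]$ is the private classical capacity. - $Q(\mathcal N)=\sup_n\frac1n\max_\rho\big[H(\mathcal N^{\otimes n}(\rho))-H((\mathcal N^c)^{\otimes n}(\rho))\big]$ is the quantum capacity.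 - $C_{\mathrm E}(\mathcal N)=\max_\rho\big[H(\rho)+H(\mathcal N(\rho))-H((\mathrm{id}\otimes\mathcal N)(\phi_\rho))\big]$, with $\phi_\rho$ a purification of $\rho$, is the entanglement-assisted classical capacity. *)

theory Defs
  imports
    "HOL-Analysis.Analysis"
    "Jordan_Normal_Form.Schur_Decomposition"
    "Jordan_Normal_Form.Spectral_Radius"
begin

no_notation Finite_Cartesian_Product.vec_nth (infixl \<open>$\<close> 90)
hide_const (open) Finite_Cartesian_Product.vec Determinants.det Finite_Cartesian_Product.mat

definition msum :: "nat \<Rightarrow> complex mat list \<Rightarrow> complex mat" where
  "msum d Ms = foldr (+) Ms (0\<^sub>m d d)"

text \<open>In a tensor product of dimensions \<open>d\<^sub>1\<close> and \<open>d\<^sub>2\<close> the basis vector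
  \<open>|i\<rangle>|k\<rangle>\<close> has index \<open>i * d\<^sub>2 + k\<close>.\<close>

definition kron :: "complex mat \<Rightarrow> complex mat \<Rightarrow> complex mat" where
  "kron A B = mat (dim_row A * dim_row B) (dim_col A * dim_col B)
     (\<lambda>(r, c). A $$ (r div dim_row B, c div dim_col B) * B $$ (r mod dim_row B, c mod dim_col B))"

text \<open>Partial traces over the first and over the second tensor factor.\<close>

definition ptrace1 :: "nat \<Rightarrow> nat \<Rightarrow> complex mat \<Rightarrow> complex mat" where
  "ptrace1 d1 d2 X = mat d2 d2 (\<lambda>(k, l). \<Sum>i<d1. X $$ (i * d2 + k, i * d2 + l))"

definition ptrace2 :: "nat \<Rightarrow> nat \<Rightarrow> complex mat \<Rightarrow> complex mat" where
  "ptrace2 d1 d2 X = mat d1 d1 (\<lambda>(i, j). \<Sum>k<d2. X $$ (i * d2 + k, j * d2 + k))"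

definition density_ops :: "nat \<Rightarrow> complex mat set" where
  "density_ops d = {\<rho> \<in> carrier_mat d d. mat_adjoint \<rho> = \<rho> \<and>
     (\<forall>v \<in> carrier_vec d. 0 \<le> Re ((\<rho> *\<^sub>v v) \<bullet>c v)) \<and> (\<Sum>i<d. \<rho> $$ (i, i)) = 1}"

text \<open>\<open>- Tr (\<rho> log \<rho>)\<close>, evaluated on the spectrum; \<open>order\<close> is the multiplicity
  of an eigenvalue, and \<open>0 log 0 = 0\<close>.\<close>

definition vn_entropy :: "complex mat \<Rightarrow> real" where
  "vn_entropy \<rho> = - (\<Sum>x \<in> spectrum \<rho>. real (order x (char_poly \<rho>)) * (Re x * log 2 (Re x)))"

text \<open>A channel is given by a nonempty list of Kraus operators.\<close>

type_synonym kraus = "complex mat list"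

definition dim_in :: "kraus \<Rightarrow> nat" where "dim_in Es = dim_col (hd Es)"
definition dim_out :: "kraus \<Rightarrow> nat" where "dim_out Es = dim_row (hd Es)"

definition is_channel :: "kraus \<Rightarrow> bool" where
  "is_channel Es \<longleftrightarrow> Es \<noteq> [] \<and> set Es \<subseteq> carrier_mat (dim_out Es) (dim_in Es) \<and>
     msum (dim_in Es) (map (\<lambda>E. mat_adjoint E * E) Es) = 1\<^sub>m (dim_in Es)"

definition apply_channel :: "kraus \<Rightarrow> complex mat \<Rightarrow> complex mat" where
  "apply_channel Es \<rho> = msum (dim_out Es) (map (\<lambda>E. E * \<rho> * mat_adjoint E) Es)"

definition id_channel :: "nat \<Rightarrow> kraus" where "id_channel d = [1\<^sub>m d]"

definition tensor :: "kraus \<Rightarrow> kraus \<Rightarrow> kraus" where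
  "tensor Es Fs = [kron E F. E \<leftarrow> Es, F \<leftarrow> Fs]"

primrec tensor_power :: "kraus \<Rightarrow> nat \<Rightarrow> kraus" where
  "tensor_power Es 0 = id_channel 1"
| "tensor_power Es (Suc n) = tensor Es (tensor_power Es n)"

text \<open>The Stinespring isometry \<open>V = \<Sum>\<^sub>i E\<^sub>i \<otimes> |i\<rangle>\<close> from the input to output times environment.\<close>

definition stinespring :: "kraus \<Rightarrow> complex mat" where
  "stinespring Es = mat (dim_out Es * length Es) (dim_in Es)
     (\<lambda>(r, a). (Es ! (r mod length Es)) $$ (r div length Es, a))"

text \<open>Kraus operators \<open>(\<langle>b| \<otimes> 1) V\<close> of the channel \<open>\<rho> \<mapsto> Tr\<^sub>o\<^sub>u\<^sub>t (V \<rho> V\<^sup>\<dagger>)\<close>,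
  see \<open>apply_complementary\<close> below.\<close>

definition complementary :: "kraus \<Rightarrow> kraus" where
  "complementary Es = [mat (length Es) (dim_in Es)
     (\<lambda>(i, a). stinespring Es $$ (b * length Es + i, a)). b \<leftarrow> [0..<dim_out Es]]"

lemma complex_mat_adjoint_index:
  fixes A :: "complex mat"
  assumes "i < dim_col A" "j < dim_row A"
  shows "mat_adjoint A $$ (i, j) = cnj (A $$ (j, i))"
  using assms by (simp add: mat_adjoint_def mat_of_rows_index)

lemma mat_adjoint_carrier:
  fixes A :: "complex mat"
  assumes "A \<in> carrier_mat m n"
  shows "mat_adjoint A \<in> carrier_mat n m"
  using assms by (auto simp: mat_adjoint_def)

lemma conj_by_index:
  fixes A X :: "complex mat"
  assumes "A \<in> carrier_mat m n" "X \<in> carrier_mat n n" "i < m" "j < m"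
  shows "(A * X * mat_adjoint A) $$ (i, j) =
    (\<Sum>b<n. (\<Sum>a<n. A $$ (i, a) * X $$ (a, b)) * cnj (A $$ (j, b)))"
proof -
  have "mat_adjoint A \<in> carrier_mat n m" by (rule mat_adjoint_carrier[OF assms(1)])
  then show ?thesis
    using assms
    by (auto simp: times_mat_def scalar_prod_def complex_mat_adjoint_index atLeast0LessThan
        intro!: sum.cong)
qed

lemma msum_carrier:
  assumes "set Ms \<subseteq> carrier_mat d d"
  shows "msum d Ms \<in> carrier_mat d d"
  using assms by (induction Ms) (auto simp: msum_def)

lemma msum_index:
  assumes "set Ms \<subseteq> carrier_mat d d" "i < d" "j < d"
  shows "msum d Ms $$ (i, j) = (\<Sum>M \<leftarrow> Ms. M $$ (i, j))"
  using assms
proof (induction Ms)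
  case (Cons M Ms)
  have "msum d Ms \<in> carrier_mat d d" by (rule msum_carrier) (use Cons.prems in auto)
  then have "(M + msum d Ms) $$ (i, j) = M $$ (i, j) + msum d Ms $$ (i, j)"
    using Cons.prems by auto
  then show ?case using Cons by (simp add: msum_def)
qed (simp add: msum_def)

lemma apply_channel_index:
  assumes "is_channel Es" "\<rho> \<in> carrier_mat (dim_in Es) (dim_in Es)" "i < dim_out Es" "j < dim_out Es"
  shows "apply_channel Es \<rho> $$ (i, j) = (\<Sum>k<length Es.
    \<Sum>b<dim_in Es. (\<Sum>a<dim_in Es. (Es ! k) $$ (i, a) * \<rho> $$ (a, b)) * cnj ((Es ! k) $$ (j, b)))"
proof -
  have sub: "set Es \<subseteq> carrier_mat (dim_out Es) (dim_in Es)" using assms(1) by (simp add: is_channel_def)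
  have car: "E * \<rho> * mat_adjoint E \<in> carrier_mat (dim_out Es) (dim_out Es)" if "E \<in> set Es" for E
    using sub that assms(2) mat_adjoint_carrier[of E "dim_out Es" "dim_in Es"] by auto
  have "apply_channel Es \<rho> $$ (i, j) = (\<Sum>E \<leftarrow> Es. (E * \<rho> * mat_adjoint E) $$ (i, j))"
    unfolding apply_channel_def using car assms
    by (subst msum_index) (auto simp: comp_def)
  also have "\<dots> = (\<Sum>k<length Es. (Es ! k * \<rho> * mat_adjoint (Es ! k)) $$ (i, j))"
    by (simp add: sum_list_sum_nth atLeast0LessThan)
  also have "\<dots> = (\<Sum>k<length Es.
    \<Sum>b<dim_in Es. (\<Sum>a<dim_in Es. (Es ! k) $$ (i, a) * \<rho> $$ (a, b)) * cnj ((Es ! k) $$ (j, b)))"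
    using sub assms by (intro sum.cong refl conj_by_index) (auto dest: nth_mem)
  finally show ?thesis .
qed

lemma stinespring_carrier: "stinespring Es \<in> carrier_mat (dim_out Es * length Es) (dim_in Es)"
  by (simp add: stinespring_def)

lemma pair_index_less:
  fixes i k m n :: nat
  assumes "i < m" "k < n"
  shows "i * n + k < m * n"
proof -
  have "i * n + k < Suc i * n" using assms by simp
  also have "\<dots> \<le> m * n" using assms by (intro mult_le_mono1) simp
  finally show ?thesis .
qed

lemma stinespring_index:
  assumes "b < dim_out Es" "k < length Es" "a < dim_in Es"
  shows "stinespring Es $$ (b * length Es + k, a) = (Es ! k) $$ (b, a)"
proof -
  have "length Es \<noteq> 0" using assms by auto
  then have "(b * length Es + k) div length Es = b" "(b * length Es + k) mod length Es = k"
    using assms(2) by (simp_all add: div_mult_self3 del: length_0_conv)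
  then show ?thesis
    using assms pair_index_less[of b "dim_out Es" k "length Es"] by (simp add: stinespring_def)
qed

lemma stinespring_conj_index:
  assumes "\<rho> \<in> carrier_mat (dim_in Es) (dim_in Es)"
    "i < dim_out Es" "j < dim_out Es" "k < length Es" "l < length Es"
  shows "(stinespring Es * \<rho> * mat_adjoint (stinespring Es)) $$ (i * length Es + k, j * length Es + l) =
    (\<Sum>b<dim_in Es. (\<Sum>a<dim_in Es. (Es ! k) $$ (i, a) * \<rho> $$ (a, b)) * cnj ((Es ! l) $$ (j, b)))"
  using assms pair_index_less[of i "dim_out Es" k "length Es"] pair_index_less[of j "dim_out Es" l "length Es"]
  by (subst conj_by_index[OF stinespring_carrier]) (auto simp: stinespring_index)

lemma apply_channel_carrier:
  assumes "set Es \<subseteq> carrier_mat (dim_out Es) (dim_in Es)" "\<rho> \<in> carrier_mat (dim_in Es) (dim_in Es)"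
  shows "apply_channel Es \<rho> \<in> carrier_mat (dim_out Es) (dim_out Es)"
  unfolding apply_channel_def
proof (rule msum_carrier, clarsimp)
  fix E assume "E \<in> set Es"
  then have "E \<in> carrier_mat (dim_out Es) (dim_in Es)" using assms(1) by auto
  then show "E * \<rho> * mat_adjoint E \<in> carrier_mat (dim_out Es) (dim_out Es)"
    using assms(2) mat_adjoint_carrier[of E "dim_out Es" "dim_in Es"] by auto
qed

lemma apply_channel_eq_ptrace:
  assumes "is_channel Es" "\<rho> \<in> carrier_mat (dim_in Es) (dim_in Es)"
  shows "apply_channel Es \<rho> =
    ptrace2 (dim_out Es) (length Es) (stinespring Es * \<rho> * mat_adjoint (stinespring Es))"
proof (rule eq_matI)
  have "apply_channel Es \<rho> \<in> carrier_mat (dim_out Es) (dim_out Es)"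
    using assms by (intro apply_channel_carrier) (auto simp: is_channel_def)
  then show "dim_row (apply_channel Es \<rho>) = dim_row (ptrace2 (dim_out Es) (length Es)
      (stinespring Es * \<rho> * mat_adjoint (stinespring Es)))"
    "dim_col (apply_channel Es \<rho>) = dim_col (ptrace2 (dim_out Es) (length Es)
      (stinespring Es * \<rho> * mat_adjoint (stinespring Es)))"
    by (auto simp: ptrace2_def)
qed (simp add: ptrace2_def apply_channel_index[OF assms] stinespring_conj_index[OF assms(2)])

text \<open>If \<open>dim_out Es = 0\<close> then \<open>complementary Es\<close> is empty; the trace condition on a channel
  with nonzero input dimension excludes this.\<close>

lemma apply_complementary:
  assumes "is_channel Es" "0 < dim_out Es" "\<rho> \<in> carrier_mat (dim_in Es) (dim_in Es)"
  shows "apply_channel (complementary Es) \<rho> =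
    ptrace1 (dim_out Es) (length Es) (stinespring Es * \<rho> * mat_adjoint (stinespring Es))"
proof (rule eq_matI)
  let ?F = "\<lambda>b. mat (length Es) (dim_in Es) (\<lambda>(i, a). stinespring Es $$ (b * length Es + i, a))"
  have hd: "hd (complementary Es) = ?F 0"
    using assms(2) by (simp add: complementary_def hd_map)
  have din: "dim_in (complementary Es) = dim_in Es" and dout: "dim_out (complementary Es) = length Es"
    by (simp_all add: hd dim_in_def[of "complementary Es"] dim_out_def[of "complementary Es"])
  have sub: "set (complementary Es) \<subseteq>
    carrier_mat (dim_out (complementary Es)) (dim_in (complementary Es))"
    unfolding din dout by (auto simp: complementary_def)
  have c: "apply_channel (complementary Es) \<rho> \<in> carrier_mat (length Es) (length Es)"
    using apply_channel_carrier[OF sub] assms(3) by (simp add: din dout)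
  then show "dim_row (apply_channel (complementary Es) \<rho>) = dim_row (ptrace1 (dim_out Es) (length Es)
      (stinespring Es * \<rho> * mat_adjoint (stinespring Es)))"
    "dim_col (apply_channel (complementary Es) \<rho>) = dim_col (ptrace1 (dim_out Es) (length Es)
      (stinespring Es * \<rho> * mat_adjoint (stinespring Es)))"
    by (auto simp: ptrace1_def)
  fix k l
  assume "k < dim_row (ptrace1 (dim_out Es) (length Es) (stinespring Es * \<rho> * mat_adjoint (stinespring Es)))"
    "l < dim_col (ptrace1 (dim_out Es) (length Es) (stinespring Es * \<rho> * mat_adjoint (stinespring Es)))"
  then have kl: "k < length Es" "l < length Es" by (auto simp: ptrace1_def)
  have car: "?F b * \<rho> * mat_adjoint (?F b) \<in> carrier_mat (length Es) (length Es)" for b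
    using assms(3) mat_adjoint_carrier[of "?F b" "length Es" "dim_in Es"] by auto
  have "apply_channel (complementary Es) \<rho> $$ (k, l) =
      (\<Sum>b \<leftarrow> [0..<dim_out Es]. (?F b * \<rho> * mat_adjoint (?F b)) $$ (k, l))"
    unfolding apply_channel_def dout using car kl
    by (subst msum_index) (auto simp: complementary_def comp_def)
  also have "\<dots> = (\<Sum>b<dim_out Es. (?F b * \<rho> * mat_adjoint (?F b)) $$ (k, l))"
    by (simp add: interv_sum_list_conv_sum_set_nat atLeast0LessThan)
  also have "\<dots> = (\<Sum>b<dim_out Es. (stinespring Es * \<rho> * mat_adjoint (stinespring Es))
      $$ (b * length Es + k, b * length Es + l))"
  proof (rule sum.cong[OF refl])
    fix b assume b: "b \<in> {..<dim_out Es}"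
    have "?F b \<in> carrier_mat (length Es) (dim_in Es)" by simp
    from conj_by_index[OF this assms(3) kl]
    show "(?F b * \<rho> * mat_adjoint (?F b)) $$ (k, l) =
      (stinespring Es * \<rho> * mat_adjoint (stinespring Es)) $$ (b * length Es + k, b * length Es + l)"
      using b kl assms(3) by (simp add: stinespring_conj_index stinespring_index)
  qed
  finally show "apply_channel (complementary Es) \<rho> $$ (k, l) =
      ptrace1 (dim_out Es) (length Es) (stinespring Es * \<rho> * mat_adjoint (stinespring Es)) $$ (k, l)"
    using kl by (simp add: ptrace1_def)
qed

type_synonym ensemble = "(real \<times> complex mat) list"

definition ensembles :: "nat \<Rightarrow> ensemble set" where
  "ensembles d = {ens. (\<forall>(p, \<rho>) \<in> set ens. 0 \<le> p \<and> \<rho> \<in> density_ops d) \<and> (\<Sum>(p, \<rho>) \<leftarrow> ens. p) = 1}"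

definition holevo :: "nat \<Rightarrow> ensemble \<Rightarrow> real" where
  "holevo d ens = vn_entropy (msum d [complex_of_real p \<cdot>\<^sub>m \<rho>. (p, \<rho>) \<leftarrow> ens])
     - (\<Sum>(p, \<rho>) \<leftarrow> ens. p * vn_entropy \<rho>)"

definition holevo_out :: "kraus \<Rightarrow> ensemble \<Rightarrow> real" where
  "holevo_out Es ens = holevo (dim_out Es) [(p, apply_channel Es \<rho>). (p, \<rho>) \<leftarrow> ens]"

text \<open>Maxima over states and ensembles are written as suprema of real sets: all of these sets
  are bounded because \<open>0 \<le> vn_entropy \<rho> \<le> log 2 d\<close> in dimension \<open>d\<close>.\<close>

definition classical_capacity :: "kraus \<Rightarrow> real" where
  "classical_capacity Es = (SUP n \<in> {1..}. 1 / real n *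
     (SUP ens \<in> ensembles (dim_in Es ^ n). holevo_out (tensor_power Es n) ens))"

definition private_capacity :: "kraus \<Rightarrow> real" where
  "private_capacity Es = (SUP n \<in> {1..}. 1 / real n *
     (SUP ens \<in> ensembles (dim_in Es ^ n).
        holevo_out (tensor_power Es n) ens - holevo_out (tensor_power (complementary Es) n) ens))"

definition quantum_capacity :: "kraus \<Rightarrow> real" where
  "quantum_capacity Es = (SUP n \<in> {1..}. 1 / real n *
     (SUP \<rho> \<in> density_ops (dim_in Es ^ n).
        vn_entropy (apply_channel (tensor_power Es n) \<rho>) - vn_entropy (apply_channel (tensor_power (complementary Es) n) \<rho>)))"

definition pure_state :: "complex vec \<Rightarrow> complex mat" where
  "pure_state \<phi> = mat (dim_vec \<phi>) (dim_vec \<phi>) (\<lambda>(i, j). \<phi> $ i * cnj (\<phi> $ j))"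

definition purification :: "nat \<Rightarrow> nat \<Rightarrow> complex vec \<Rightarrow> complex mat \<Rightarrow> bool" where
  "purification r d \<phi> \<rho> \<longleftrightarrow> \<phi> \<in> carrier_vec (r * d) \<and> ptrace1 r d (pure_state \<phi>) = \<rho>"

text \<open>The reference system \<open>r\<close> of the purification is arbitrary.\<close>

definition entanglement_assisted_capacity :: "kraus \<Rightarrow> real" where
  "entanglement_assisted_capacity Es =
     Sup {vn_entropy \<rho> + vn_entropy (apply_channel Es \<rho>) - vn_entropy (apply_channel (tensor (id_channel r) Es) (pure_state \<phi>))
       | \<rho> r \<phi>. \<rho> \<in> density_ops (dim_in Es) \<and> purification r (dim_in Es) \<phi> \<rho>}"

definition ketbra :: "nat \<Rightarrow> nat \<Rightarrow> nat \<Rightarrow> complex mat" where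
  "ketbra d i j = mat d d (\<lambda>(r, c). if r = i \<and> c = j then 1 else 0)"

definition kraus0 :: "real \<Rightarrow> complex mat" where
  "kraus0 \<alpha> = complex_of_real (sin \<alpha>) \<cdot>\<^sub>m ketbra 3 0 1 + ketbra 3 1 2"

definition kraus1 :: "real \<Rightarrow> complex mat" where
  "kraus1 \<alpha> = complex_of_real (cos \<alpha>) \<cdot>\<^sub>m ketbra 3 2 1 + ketbra 3 1 0"

definition qutrit_channel :: "real \<Rightarrow> kraus" where "qutrit_channel \<alpha> = [kraus0 \<alpha>, kraus1 \<alpha>]"

lemma is_channel_qutrit_channel: "is_channel (qutrit_channel \<alpha>)"
proof -
  have k: "mat_adjoint (kraus0 \<alpha>) \<in> carrier_mat 3 3" "mat_adjoint (kraus1 \<alpha>) \<in> carrier_mat 3 3"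
    "kraus0 \<alpha> \<in> carrier_mat 3 3" "kraus1 \<alpha> \<in> carrier_mat 3 3"
    by (auto intro!: mat_adjoint_carrier simp: kraus0_def kraus1_def ketbra_def)
  have d: "dim_in (qutrit_channel \<alpha>) = 3" "dim_out (qutrit_channel \<alpha>) = 3"
    by (auto simp: dim_in_def dim_out_def qutrit_channel_def kraus0_def ketbra_def)
  have sc: "complex_of_real (sin \<alpha>) * complex_of_real (sin \<alpha>)
      + complex_of_real (cos \<alpha>) * complex_of_real (cos \<alpha>) = 1"
    by (metis of_real_1 of_real_add of_real_mult power2_eq_square sin_cos_squared_add)
  have "(mat_adjoint (kraus0 \<alpha>) * kraus0 \<alpha> + (mat_adjoint (kraus1 \<alpha>) * kraus1 \<alpha> + 0\<^sub>m 3 3)) = 1\<^sub>m 3"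
  proof (rule eq_matI)
    fix i j assume "i < dim_row (1\<^sub>m 3 :: complex mat)" "j < dim_col (1\<^sub>m 3 :: complex mat)"
    then have "i = 0 \<or> i = 1 \<or> i = 2" "j = 0 \<or> j = 1 \<or> j = 2" by auto
    then show "(mat_adjoint (kraus0 \<alpha>) * kraus0 \<alpha> + (mat_adjoint (kraus1 \<alpha>) * kraus1 \<alpha> + 0\<^sub>m 3 3)) $$ (i, j)
      = 1\<^sub>m 3 $$ (i, j)"
      using k sc
      by (elim disjE)
        (simp_all add: scalar_prod_def complex_mat_adjoint_index numeral_3_eq_3 sum.atLeast0_lessThan_Suc
          kraus0_def kraus1_def ketbra_def)
  qed (use k in auto)
  then show ?thesis using k
    unfolding is_channel_def d by (simp add: qutrit_channel_def msum_def)
qed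

end

theory Submission
  imports Defs
begin

text \<open>
  Split the input into the middle letter 1 and the qubit spanned by 0 and 2. The channel sends this qubit
  to the environment and outputs the flag 1; the letter 1 leaves \<open>sin \<alpha> |00\<rangle> + cos \<alpha> |21\<rangle>\<close> on output and
  environment.

  Classical capacity: with \<open>\<sigma> = diag (sin\<^sup>2 \<alpha>, 1, cos\<^sup>2 \<alpha>) / 2\<close> every output of \<open>n\<close> uses is at most
  \<open>2\<^sup>n \<sigma>\<^sup>\<otimes>\<^sup>n\<close>, which bounds its relative entropy to \<open>\<sigma>\<^sup>\<otimes>\<^sup>n\<close>, and so the Holevo information, by \<open>n\<close>. The private
  capacity lies below the classical one, and the ensemble of \<open>|1\<rangle>\<langle>1|\<close> and \<open>diag (cos\<^sup>2 \<alpha>, 0, sin\<^sup>2 \<alpha>)\<close> attains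
  one bit because both states look the same to the environment.

  Quantum capacity: dephasing the output can only increase its entropy. For the outcomes \<open>b\<close> with
  unnormalised environment states \<open>\<tau>\<^sub>b\<close> and probabilities \<open>\<beta>\<^sub>b = Tr \<tau>\<^sub>b\<close> the coherent information is then at most
  \<open>log Tr (\<Sum>\<^sub>b \<tau>\<^sub>b / sqrt \<beta>\<^sub>b)\<^sup>2\<close>. Letter by letter this trace is governed by the matrix with diagonal entries 1 and
  off-diagonal entries \<open>cos \<alpha>\<close>, whose norm is \<open>1 + cos \<alpha>\<close>.

  Entanglement-assisted capacity: measuring input, output and environment in suitable bases turns
  \<open>H(\<rho>) + H(N(\<rho>)) - H(N\<^sup>c(\<rho>))\<close> into the expectation of a logarithm, and concavity bounds it by \<open>log 4\<close>.
\<close>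

text \<open>Regularisation is the obstacle: inputs may be entangled over any number of uses, so a
  bound for one use settles nothing by itself. Each regularised quantity is therefore reduced to an
  inequality about vectors that survives peeling off one letter: a bilinear bound against a product
  weight for the Holevo information, and a bound on overlaps of conditional environment states for
  the coherent information. The state \<sigma> is the output of the average of the optimal ensemble,
  which is why comparing with it loses nothing; the same \<sigma> makes the entanglement-assisted
  bound tight. The square roots in the quantum bound come from writing a logarithm as twice the
  logarithm of a square root: Cauchy-Schwarz can then split off the square root of the environment
  state, whose Hilbert-Schmidt norm is 1. The off-diagonal entry is really the larger of sin
  \<alpha> and cos \<alpha>, and \<alpha> \<le> pi / 4 selects the cosine. The entanglement-assisted
  formula needs no regularisation but admits an arbitrary reference system, which is eliminated
  because the two halves of a pure state have the same nonzero spectrum.\<close>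

section \<open>Composite indices and Jensen's inequality for the logarithm\<close>

lemma sum_lessThan_times:
  fixes f :: "nat \<Rightarrow> 'a::comm_monoid_add"
  shows "(\<Sum>r<a * b. f r) = (\<Sum>i<a. \<Sum>j<b. f (i * b + j))"
proof -
  have "(\<Sum>i<a. \<Sum>j<b. f (i * b + j)) = (\<Sum>i<a. sum f {i * b..<i * b + b})"
    by (rule sum.cong[OF refl], subst sum.atLeastLessThan_shift_0) (simp add: atLeast0LessThan)
  then show ?thesis by (simp add: sum.nat_group)
qed

lemma sum_Times: "(\<Sum>p\<in>A \<times> B. g p) = (\<Sum>a\<in>A. \<Sum>b\<in>B. g (a, b))"
  by (simp add: sum.cartesian_product)

lemma sum_weighted_pos:
  fixes w x :: "'a \<Rightarrow> real"
  assumes "finite S" and w: "\<And>i. i \<in> S \<Longrightarrow> 0 \<le> w i" and w1: "sum w S = 1"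
    and x: "\<And>i. i \<in> S \<Longrightarrow> 0 < w i \<Longrightarrow> 0 < x i"
  shows "0 < (\<Sum>i\<in>S. w i * x i)"
proof -
  have nn: "0 \<le> w i * x i" if "i \<in> S" for i
    using w[OF that] x[OF that] by (cases "w i = 0") (auto intro: mult_nonneg_nonneg less_imp_le)
  obtain j where j: "j \<in> S" "0 < w j"
    using w w1 by (metis less_eq_real_def sum.neutral zero_neq_one)
  show ?thesis
    using nn j x by (intro sum_pos2[OF assms(1) j(1)]) auto
qed

text \<open>Jensen's inequality, from \<open>ln y \<le> y - 1\<close> at
  \<open>y = x i / ?X\<close>. Positivity of \<open>x i\<close> is asked only where
  \<open>w i\<close> is positive, because the ratios of eigenvalues inserted below may vanish on
  outcomes of probability zero.\<close>

lemma sum_weighted_log_le: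
  fixes w x :: "'a \<Rightarrow> real"
  assumes "finite S" and w: "\<And>i. i \<in> S \<Longrightarrow> 0 \<le> w i" and w1: "sum w S = 1"
    and x: "\<And>i. i \<in> S \<Longrightarrow> 0 < w i \<Longrightarrow> 0 < x i"
  shows "(\<Sum>i\<in>S. w i * log 2 (x i)) \<le> log 2 (\<Sum>i\<in>S. w i * x i)"
proof -
  let ?X = "\<Sum>i\<in>S. w i * x i"
  have X: "0 < ?X" using assms by (rule sum_weighted_pos)
  have "w i * (ln (x i) - ln ?X) \<le> w i * (x i / ?X) - w i" if i: "i \<in> S" for i
  proof (cases "w i = 0")
    case False
    then have pos: "0 < w i" "0 < x i" using w[OF i] x[OF i] by auto
    then have "ln (x i / ?X) \<le> x i / ?X - 1" using X by (intro ln_le_minus_one) simp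
    then have "ln (x i) - ln ?X \<le> x i / ?X - 1" using pos X by (simp add: ln_div)
    then have "w i * (ln (x i) - ln ?X) \<le> w i * (x i / ?X - 1)"
      using pos by (intro mult_left_mono) auto
    then show ?thesis by (simp add: right_diff_distrib)
  qed simp
  then have "(\<Sum>i\<in>S. w i * (ln (x i) - ln ?X)) \<le> (\<Sum>i\<in>S. w i * (x i / ?X) - w i)"
    by (rule sum_mono)
  also have "\<dots> = (\<Sum>i\<in>S. w i * x i) / ?X - 1"
    by (simp only: sum_subtractf w1 sum_divide_distrib times_divide_eq_right)
  finally have "(\<Sum>i\<in>S. w i * (ln (x i) - ln ?X)) \<le> 0" using X by simp
  then have "(\<Sum>i\<in>S. w i * ln (x i)) \<le> ln ?X"
    by (simp add: right_diff_distrib sum_subtractf flip: sum_distrib_right) (simp add: w1)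
  then show ?thesis
    by (simp add: log_def divide_right_mono flip: sum_divide_distrib)
qed

subsection \<open>The spectral theorem\<close>

lemma mat_adjoint_mult:
  fixes A B :: "complex mat"
  assumes "A \<in> carrier_mat m k" "B \<in> carrier_mat k n"
  shows "mat_adjoint (A * B) = mat_adjoint B * mat_adjoint A"
  using assms mat_adjoint_carrier[OF assms(1)] mat_adjoint_carrier[OF assms(2)]
    mat_adjoint_carrier[of "A * B" m n]
  by (intro eq_matI) (auto simp: complex_mat_adjoint_index scalar_prod_def ac_simps)

lemma mat_adjoint_adjoint:
  fixes A :: "complex mat"
  shows "mat_adjoint (mat_adjoint A) = A"
proof -
  have A: "A \<in> carrier_mat (dim_row A) (dim_col A)" by simp
  note A' = mat_adjoint_carrier[OF A]
  show ?thesis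
    using A' mat_adjoint_carrier[OF A'] by (intro eq_matI) (auto simp: complex_mat_adjoint_index)
qed

text \<open>Complete \<open>v\<close> to a basis and orthogonalise: Gram-Schmidt leaves the first
  vector alone, and normalising the columns does not change it because it is already a unit
  vector.\<close>

lemma unitary_completion:
  fixes v :: "complex vec"
  assumes v: "v \<in> carrier_vec n" "v \<bullet>c v = 1"
  obtains W where "W \<in> carrier_mat n n" "mat_adjoint W * W = 1\<^sub>m n" "W * mat_adjoint W = 1\<^sub>m n"
    "col W 0 = v"
proof -
  have n: "n \<noteq> 0"
  proof
    assume "n = 0"
    with v show False by (auto simp: scalar_prod_def)
  qed
  have v0: "v \<noteq> 0\<^sub>v n" using v by (auto simp: scalar_prod_def)
  interpret cof_vec_space n "TYPE(complex)" .
  define b where "b = basis_completion v"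
  define ws where "ws = gram_schmidt n b"
  from basis_completion[OF v(1) v0, folded b_def]
  have b: "distinct b" "\<not> lin_dep (set b)" "set b \<subseteq> carrier_vec n" "hd b = v" "length b = n"
    by auto
  then obtain vs where bv: "b = v # vs" using n by (cases b) auto
  from gram_schmidt_result[OF b(3,1,2) refl, folded ws_def]
  have ws: "set ws \<subseteq> carrier_vec n" "corthogonal ws" "length ws = n" by (auto simp: b)
  have hd: "hd ws = v" using gram_schmidt_hd[OF v(1), of vs, folded bv] by (simp add: ws_def)
  have ws0: "ws ! 0 = v" using hd ws(3) n by (metis hd_conv_nth list.size(3))
  define N where "N j = sqrt (Re (ws ! j \<bullet>c ws ! j))" for j
  have wsc: "ws ! j \<in> carrier_vec n" if "j < n" for j using ws that by auto
  have sp: "ws ! i \<bullet>c ws ! j = (\<Sum>a<n. ws ! i $ a * cnj (ws ! j $ a))" if "i < n" "j < n" for i j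
    using wsc[OF that(1)] wsc[OF that(2)] by (auto simp: scalar_prod_def atLeast0LessThan)
  have nn: "ws ! j \<bullet>c ws ! j = complex_of_real (\<Sum>a<n. (cmod (ws ! j $ a))\<^sup>2)" if "j < n" for j
    by (simp only: sp[OF that that] of_real_sum complex_norm_square)
  have N2: "complex_of_real (N j) * complex_of_real (N j) = ws ! j \<bullet>c ws ! j" and N0: "N j \<noteq> 0" if j: "j < n" for j
  proof -
    have "(N j)\<^sup>2 = Re (ws ! j \<bullet>c ws ! j)"
      unfolding N_def nn[OF j] by (simp add: sum_nonneg)
    then show *: "complex_of_real (N j) * complex_of_real (N j) = ws ! j \<bullet>c ws ! j"
      unfolding nn[OF j] by (metis Re_complex_of_real of_real_mult power2_eq_square)
    have "ws ! j \<bullet>c ws ! j \<noteq> 0" using corthogonalD[OF ws(2), of j j] j ws(3) by simp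
    then show "N j \<noteq> 0" using * by auto
  qed
  define W where "W = mat n n (\<lambda>(a, j). ws ! j $ a / complex_of_real (N j))"
  have W: "W \<in> carrier_mat n n" by (simp add: W_def)
  note W' = mat_adjoint_carrier[OF W]
  have WW: "mat_adjoint W * W = 1\<^sub>m n"
  proof (rule eq_matI)
    fix i j assume "i < dim_row (1\<^sub>m n :: complex mat)" "j < dim_col (1\<^sub>m n :: complex mat)"
    then have ij: "i < n" "j < n" by auto
    have "(mat_adjoint W * W) $$ (i, j) = (\<Sum>a<n. cnj (W $$ (a, i)) * W $$ (a, j))"
      using W W' ij by (auto simp: scalar_prod_def complex_mat_adjoint_index atLeast0LessThan)
    also have "\<dots> = (\<Sum>a<n. ws ! j $ a * cnj (ws ! i $ a)) / (complex_of_real (N i) * complex_of_real (N j))"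
      unfolding sum_divide_distrib using ij by (intro sum.cong refl) (simp add: W_def)
    also have "\<dots> = (if i = j then 1 else 0)"
      using corthogonalD[OF ws(2), of j i] ij ws(3) N2[OF ij(1)] N0[OF ij(1)]
      by (auto simp: sp[OF ij(2,1), symmetric])
    finally show "(mat_adjoint W * W) $$ (i, j) = 1\<^sub>m n $$ (i, j)" using ij by simp
  qed (use W W' in auto)
  moreover have "W * mat_adjoint W = 1\<^sub>m n" by (rule mat_mult_left_right_inverse[OF W' W WW])
  moreover have "col W 0 = v"
    using n v ws0 by (intro eq_vecI) (auto simp: W_def N_def)
  ultimately show ?thesis using W that by blast
qed

text \<open>Deflation. A unit eigenvector becomes the first column of a unitary; conjugation by it
  clears the first column below the diagonal, hermiticity then clears the first row, and the
  remaining block is again hermitian.\<close>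

lemma hermitian_diagonalization:
  fixes A :: "complex mat"
  assumes "A \<in> carrier_mat n n" "mat_adjoint A = A"
  shows "\<exists>U D. U \<in> carrier_mat n n \<and> D \<in> carrier_mat n n \<and> mat_adjoint U * U = 1\<^sub>m n \<and>
    U * mat_adjoint U = 1\<^sub>m n \<and> diagonal_mat D \<and> A = U * D * mat_adjoint U"
  using assms
proof (induction n arbitrary: A)
  case 0
  have "mat_adjoint (1\<^sub>m 0 :: complex mat) \<in> carrier_mat 0 0" by (rule mat_adjoint_carrier) simp
  then show ?case using 0
    by (intro exI[of _ "1\<^sub>m 0"] exI[of _ A]) (auto simp: diagonal_mat_def)
next
  case (Suc n A)
  obtain e where "e \<in> spectrum A" using spectrum_non_empty[OF Suc.prems(1)] by auto
  then obtain u where u: "u \<in> carrier_vec (Suc n)" "u \<noteq> 0\<^sub>v (Suc n)" "A *\<^sub>v u = e \<cdot>\<^sub>v u"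
    using Suc.prems(1) by (auto simp: spectrum_def eigenvalue_def eigenvector_def)
  define N where "N = sqrt (\<Sum>a<Suc n. (cmod (u $ a))\<^sup>2)"
  obtain a where a: "a < Suc n" "u $ a \<noteq> 0"
    using u by (metis carrier_vecD eq_vecI index_zero_vec(1) index_zero_vec(2))
  then have "(\<Sum>a<Suc n. (cmod (u $ a))\<^sup>2) > 0"
    by (intro sum_pos2[of _ a]) auto
  then have N0: "N \<noteq> 0" and N2: "N\<^sup>2 = (\<Sum>a<Suc n. (cmod (u $ a))\<^sup>2)"
    by (auto simp: N_def simp del: sum.lessThan_Suc)
  define v where "v = complex_of_real (1 / N) \<cdot>\<^sub>v u"
  have v: "v \<in> carrier_vec (Suc n)" using u by (simp add: v_def)
  have Av: "A *\<^sub>v v = e \<cdot>\<^sub>v v"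
    using u Suc.prems(1) by (simp add: v_def mult_mat_vec[OF Suc.prems(1) u(1)] smult_smult_assoc ac_simps)
  have "v \<bullet>c v = (\<Sum>a<Suc n. v $ a * cnj (v $ a))"
    using v by (auto simp: scalar_prod_def atLeast0LessThan simp del: sum.lessThan_Suc)
  also have "\<dots> = (\<Sum>a<Suc n. complex_of_real ((cmod (u $ a))\<^sup>2)) / complex_of_real (N\<^sup>2)"
    unfolding sum_divide_distrib complex_norm_square
    using u(1) by (intro sum.cong refl) (simp add: v_def power2_eq_square)
  also have "\<dots> = 1"
    using N0 unfolding of_real_sum[symmetric] N2[symmetric] by simp
  finally obtain W where W: "W \<in> carrier_mat (Suc n) (Suc n)" "mat_adjoint W * W = 1\<^sub>m (Suc n)"
    "W * mat_adjoint W = 1\<^sub>m (Suc n)" "col W 0 = v"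
    using unitary_completion[OF v] by blast
  note A = Suc.prems(1)
  have W': "mat_adjoint W \<in> carrier_mat (Suc n) (Suc n)" by (rule mat_adjoint_carrier[OF W(1)])
  define A' where "A' = mat_adjoint W * A * W"
  have A': "A' \<in> carrier_mat (Suc n) (Suc n)" using W W' A by (auto simp: A'_def)
  have A'h: "mat_adjoint A' = A'"
    unfolding A'_def
    using mat_adjoint_mult[OF mult_carrier_mat[OF W' A] W(1)] mat_adjoint_mult[OF W' A] W W' A Suc.prems(2)
    by (simp add: mat_adjoint_adjoint)
  have herm: "A' $$ (i, j) = cnj (A' $$ (j, i))" if "i < Suc n" "j < Suc n" for i j
    using complex_mat_adjoint_index[of i A' j] A' A'h that by auto
  have c0: "A' $$ (i, 0) = (if i = 0 then e else 0)" if i: "i < Suc n" for i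
  proof -
    have "A' = mat_adjoint W * (A * W)" using W W' A by (simp add: A'_def)
    then have "A' $$ (i, 0) = row (mat_adjoint W) i \<bullet> (A *\<^sub>v v)"
      using W' A i W(1,4) col_mult2[OF A W(1), of 0]
      by (metis carrier_matD index_mult_mat(1,3) zero_less_Suc)
    also have "\<dots> = e * (row (mat_adjoint W) i \<bullet> col W 0)"
      using W(4) v W' i by (simp add: Av)
    also have "row (mat_adjoint W) i \<bullet> col W 0 = (mat_adjoint W * W) $$ (i, 0)"
      using W(1) W' i by simp
    finally show ?thesis using i by (simp add: W(2))
  qed
  define A3 where "A3 = mat n n (\<lambda>(i, j). A' $$ (Suc i, Suc j))"
  have A3: "A3 \<in> carrier_mat n n" by (simp add: A3_def)
  have "mat_adjoint A3 = A3"
    using mat_adjoint_carrier[OF A3] A3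
    by (intro eq_matI) (auto simp: complex_mat_adjoint_index A3_def herm[symmetric])
  from Suc.IH[OF A3 this] obtain U3 D3 where 3: "U3 \<in> carrier_mat n n" "D3 \<in> carrier_mat n n"
    "mat_adjoint U3 * U3 = 1\<^sub>m n" "U3 * mat_adjoint U3 = 1\<^sub>m n" "diagonal_mat D3"
    "A3 = U3 * D3 * mat_adjoint U3" by blast
  have U3': "mat_adjoint U3 \<in> carrier_mat n n" by (rule mat_adjoint_carrier[OF 3(1)])
  let ?E = "mat 1 1 (\<lambda>_. e) :: complex mat"
  have ce: "cnj e = e" using herm[of 0 0] c0[of 0] by (metis zero_less_Suc)
  have blk: "A' = four_block_mat ?E (0\<^sub>m 1 n) (0\<^sub>m n 1) A3"
    using A' c0 herm[of 0]
    by (intro eq_matI) (auto simp: four_block_mat_def A3_def Let_def ce)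
  define V where "V = four_block_mat (1\<^sub>m 1) (0\<^sub>m 1 n) (0\<^sub>m n 1) U3"
  define V' where "V' = four_block_mat (1\<^sub>m 1) (0\<^sub>m 1 n) (0\<^sub>m n 1) (mat_adjoint U3)"
  define D where "D = four_block_mat ?E (0\<^sub>m 1 n) (0\<^sub>m n 1) D3"
  have V: "V \<in> carrier_mat (Suc n) (Suc n)" "V' \<in> carrier_mat (Suc n) (Suc n)" "D \<in> carrier_mat (Suc n) (Suc n)"
    using 3 U3' by (auto simp: V_def V'_def D_def)
  have V'eq: "mat_adjoint V = V'"
    using V mat_adjoint_carrier[OF V(1)] 3(1) U3'
    by (intro eq_matI)
      (auto simp: complex_mat_adjoint_index V_def V'_def four_block_mat_def Let_def)
  have V'V: "V' * V = 1\<^sub>m (Suc n)" and VV': "V * V' = 1\<^sub>m (Suc n)"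
    and VDV: "V * D * V' = A'"
    using 3 U3' four_block_one_mat[of 1 n]
    by (simp_all add: V_def V'_def D_def blk
        mult_four_block_mat[of _ 1 1 _ n _ n _ _ 1 _ n])
  define U where "U = W * V"
  have U: "U \<in> carrier_mat (Suc n) (Suc n)" using W V by (auto simp: U_def)
  have Ua: "mat_adjoint U = V' * mat_adjoint W"
    by (simp add: U_def mat_adjoint_mult[OF W(1) V(1)] V'eq)
  have "mat_adjoint U * U = V' * (mat_adjoint W * W) * V"
    unfolding Ua unfolding U_def using W(1) W' V by (simp add: assoc_mult_mat[of _ "Suc n" "Suc n" _ "Suc n" _ "Suc n"])
  also have "\<dots> = 1\<^sub>m (Suc n)" using V V'V by (simp add: W(2))
  finally have UU: "mat_adjoint U * U = 1\<^sub>m (Suc n)" .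
  have UU': "U * mat_adjoint U = 1\<^sub>m (Suc n)"
    by (rule mat_mult_left_right_inverse[OF mat_adjoint_carrier[OF U] U UU])
  have "U * D * mat_adjoint U = W * (V * D * V') * mat_adjoint W"
    unfolding Ua unfolding U_def using W(1) W' V by (simp add: assoc_mult_mat[of _ "Suc n" "Suc n" _ "Suc n" _ "Suc n"])
  also have "\<dots> = (W * mat_adjoint W) * A * (W * mat_adjoint W)"
    unfolding VDV A'_def using W(1) W' A by (simp add: assoc_mult_mat[of _ "Suc n" "Suc n" _ "Suc n" _ "Suc n"])
  also have "\<dots> = A" using A by (simp add: W(3))
  finally have "A = U * D * mat_adjoint U" by simp
  moreover have "diagonal_mat D"
    using 3(2,5) by (auto simp: D_def diagonal_mat_def four_block_mat_def Let_def)
  ultimately show ?case using U V UU UU' by blast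
qed

subsection \<open>The von Neumann entropy\<close>

lemma order_prod_list_linear:
  fixes xs :: "'a::idom list"
  shows "order y (\<Prod>x\<leftarrow>xs. [:- x, 1:]) = count_list xs y"
proof (induction xs)
  case (Cons x xs)
  have "order y [:- x, 1:] = (if x = y then 1 else 0)"
    by (auto simp: order_0I order_linear)
  moreover have "(\<Prod>x\<leftarrow>xs. [:- x, 1:]) \<noteq> 0" by (auto simp: prod_list_zero_iff)
  ultimately show ?case using Cons by (simp add: order_mult del: mult_pCons_left)
qed simp

lemma sum_count_list_times:
  fixes f :: "'a \<Rightarrow> real"
  assumes "finite S" "set xs \<subseteq> S"
  shows "(\<Sum>x\<in>S. real (count_list xs x) * f x) = (\<Sum>x\<leftarrow>xs. f x)"
  using assms(2)
proof (induction xs)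
  case (Cons y xs)
  have "(\<Sum>x\<in>S. real (count_list (y # xs) x) * f x)
      = (\<Sum>x\<in>S. real (count_list xs x) * f x + (if x = y then f x else 0))"
    by (intro sum.cong refl) (auto simp: algebra_simps)
  then show ?case using Cons assms(1) by (simp add: sum.distrib)
qed simp

text \<open>Turns the sum over distinct eigenvalues with algebraic multiplicities into a sum over
  the roots with repetition. In particular the entropy depends on the characteristic polynomial
  alone.\<close>

lemma vn_entropy_char_poly:
  assumes "A \<in> carrier_mat n n" "char_poly A = (\<Prod>x\<leftarrow>xs. [:- x, 1:])"
  shows "vn_entropy A = - (\<Sum>x\<leftarrow>xs. Re x * log 2 (Re x))"
proof -
  have "spectrum A = set xs"
    using assms(2) by (auto simp: spectrum_root_char_poly[OF assms(1)] poly_prod_list prod_list_zero_iff)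
  then show ?thesis
    using sum_count_list_times[of "set xs" xs "\<lambda>x. Re x * log 2 (Re x)"]
    by (simp add: vn_entropy_def assms(2) order_prod_list_linear)
qed

lemma char_poly_diagonal:
  fixes D :: "complex mat"
  assumes "D \<in> carrier_mat n n" "diagonal_mat D"
  shows "char_poly D = (\<Prod>x\<leftarrow>map (\<lambda>i. D $$ (i, i)) [0..<n]. [:- x, 1:])"
proof -
  have "upper_triangular D"
    using assms unfolding upper_triangular_def diagonal_mat_def by auto
  from char_poly_upper_triangular[OF assms(1) this] show ?thesis
    using assms(1) by (auto simp: diag_mat_def)
qed

lemma vn_entropy_diagonal:
  assumes "D \<in> carrier_mat n n" "diagonal_mat D"
  shows "vn_entropy D = - (\<Sum>i<n. Re (D $$ (i, i)) * log 2 (Re (D $$ (i, i))))"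
  unfolding vn_entropy_char_poly[OF assms(1) char_poly_diagonal[OF assms]] map_map comp_def
  by (simp add: interv_sum_list_conv_sum_set_nat atLeast0LessThan)

section \<open>Orthonormal bases, Gram representations of states and Klein's inequality\<close>

text \<open>\<open>U j a\<close> is coordinate \<open>a\<close> of the \<open>j\<close>-th vector of
  an orthonormal basis. Orthonormality and completeness are both recorded: norms and overlaps of
  basis vectors use the former, Parseval's identity the latter.\<close>

definition unitary_on :: "nat \<Rightarrow> (nat \<Rightarrow> nat \<Rightarrow> complex) \<Rightarrow> bool" where
  "unitary_on d U \<longleftrightarrow>
     (\<forall>i<d. \<forall>j<d. (\<Sum>a<d. cnj (U i a) * U j a) = (if i = j then 1 else 0)) \<and>
     (\<forall>a<d. \<forall>b<d. (\<Sum>j<d. U j a * cnj (U j b)) = (if a = b then 1 else 0))"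

lemma unitary_norm:
  assumes "unitary_on d U" "j < d"
  shows "(\<Sum>a<d. (cmod (U j a))\<^sup>2) = 1"
proof -
  have "complex_of_real (\<Sum>a<d. (cmod (U j a))\<^sup>2) = (\<Sum>a<d. cnj (U j a) * U j a)"
    by (simp only: of_real_sum complex_norm_square mult.commute)
  also have "\<dots> = 1" using assms by (simp add: unitary_on_def)
  finally show ?thesis using of_real_eq_1_iff by blast
qed

lemma unitary_parseval:
  assumes "unitary_on d U"
  shows "(\<Sum>j<d. (cmod (\<Sum>a<d. cnj (U j a) * f a))\<^sup>2) = (\<Sum>a<d. (cmod (f a))\<^sup>2)"
proof -
  have compl: "(\<Sum>j<d. U j a * cnj (U j b)) = (if a = b then 1 else 0)" if "a < d" "b < d" for a b
    using assms that by (simp add: unitary_on_def)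
  have "complex_of_real (\<Sum>j<d. (cmod (\<Sum>k<d. cnj (U j k) * f k))\<^sup>2)
      = (\<Sum>j<d. \<Sum>k<d. \<Sum>k'<d. (cnj (U j k) * f k) * cnj (cnj (U j k') * f k'))"
    by (simp only: of_real_sum complex_norm_square cnj_sum sum_product)
  also have "\<dots> = (\<Sum>k<d. \<Sum>j<d. \<Sum>k'<d. (cnj (U j k) * f k) * cnj (cnj (U j k') * f k'))"
    by (rule sum.swap)
  also have "\<dots> = (\<Sum>k<d. \<Sum>k'<d. \<Sum>j<d. (cnj (U j k) * f k) * cnj (cnj (U j k') * f k'))"
    by (rule sum.cong[OF refl], rule sum.swap)
  also have "\<dots> = (\<Sum>k<d. \<Sum>k'<d. f k * cnj (f k') * (\<Sum>j<d. U j k' * cnj (U j k)))"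
    by (simp add: sum_distrib_left ac_simps)
  also have "\<dots> = (\<Sum>k<d. \<Sum>k'<d. if k' = k then f k * cnj (f k) else 0)"
    by (intro sum.cong refl) (auto simp: compl)
  also have "\<dots> = complex_of_real (\<Sum>k<d. (cmod (f k))\<^sup>2)"
    by (simp only: of_real_sum complex_norm_square) simp
  finally show ?thesis by (simp only: of_real_eq_iff)
qed

lemma unitary_parseval_cnj:
  assumes "unitary_on d U"
  shows "(\<Sum>j<d. (cmod (\<Sum>a<d. f a * U j a))\<^sup>2) = (\<Sum>a<d. (cmod (f a))\<^sup>2)"
proof -
  have "cmod (\<Sum>a<d. f a * U j a) = cmod (\<Sum>a<d. cnj (U j a) * cnj (f a))" for j
    using complex_mod_cnj[of "\<Sum>a<d. f a * U j a"] by (simp add: mult.commute)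
  then show ?thesis using unitary_parseval[OF assms, of "\<lambda>a. cnj (f a)"] by simp
qed

text \<open>The spectral theorem in the form used below: eigenvalues listed with repetition form a
  probability vector \<open>t\<close>, and the entropy is the Shannon entropy of \<open>t\<close>.
  Similarity preserves the characteristic polynomial and thereby the entropy.\<close>

lemma density_eigenbasis:
  assumes A: "A \<in> density_ops d"
  obtains U t where "unitary_on d U" "\<And>j. j < d \<Longrightarrow> 0 \<le> t j" "(\<Sum>j<d. t j) = 1"
    "\<And>a b. a < d \<Longrightarrow> b < d \<Longrightarrow> A $$ (a, b) = (\<Sum>j<d. complex_of_real (t j) * U j a * cnj (U j b))"
    "vn_entropy A = - (\<Sum>j<d. t j * log 2 (t j))"
proof -
  have Ac: "A \<in> carrier_mat d d" and Ah: "mat_adjoint A = A"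
    and Ap: "\<And>v. v \<in> carrier_vec d \<Longrightarrow> 0 \<le> Re ((A *\<^sub>v v) \<bullet>c v)"
    and At: "(\<Sum>i<d. A $$ (i, i)) = 1"
    using A by (auto simp: density_ops_def)
  obtain V D where V: "V \<in> carrier_mat d d" "D \<in> carrier_mat d d" "mat_adjoint V * V = 1\<^sub>m d"
    "V * mat_adjoint V = 1\<^sub>m d" "diagonal_mat D" "A = V * D * mat_adjoint V"
    using hermitian_diagonalization[OF Ac Ah] by blast
  have V': "mat_adjoint V \<in> carrier_mat d d" by (rule mat_adjoint_carrier[OF V(1)])
  define U where "U j a = V $$ (a, j)" for j a
  define t where "t j = Re (D $$ (j, j))" for j
  have U: "unitary_on d U"
    unfolding unitary_on_def
  proof (intro conjI allI impI)
    fix i j assume ij: "i < d" "j < d"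
    have "(mat_adjoint V * V) $$ (i, j) = (\<Sum>a<d. cnj (U i a) * U j a)"
      using V(1) V' ij by (auto simp: scalar_prod_def complex_mat_adjoint_index atLeast0LessThan U_def)
    then show "(\<Sum>a<d. cnj (U i a) * U j a) = (if i = j then 1 else 0)" using ij by (simp add: V(3))
  next
    fix i j assume ij: "i < d" "j < d"
    have "(V * mat_adjoint V) $$ (i, j) = (\<Sum>a<d. U a i * cnj (U a j))"
      using V(1) V' ij by (auto simp: scalar_prod_def complex_mat_adjoint_index atLeast0LessThan U_def)
    then show "(\<Sum>a<d. U a i * cnj (U a j)) = (if i = j then 1 else 0)" using ij by (simp add: V(4))
  qed
  have Dv: "D = mat_adjoint V * A * V"
  proof -
    have "mat_adjoint V * A * V = (mat_adjoint V * V) * D * (mat_adjoint V * V)"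
      using V(1,2,6) V' by (simp add: assoc_mult_mat[of _ d d _ d _ d])
    then show ?thesis using V(2) by (simp add: V(3))
  qed
  have Dh: "mat_adjoint D = D"
    using mat_adjoint_mult[OF mult_carrier_mat[OF V' Ac] V(1)] mat_adjoint_mult[OF V' Ac] V(1) V' Ac Ah
    unfolding Dv by (simp add: mat_adjoint_adjoint)
  have Dt: "D $$ (j, j) = complex_of_real (t j)" if j: "j < d" for j
  proof -
    have "D $$ (j, j) = cnj (D $$ (j, j))"
      using complex_mat_adjoint_index[of j D j] V(2) Dh j by auto
    then show ?thesis unfolding t_def by (metis Reals_cnj_iff of_real_Re)
  qed
  have tp: "0 \<le> t j" if j: "j < d" for j
  proof -
    have "D = mat_adjoint V * (A * V)" using Dv V(1) V' Ac by simp
    then have "D $$ (j, j) = row (mat_adjoint V) j \<bullet> (A *\<^sub>v col V j)"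
      using V' Ac j V(1) col_mult2[OF Ac V(1), of j] by (metis carrier_matD index_mult_mat(1,3))
    also have "\<dots> = (A *\<^sub>v col V j) \<bullet>c col V j"
      using V(1) V' Ac j by (auto simp: scalar_prod_def complex_mat_adjoint_index intro!: sum.cong)
    finally show ?thesis using Ap[of "col V j"] V(1) j by (auto simp: t_def)
  qed
  have Aij: "A $$ (a, b) = (\<Sum>j<d. complex_of_real (t j) * U j a * cnj (U j b))"
    if ab: "a < d" "b < d" for a b
  proof -
    have "(\<Sum>x<d. V $$ (a, x) * D $$ (x, j)) = V $$ (a, j) * D $$ (j, j)" if j: "j < d" for j
    proof -
      have "(\<Sum>x<d. V $$ (a, x) * D $$ (x, j)) = (\<Sum>x<d. if x = j then V $$ (a, j) * D $$ (j, j) else 0)"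
        using V(2,5) j by (intro sum.cong refl) (auto simp: diagonal_mat_def)
      then show ?thesis using j by simp
    qed
    then show ?thesis
      using conj_by_index[OF V(1,2) ab] V(6) by (simp add: Dt U_def ac_simps)
  qed
  have "(\<Sum>i<d. A $$ (i, i)) = (\<Sum>i<d. \<Sum>j<d. complex_of_real (t j) * (cnj (U j i) * U j i))"
    by (simp add: Aij ac_simps)
  also have "\<dots> = (\<Sum>j<d. complex_of_real (t j) * (\<Sum>i<d. cnj (U j i) * U j i))"
    by (subst sum.swap) (simp add: sum_distrib_left)
  also have "\<dots> = complex_of_real (\<Sum>j<d. t j)" using U by (simp add: unitary_on_def)
  finally have "(\<Sum>j<d. t j) = 1" using At of_real_eq_1_iff by metis
  moreover have "vn_entropy A = - (\<Sum>j<d. t j * log 2 (t j))"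
  proof -
    have "similar_mat A D"
      unfolding similar_mat_def using V V' Ac similar_mat_witI[OF V(4,3,6) Ac V(2,1) V'] by blast
    then have "char_poly A = char_poly D" by (rule char_poly_similar)
    with char_poly_diagonal[OF V(2,5)] have "vn_entropy A = vn_entropy D"
      using vn_entropy_char_poly[OF Ac] vn_entropy_char_poly[OF V(2)] by metis
    then show ?thesis using vn_entropy_diagonal[OF V(2,5)] by (simp add: t_def)
  qed
  ultimately show ?thesis using that U tp Aij by blast
qed

text \<open>Columns of \<open>W\<close> are eigenvectors scaled by square roots of eigenvalues. They
  can be read as amplitudes of a purification with reference index \<open>m\<close>, on which Kraus
  operators act linearly.\<close>

lemma density_gram:
  assumes "A \<in> density_ops d"
  obtains W where "\<And>a b. a < d \<Longrightarrow> b < d \<Longrightarrow> A $$ (a, b) = (\<Sum>m<d. W a m * cnj (W b m))"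
    "(\<Sum>a<d. \<Sum>m<d. (cmod (W a m))\<^sup>2) = 1"
proof -
  obtain U t where U: "unitary_on d U" "\<And>j. j < d \<Longrightarrow> 0 \<le> t j" "(\<Sum>j<d. t j) = 1"
    "\<And>a b. a < d \<Longrightarrow> b < d \<Longrightarrow> A $$ (a, b) = (\<Sum>j<d. complex_of_real (t j) * U j a * cnj (U j b))"
    "vn_entropy A = - (\<Sum>j<d. t j * log 2 (t j))"
    by (rule density_eigenbasis[OF assms], rule that)
  define W where "W a m = complex_of_real (sqrt (t m)) * U m a" for a m
  have sq: "complex_of_real (sqrt (t m)) * complex_of_real (sqrt (t m)) = complex_of_real (t m)"
    if "m < d" for m using U(2)[OF that] by (simp flip: of_real_mult)
  have AW: "A $$ (a, b) = (\<Sum>m<d. W a m * cnj (W b m))" if "a < d" "b < d" for a b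
    unfolding U(4)[OF that]
  proof (rule sum.cong[OF refl])
    fix m assume "m \<in> {..<d}"
    then have "complex_of_real (t m) * U m a * cnj (U m b)
        = (complex_of_real (sqrt (t m)) * complex_of_real (sqrt (t m))) * U m a * cnj (U m b)"
      by (simp only: sq lessThan_iff)
    then show "complex_of_real (t m) * U m a * cnj (U m b) = W a m * cnj (W b m)"
      by (simp only: W_def complex_cnj_mult complex_cnj_complex_of_real ac_simps)
  qed
  have "complex_of_real (\<Sum>a<d. \<Sum>m<d. (cmod (W a m))\<^sup>2) = (\<Sum>a<d. A $$ (a, a))"
    unfolding of_real_sum complex_norm_square by (simp add: AW)
  also have "\<dots> = 1" using assms by (simp add: density_ops_def)
  finally have "(\<Sum>a<d. \<Sum>m<d. (cmod (W a m))\<^sup>2) = 1" using of_real_eq_1_iff by blast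
  with AW show ?thesis using that by blast
qed

text \<open>A Gram matrix is positive because its quadratic form is a sum of squared moduli. The
  index set \<open>S\<close> is left free so that pairs of a Kraus index and a reference index
  fit.\<close>

lemma density_opsI_gram:
  assumes M: "M \<in> carrier_mat d d"
    and MW: "\<And>i j. i < d \<Longrightarrow> j < d \<Longrightarrow> M $$ (i, j) = (\<Sum>x\<in>S. W i x * cnj (W j x))"
    and W1: "(\<Sum>i<d. \<Sum>x\<in>S. (cmod (W i x))\<^sup>2) = 1"
  shows "M \<in> density_ops d"
proof -
  have "mat_adjoint M = M"
    using mat_adjoint_carrier[OF M] M
    by (intro eq_matI) (auto simp: complex_mat_adjoint_index MW ac_simps)
  moreover have "0 \<le> Re ((M *\<^sub>v v) \<bullet>c v)" if v: "v \<in> carrier_vec d" for v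
  proof -
    have "(M *\<^sub>v v) \<bullet>c v = (\<Sum>i<d. (\<Sum>j<d. M $$ (i, j) * v $ j) * cnj (v $ i))"
      using M v by (auto simp: scalar_prod_def atLeast0LessThan intro!: sum.cong)
    also have "\<dots> = (\<Sum>i<d. \<Sum>j<d. \<Sum>x\<in>S. (cnj (v $ i) * W i x) * cnj (cnj (v $ j) * W j x))"
      by (simp add: MW sum_distrib_left sum_distrib_right ac_simps)
    also have "\<dots> = (\<Sum>i<d. \<Sum>x\<in>S. \<Sum>j<d. (cnj (v $ i) * W i x) * cnj (cnj (v $ j) * W j x))"
      by (intro sum.cong refl sum.swap)
    also have "\<dots> = (\<Sum>x\<in>S. \<Sum>i<d. \<Sum>j<d. (cnj (v $ i) * W i x) * cnj (cnj (v $ j) * W j x))"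
      by (rule sum.swap)
    also have "\<dots> = (\<Sum>x\<in>S. complex_of_real ((cmod (\<Sum>i<d. cnj (v $ i) * W i x))\<^sup>2))"
      by (simp only: complex_norm_square cnj_sum sum_product)
    finally show ?thesis by (simp add: sum_nonneg flip: of_real_sum of_real_power)
  qed
  moreover have "(\<Sum>i<d. M $$ (i, i)) = 1"
  proof -
    have "(\<Sum>i<d. M $$ (i, i)) = complex_of_real (\<Sum>i<d. \<Sum>x\<in>S. (cmod (W i x))\<^sup>2)"
      unfolding of_real_sum complex_norm_square by (simp add: MW)
    then show ?thesis by (simp add: W1)
  qed
  ultimately show ?thesis using M by (simp add: density_ops_def)
qed

lemma density_diagonal:
  assumes "D \<in> carrier_mat d d" "diagonal_mat D" "\<And>i. i < d \<Longrightarrow> D $$ (i, i) = complex_of_real (p i)"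
    "\<And>i. i < d \<Longrightarrow> 0 \<le> p i" "(\<Sum>i<d. p i) = 1"
  shows "D \<in> density_ops d"
proof (rule density_opsI_gram[OF assms(1)])
  let ?W = "\<lambda>i x. if i = x then complex_of_real (sqrt (p i)) else 0"
  show "D $$ (i, j) = (\<Sum>x<d. ?W i x * cnj (?W j x))" if "i < d" "j < d" for i j
  proof -
    have "(\<Sum>x<d. ?W i x * cnj (?W j x)) = (\<Sum>x<d. if x = i then ?W i i * cnj (?W j i) else 0)"
      by (intro sum.cong) auto
    also have "\<dots> = D $$ (i, j)"
      using assms that by (auto simp: diagonal_mat_def simp flip: of_real_mult)
    finally show ?thesis by simp
  qed
  have "(\<Sum>i<d. \<Sum>x<d. (cmod (?W i x))\<^sup>2) = (\<Sum>i<d. \<Sum>x<d. if x = i then p i else 0)"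
    using assms(4) by (intro sum.cong refl) auto
  also have "\<dots> = 1" using assms(5) by simp
  finally show "(\<Sum>i<d. \<Sum>x<d. (cmod (?W i x))\<^sup>2) = 1" .
qed

lemma log2_nonpos: "0 \<le> x \<Longrightarrow> x \<le> 1 \<Longrightarrow> log 2 x \<le> 0"
  by (cases "x = 0") (simp_all add: log_le_zero_cancel_iff, simp add: log_def)

text \<open>Expectation of \<open>A\<close> in the vector \<open>u\<close>. It is applied twice to
  the same state, with an eigenbasis and with amplitudes coming from Kraus operators; comparing the
  two yields the marginals of the joint distributions below.\<close>

lemma quadratic_form_gram:
  assumes "\<And>a b. a < d \<Longrightarrow> b < d \<Longrightarrow> A $$ (a, b) = (\<Sum>x\<in>S. complex_of_real (c x) * W a x * cnj (W b x))"
  shows "(\<Sum>a<d. \<Sum>b<d. cnj (u a) * A $$ (a, b) * u b)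
    = complex_of_real (\<Sum>x\<in>S. c x * (cmod (\<Sum>a<d. cnj (u a) * W a x))\<^sup>2)"
proof -
  have "(\<Sum>a<d. \<Sum>b<d. cnj (u a) * A $$ (a, b) * u b)
      = (\<Sum>a<d. \<Sum>b<d. \<Sum>x\<in>S. complex_of_real (c x) * ((cnj (u a) * W a x) * cnj (cnj (u b) * W b x)))"
    by (simp add: assms sum_distrib_left sum_distrib_right ac_simps)
  also have "\<dots> = (\<Sum>a<d. \<Sum>x\<in>S. \<Sum>b<d. complex_of_real (c x) * ((cnj (u a) * W a x) * cnj (cnj (u b) * W b x)))"
    by (rule sum.cong[OF refl], rule sum.swap)
  also have "\<dots> = (\<Sum>x\<in>S. \<Sum>a<d. \<Sum>b<d. complex_of_real (c x) * ((cnj (u a) * W a x) * cnj (cnj (u b) * W b x)))"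
    by (rule sum.swap)
  also have "\<dots> = complex_of_real (\<Sum>x\<in>S. c x * (cmod (\<Sum>a<d. cnj (u a) * W a x))\<^sup>2)"
    by (simp only: of_real_sum of_real_mult complex_norm_square cnj_sum sum_product)
      (simp only: sum_distrib_left)
  finally show ?thesis .
qed

text \<open>Klein's inequality against an operator with eigenbasis \<open>F\<close> and eigenvalues
  \<open>s\<close>. Eigenvalues of \<open>A\<close> times squared overlaps of the two bases form a
  joint distribution; Jensen for the ratio \<open>s b / t j\<close> leaves a sum of \<open>s\<close>
  weighted by a doubly stochastic matrix. The support hypothesis excludes an infinite relative
  entropy, which a total logarithm would hide.\<close>

lemma vn_entropy_le_cross_entropy:
  assumes A: "A \<in> density_ops d" and F: "unitary_on d F"
    and s: "\<And>b. b < d \<Longrightarrow> 0 \<le> s b" "(\<Sum>b<d. s b) \<le> 1"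
    and q: "\<And>b. b < d \<Longrightarrow> complex_of_real (q b) = (\<Sum>a<d. \<Sum>a'<d. cnj (F b a) * A $$ (a, a') * F b a')"
    and supp: "\<And>b. b < d \<Longrightarrow> s b = 0 \<Longrightarrow> q b = 0"
  shows "vn_entropy A \<le> - (\<Sum>b<d. q b * log 2 (s b))"
proof -
  obtain U t where U: "unitary_on d U" "\<And>j. j < d \<Longrightarrow> 0 \<le> t j" "(\<Sum>j<d. t j) = 1"
    "\<And>a b. a < d \<Longrightarrow> b < d \<Longrightarrow> A $$ (a, b) = (\<Sum>j<d. complex_of_real (t j) * U j a * cnj (U j b))"
    "vn_entropy A = - (\<Sum>j<d. t j * log 2 (t j))"
    by (rule density_eigenbasis[OF A], rule that)
  define c where "c j b = (\<Sum>a<d. cnj (F b a) * U j a)" for j b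
  define w where "w j b = t j * (cmod (c j b))\<^sup>2" for j b
  have wnn: "0 \<le> w j b" if "j < d" for j b using U(2)[OF that] by (simp add: w_def)
  have c1: "(\<Sum>b<d. (cmod (c j b))\<^sup>2) = 1" if j: "j < d" for j
    unfolding c_def unitary_parseval[OF F] by (rule unitary_norm[OF U(1) j])
  have c2: "(\<Sum>j<d. (cmod (c j b))\<^sup>2) = 1" if b: "b < d" for b
    unfolding c_def unitary_parseval_cnj[OF U(1)] complex_mod_cnj by (rule unitary_norm[OF F b])
  have qw: "q b = (\<Sum>j<d. w j b)" if b: "b < d" for b
  proof -
    have "complex_of_real (q b) = complex_of_real (\<Sum>j<d. w j b)"
      unfolding q[OF b] w_def c_def by (rule quadratic_form_gram) (rule U(4))
    then show ?thesis by (simp only: of_real_eq_iff)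
  qed
  have tw: "t j = (\<Sum>b<d. w j b)" if "j < d" for j
    using c1[OF that] by (simp add: w_def flip: sum_distrib_left)
  let ?S = "{..<d} \<times> {..<d}"
  have pos: "0 < t (fst x)" "0 < s (snd x)" if "x \<in> ?S" "0 < w (fst x) (snd x)" for x
  proof -
    show "0 < t (fst x)" using that U(2)[of "fst x"] by (auto simp: w_def zero_less_mult_iff)
    have "q (snd x) \<noteq> 0"
      using that qw[of "snd x"] wnn sum_pos2[of "{..<d}" "fst x" "\<lambda>j. w j (snd x)"] by auto
    then show "0 < s (snd x)" using s(1)[of "snd x"] supp[of "snd x"] that by (auto simp: less_le)
  qed
  have "vn_entropy A + (\<Sum>b<d. q b * log 2 (s b))
      = (\<Sum>b<d. \<Sum>j<d. w j b * log 2 (s b)) - (\<Sum>j<d. \<Sum>b<d. w j b * log 2 (t j))"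
    by (simp add: U(5) qw tw[symmetric] flip: sum_distrib_right)
  also have "(\<Sum>b<d. \<Sum>j<d. w j b * log 2 (s b)) = (\<Sum>j<d. \<Sum>b<d. w j b * log 2 (s b))"
    by (rule sum.swap)
  also have "\<dots> - (\<Sum>j<d. \<Sum>b<d. w j b * log 2 (t j))
      = (\<Sum>x\<in>?S. w (fst x) (snd x) * log 2 (s (snd x)) - w (fst x) (snd x) * log 2 (t (fst x)))"
    by (simp add: sum.cartesian_product split_def sum_subtractf)
  also have "\<dots> = (\<Sum>x\<in>?S. w (fst x) (snd x) * log 2 (s (snd x) / t (fst x)))"
  proof (rule sum.cong[OF refl])
    fix x assume x: "x \<in> ?S"
    show "w (fst x) (snd x) * log 2 (s (snd x)) - w (fst x) (snd x) * log 2 (t (fst x))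
      = w (fst x) (snd x) * log 2 (s (snd x) / t (fst x))"
    proof (cases "w (fst x) (snd x) = 0")
      case False
      then have "0 < w (fst x) (snd x)" using x wnn[of "fst x" "snd x"] by auto
      from pos[OF x this] show ?thesis by (simp add: log_divide algebra_simps)
    qed simp
  qed
  also have "\<dots> \<le> log 2 (\<Sum>x\<in>?S. w (fst x) (snd x) * (s (snd x) / t (fst x)))"
  proof (rule sum_weighted_log_le)
    show "(\<Sum>x\<in>?S. w (fst x) (snd x)) = 1"
      using U(3) tw by (simp add: sum.cartesian_product split_def)
  qed (use wnn pos in auto)
  also have "\<dots> \<le> 0"
  proof -
    \<comment> \<open>Where \<open>t\<close> vanishes, the quotient by 0 is 0, so cancelling
      \<open>t\<close> gives only an inequality.\<close>
    have le: "w (fst x) (snd x) * (s (snd x) / t (fst x)) \<le> (cmod (c (fst x) (snd x)))\<^sup>2 * s (snd x)"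
      and ge: "0 \<le> w (fst x) (snd x) * (s (snd x) / t (fst x))" if "x \<in> ?S" for x
      using U(2)[of "fst x"] s(1)[of "snd x"] that by (cases "t (fst x) = 0"; auto simp: w_def)+
    have "(\<Sum>x\<in>?S. w (fst x) (snd x) * (s (snd x) / t (fst x)))
        \<le> (\<Sum>x\<in>?S. (cmod (c (fst x) (snd x)))\<^sup>2 * s (snd x))"
      using le by (rule sum_mono)
    also have "\<dots> = (\<Sum>b<d. \<Sum>j<d. (cmod (c j b))\<^sup>2 * s b)"
      by (subst sum.swap) (simp add: sum.cartesian_product split_def)
    also have "\<dots> = (\<Sum>b<d. s b)" using c2 by (simp flip: sum_distrib_right)
    finally have "(\<Sum>x\<in>?S. w (fst x) (snd x) * (s (snd x) / t (fst x))) \<le> 1" using s(2) by simp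
    moreover have "0 \<le> (\<Sum>x\<in>?S. w (fst x) (snd x) * (s (snd x) / t (fst x)))"
      using ge by (rule sum_nonneg)
    ultimately show ?thesis by (simp only: log2_nonpos)
  qed
  finally show ?thesis by simp
qed

lemma unitary_on_standard: "unitary_on d (\<lambda>b a. if a = b then 1 else 0)"
  unfolding unitary_on_def
proof (intro conjI allI impI)
  fix i j assume "i < d" "j < d"
  have "(\<Sum>a<d. cnj (if a = i then 1 else 0) * (if a = j then 1 else 0))
      = (\<Sum>a<d. if a = i then (if i = j then 1 else 0) else 0 :: complex)"
    by (intro sum.cong) auto
  then show "(\<Sum>a<d. cnj (if a = i then 1 else 0) * (if a = j then 1 else 0)) = (if i = j then 1 else 0 :: complex)"
    using \<open>i < d\<close> by simp
  have "(\<Sum>a<d. (if i = a then 1 else 0) * cnj (if j = a then 1 else 0))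
      = (\<Sum>a<d. if a = i then (if i = j then 1 else 0) else 0 :: complex)"
    by (intro sum.cong) auto
  then show "(\<Sum>a<d. (if i = a then 1 else 0) * cnj (if j = a then 1 else 0)) = (if i = j then 1 else 0 :: complex)"
    using \<open>i < d\<close> by simp
qed

lemma density_diag:
  assumes "A \<in> density_ops d"
  shows "b < d \<Longrightarrow> A $$ (b, b) = complex_of_real (Re (A $$ (b, b)))"
    "b < d \<Longrightarrow> 0 \<le> Re (A $$ (b, b))" "(\<Sum>b<d. Re (A $$ (b, b))) = 1"
proof -
  obtain W where W: "\<And>a b. a < d \<Longrightarrow> b < d \<Longrightarrow> A $$ (a, b) = (\<Sum>m<d. W a m * cnj (W b m))"
    "(\<Sum>a<d. \<Sum>m<d. (cmod (W a m))\<^sup>2) = 1"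
    by (rule density_gram[OF assms], rule that)
  have *: "A $$ (b, b) = complex_of_real (\<Sum>m<d. (cmod (W b m))\<^sup>2)" if "b < d" for b
    using W(1)[OF that that] by (simp only: of_real_sum complex_norm_square)
  show "b < d \<Longrightarrow> A $$ (b, b) = complex_of_real (Re (A $$ (b, b)))" using * by auto
  show "b < d \<Longrightarrow> 0 \<le> Re (A $$ (b, b))" using * by (simp add: sum_nonneg del: of_real_sum)
  show "(\<Sum>b<d. Re (A $$ (b, b))) = 1"
    using assms by (simp add: density_ops_def flip: Re_sum)
qed

text \<open>The standard basis. With \<open>s\<close> the diagonal of \<open>A\<close> this says
  that dephasing does not decrease entropy; other choices of \<open>s\<close> compare with a fixed
  diagonal state.\<close>

lemma vn_entropy_le_diagonal_cross_entropy:
  assumes A: "A \<in> density_ops d"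
    and s: "\<And>b. b < d \<Longrightarrow> 0 \<le> s b" "(\<Sum>b<d. s b) \<le> 1"
    and supp: "\<And>b. b < d \<Longrightarrow> s b = 0 \<Longrightarrow> Re (A $$ (b, b)) = 0"
  shows "vn_entropy A \<le> - (\<Sum>b<d. Re (A $$ (b, b)) * log 2 (s b))"
proof (rule vn_entropy_le_cross_entropy[OF A unitary_on_standard s _ supp])
  fix b assume b: "b < d"
  have "(\<Sum>a<d. \<Sum>a'<d. cnj (if a = b then 1 else 0) * A $$ (a, a') * (if a' = b then 1 else 0))
      = (\<Sum>a<d. if a = b then A $$ (a, b) else 0)"
  proof (rule sum.cong[OF refl])
    fix a
    have "(\<Sum>a'<d. cnj (if a = b then 1 else 0) * A $$ (a, a') * (if a' = b then 1 else 0))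
        = (\<Sum>a'<d. if a' = b then (if a = b then A $$ (a, b) else 0) else 0)"
      by (intro sum.cong) auto
    then show "(\<Sum>a'<d. cnj (if a = b then 1 else 0) * A $$ (a, a') * (if a' = b then 1 else 0))
        = (if a = b then A $$ (a, b) else 0)" using b by simp
  qed
  then show "complex_of_real (Re (A $$ (b, b)))
      = (\<Sum>a<d. \<Sum>a'<d. cnj (if a = b then 1 else 0) * A $$ (a, a') * (if a' = b then 1 else 0))"
    using b density_diag(1)[OF A b] by simp
qed

subsection \<open>Cyclicity of the nonzero spectrum\<close>

text \<open>Sylvester's identity through the block matrix \<open>M\<close> with blocks
  \<open>X\<close>, \<open>A\<close>, \<open>B\<close> and 1. Multiplying by \<open>N\<close> on the
  right exposes \<open>X - A B\<close>, multiplying by \<open>L\<close> on the left exposes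
  \<open>X - B A\<close>; the determinants then differ by the powers of \<open>X\<close> that
  account for the two dimensions.\<close>

lemma char_poly_mult_swap:
  fixes A B :: "complex mat"
  assumes A: "A \<in> carrier_mat m n" and B: "B \<in> carrier_mat n m"
  shows "[:0, 1:] ^ n * char_poly (A * B) = [:0, 1:] ^ m * char_poly (B * A)"
proof -
  define l where "l = map_mat (\<lambda>a :: complex. [:a:])"
  let ?X = "[:0, 1:] :: complex poly"
  have lc: "l M \<in> carrier_mat r c" if "M \<in> carrier_mat r c" for M r c using that by (simp add: l_def)
  have lm: "l (M * N) = l M * l N" if "M \<in> carrier_mat r k" "N \<in> carrier_mat k c" for M N r k c
  proof -
    have pc: "(\<Sum>i\<in>S. [:f i:]) = [:sum f S:]" for f :: "nat \<Rightarrow> complex" and S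
      by (induction S rule: infinite_finite_induct) auto
    show ?thesis using that
      by (intro eq_matI) (auto simp: l_def scalar_prod_def pc[symmetric] mult.commute)
  qed
  have cp: "char_poly M = det (?X \<cdot>\<^sub>m 1\<^sub>m k - l M)" if "M \<in> carrier_mat k k" for M k
    unfolding char_poly_def char_poly_matrix_def l_def
    using that by (intro arg_cong[where f = det] eq_matI) auto
  define M where "M = four_block_mat (?X \<cdot>\<^sub>m 1\<^sub>m m) (l A) (l B) (1\<^sub>m n)"
  define N where "N = four_block_mat (1\<^sub>m m) (0\<^sub>m m n) (- l B) (1\<^sub>m n)"
  define L where "L = four_block_mat (1\<^sub>m m) (0\<^sub>m m n) (- l B) (?X \<cdot>\<^sub>m 1\<^sub>m n)"
  note lA = lc[OF A] and lB = lc[OF B]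
  have c: "M \<in> carrier_mat (m + n) (m + n)" "N \<in> carrier_mat (m + n) (m + n)" "L \<in> carrier_mat (m + n) (m + n)"
    using lA lB by (auto simp: M_def N_def L_def)
  have dN: "det N = 1"
    unfolding N_def using lB by (subst det_four_block_mat_upper_right_zero[of _ m _ n]) auto
  have dL: "det L = ?X ^ n"
    unfolding L_def using lB by (subst det_four_block_mat_upper_right_zero[of _ m _ n]) (auto simp: det_smult)
  have "M * N = four_block_mat (?X \<cdot>\<^sub>m 1\<^sub>m m - l A * l B) (l A) (0\<^sub>m n m) (1\<^sub>m n)"
    unfolding M_def N_def using lA lB
    by (subst mult_four_block_mat[of _ m m _ n _ n])
      (auto intro!: cong_four_block_mat eq_matI)
  also have "det \<dots> = char_poly (A * B)"
    using lA lB A B by (subst det_four_block_mat_lower_left_zero[of _ m _ n]) (auto simp: cp[of _ m] lm[OF A B])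
  finally have MN: "det M = char_poly (A * B)" using det_mult[OF c(1,2)] dN by simp
  have "L * M = four_block_mat (?X \<cdot>\<^sub>m 1\<^sub>m m) (l A) (0\<^sub>m n m) (?X \<cdot>\<^sub>m 1\<^sub>m n - l B * l A)"
    unfolding M_def L_def using lA lB
    by (subst mult_four_block_mat[of _ m m _ n _ n])
      (auto intro!: cong_four_block_mat eq_matI)
  also have "det \<dots> = ?X ^ m * char_poly (B * A)"
    using lA lB A B by (subst det_four_block_mat_lower_left_zero[of _ m _ n])
      (auto simp: cp[of _ n] lm[OF B A] det_smult)
  finally show ?thesis using det_mult[OF c(3,1)] dL MN by simp
qed

text \<open>Away from zero both characteristic polynomials have the same roots with the same
  multiplicities, and the eigenvalue 0 contributes nothing to the entropy. This is what gives the
  two halves of a pure bipartite state equal entropy.\<close>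

lemma vn_entropy_mult_swap:
  assumes A: "A \<in> carrier_mat m n" and B: "B \<in> carrier_mat n m"
  shows "vn_entropy (A * B) = vn_entropy (B * A)"
proof -
  have AB: "A * B \<in> carrier_mat m m" and BA: "B * A \<in> carrier_mat n n" using A B by auto
  have nz: "char_poly (A * B) \<noteq> 0" "char_poly (B * A) \<noteq> 0"
    using degree_monic_char_poly[OF AB] degree_monic_char_poly[OF BA] by auto
  have ord: "order x (char_poly (A * B)) = order x (char_poly (B * A))" if x: "x \<noteq> 0" for x
  proof -
    have o0: "order x ([:0, 1:] ^ k) = 0" for k using x by (intro order_0I) (simp add: poly_power)
    have "order x ([:0, 1:] ^ n * char_poly (A * B)) = order x ([:0, 1:] ^ m * char_poly (B * A))"
      by (simp only: char_poly_mult_swap[OF A B])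
    then show ?thesis using nz by (simp add: order_mult o0 del: mult_pCons_left)
  qed
  have "spectrum M - {0} = {x. x \<noteq> 0 \<and> order x (char_poly M) \<noteq> 0}"
    if "M \<in> carrier_mat k k" "char_poly M \<noteq> 0" for M :: "complex mat" and k
    using that(2) by (auto simp: spectrum_root_char_poly[OF that(1)] order_root)
  note sp' = this[OF AB nz(1)] this[OF BA nz(2)]
  have sp: "spectrum (A * B) - {0} = spectrum (B * A) - {0}"
    unfolding sp' by (rule Collect_cong, rule conj_cong[OF refl]) (simp add: ord)
  have "vn_entropy M = - (\<Sum>x\<in>spectrum M - {0}. real (order x (char_poly M)) * (Re x * log 2 (Re x)))"
    if "M \<in> carrier_mat k k" for M :: "complex mat" and k
    unfolding vn_entropy_def neg_equal_iff_equal
    by (rule sum.mono_neutral_right[OF card_finite_spectrum(1)[OF that]]) auto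
  note eq = this[OF AB] this[OF BA]
  show ?thesis
    unfolding eq sp neg_equal_iff_equal by (rule sum.cong[OF refl]) (simp add: ord)
qed

subsection \<open>Kraus families\<close>

lemma kron_carrier:
  "E \<in> carrier_mat m n \<Longrightarrow> F \<in> carrier_mat m' n' \<Longrightarrow> kron E F \<in> carrier_mat (m * m') (n * n')"
  by (auto simp: kron_def)

lemma kron_index:
  assumes "E \<in> carrier_mat m n" "F \<in> carrier_mat m' n'" "i < m" "j < n" "k < m'" "l < n'"
  shows "kron E F $$ (i * m' + k, j * n' + l) = E $$ (i, j) * F $$ (k, l)"
  using assms pair_index_less[of i m k m'] pair_index_less[of j n l n']
  by (auto simp: kron_def)

lemma tensor_length: "length (tensor Es Fs) = length Es * length Fs"
  by (induction Es) (auto simp: tensor_def comp_def)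

lemma tensor_nth:
  assumes "i < length Es" "j < length Fs"
  shows "tensor Es Fs ! (i * length Fs + j) = kron (Es ! i) (Fs ! j)"
  using assms(1)
proof (induction Es arbitrary: i)
  case (Cons E Es)
  have split: "tensor (E # Es) Fs = map (kron E) Fs @ tensor Es Fs"
    by (simp add: tensor_def)
  show ?case
  proof (cases i)
    case 0
    then show ?thesis using assms(2) by (simp add: split nth_append)
  next
    case (Suc i')
    then have "i * length Fs + j = length (map (kron E) Fs) + (i' * length Fs + j)" by simp
    then show ?thesis using Cons Suc by (simp only: split nth_append_length_plus) simp
  qed
qed simp

lemma tensor_carrier:
  assumes "set Es \<subseteq> carrier_mat m n" "set Fs \<subseteq> carrier_mat m' n'"
  shows "set (tensor Es Fs) \<subseteq> carrier_mat (m * m') (n * n')"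
  using assms by (auto simp: tensor_def intro!: kron_carrier)

lemma tensor_index:
  assumes "set Es \<subseteq> carrier_mat m n" "set Fs \<subseteq> carrier_mat m' n'"
    "k < length Es" "l < length Fs" "i < m" "i' < m'" "a < n" "a' < n'"
  shows "(tensor Es Fs ! (k * length Fs + l)) $$ (i * m' + i', a * n' + a')
    = (Es ! k) $$ (i, a) * (Fs ! l) $$ (i', a')"
proof -
  have "Es ! k \<in> carrier_mat m n" "Fs ! l \<in> carrier_mat m' n'"
    using assms nth_mem by blast+
  then show ?thesis using assms by (simp add: tensor_nth kron_index)
qed

lemma tensor_power_length: "length (tensor_power Es N) = length Es ^ N"
  by (induction N) (auto simp: tensor_length id_channel_def)

lemma tensor_power_carrier:
  "set Es \<subseteq> carrier_mat m n \<Longrightarrow> set (tensor_power Es N) \<subseteq> carrier_mat (m ^ N) (n ^ N)"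
proof (induction N)
  case (Suc N)
  then show ?case using tensor_carrier[of Es m n "tensor_power Es N" "m ^ N" "n ^ N"] by simp
qed (simp add: id_channel_def)

lemma tensor_power_Suc_index:
  assumes "set Es \<subseteq> carrier_mat m n" "k < length Es" "l < length Es ^ N"
    "i < m" "i' < m ^ N" "a < n" "a' < n ^ N"
  shows "(tensor_power Es (Suc N) ! (k * length Es ^ N + l)) $$ (i * m ^ N + i', a * n ^ N + a')
    = (Es ! k) $$ (i, a) * (tensor_power Es N ! l) $$ (i', a')"
  using tensor_index[OF assms(1) tensor_power_carrier[OF assms(1), of N], of k l i i' a a'] assms
  by (simp add: tensor_power_length)

text \<open>Entrywise form of V^dagger V = 1 for the Stinespring isometry. Dimensions are parameters
  rather than being read off the head of the list, so that powers such as \<open>m ^ N\<close> can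
  be supplied directly for tensor powers and complements.\<close>

definition kraus_isometry :: "nat \<Rightarrow> nat \<Rightarrow> kraus \<Rightarrow> bool" where
  "kraus_isometry m n Es \<longleftrightarrow> Es \<noteq> [] \<and> set Es \<subseteq> carrier_mat m n \<and>
     (\<forall>a<n. \<forall>a'<n. (\<Sum>i<m. \<Sum>k<length Es. cnj ((Es ! k) $$ (i, a)) * (Es ! k) $$ (i, a')) = (if a = a' then 1 else 0))"

lemma kraus_isometry_dims:
  assumes "kraus_isometry m n Es"
  shows "dim_out Es = m" "dim_in Es = n" "Es \<noteq> []" "set Es \<subseteq> carrier_mat m n"
proof -
  show ne: "Es \<noteq> []" by (rule conjunct1[OF assms[unfolded kraus_isometry_def]])
  show sub: "set Es \<subseteq> carrier_mat m n"
    by (rule conjunct1[OF conjunct2[OF assms[unfolded kraus_isometry_def]]])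
  from ne sub have "hd Es \<in> carrier_mat m n" by (meson hd_in_set subset_iff)
  then show "dim_out Es = m" "dim_in Es = n" by (simp_all add: dim_out_def dim_in_def)
qed

lemma is_channel_kraus_isometry:
  assumes "is_channel Es"
  shows "kraus_isometry (dim_out Es) (dim_in Es) Es"
proof -
  let ?m = "dim_out Es" and ?n = "dim_in Es"
  have sub: "set Es \<subseteq> carrier_mat ?m ?n" and ne: "Es \<noteq> []"
    and one: "msum ?n (map (\<lambda>E. mat_adjoint E * E) Es) = 1\<^sub>m ?n"
    using assms by (auto simp: is_channel_def)
  have car: "mat_adjoint E * E \<in> carrier_mat ?n ?n" if "E \<in> set Es" for E
    using sub that mat_adjoint_carrier[of E ?m ?n] by auto
  have "(\<Sum>i<?m. \<Sum>k<length Es. cnj ((Es ! k) $$ (i, a)) * (Es ! k) $$ (i, a')) = (if a = a' then 1 else 0)"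
    if a: "a < ?n" "a' < ?n" for a a'
  proof -
    have "(if a = a' then 1 else 0) = msum ?n (map (\<lambda>E. mat_adjoint E * E) Es) $$ (a, a')"
      using a by (simp add: one)
    also have "\<dots> = (\<Sum>E\<leftarrow>Es. (mat_adjoint E * E) $$ (a, a'))"
      using car a by (subst msum_index) (auto simp: comp_def)
    also have "\<dots> = (\<Sum>k<length Es. (mat_adjoint (Es ! k) * (Es ! k)) $$ (a, a'))"
      by (simp add: sum_list_sum_nth atLeast0LessThan)
    also have "\<dots> = (\<Sum>k<length Es. \<Sum>i<?m. cnj ((Es ! k) $$ (i, a)) * (Es ! k) $$ (i, a'))"
    proof (rule sum.cong[OF refl])
      fix k assume "k \<in> {..<length Es}"
      then have c: "Es ! k \<in> carrier_mat ?m ?n" using sub by auto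
      then show "(mat_adjoint (Es ! k) * (Es ! k)) $$ (a, a') = (\<Sum>i<?m. cnj ((Es ! k) $$ (i, a)) * (Es ! k) $$ (i, a'))"
        using mat_adjoint_carrier[OF c] a
        by (auto simp: scalar_prod_def complex_mat_adjoint_index atLeast0LessThan)
    qed
    finally show ?thesis by (subst sum.swap) simp
  qed
  then show ?thesis using sub ne by (simp add: kraus_isometry_def)
qed

lemma kraus_isometry_tensor:
  assumes E: "kraus_isometry m n Es" and F: "kraus_isometry m' n' Fs"
  shows "kraus_isometry (m * m') (n * n') (tensor Es Fs)"
  unfolding kraus_isometry_def
proof (intro conjI allI impI)
  show "tensor Es Fs \<noteq> []"
    using kraus_isometry_dims(3)[OF E] kraus_isometry_dims(3)[OF F] tensor_length[of Es Fs] by fastforce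
  show "set (tensor Es Fs) \<subseteq> carrier_mat (m * m') (n * n')"
    using E F by (intro tensor_carrier) (auto simp: kraus_isometry_def)
  fix a a' assume a: "a < n * n'" "a' < n * n'"
  have nn: "x div n' < n" "x mod n' < n'" "x = x div n' * n' + x mod n'" if "x < n * n'" for x
    using that by (auto simp: less_mult_imp_div_less) (cases "n' = 0"; simp)
  let ?a0 = "a div n'" and ?a1 = "a mod n'" and ?b0 = "a' div n'" and ?b1 = "a' mod n'"
  have "(\<Sum>i<m * m'. \<Sum>k<length (tensor Es Fs). cnj ((tensor Es Fs ! k) $$ (i, a)) * (tensor Es Fs ! k) $$ (i, a'))
      = (\<Sum>i<m. \<Sum>i'<m'. \<Sum>k<length Es. \<Sum>k'<length Fs.
          (cnj ((Es ! k) $$ (i, ?a0)) * (Es ! k) $$ (i, ?b0)) * (cnj ((Fs ! k') $$ (i', ?a1)) * (Fs ! k') $$ (i', ?b1)))"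
    unfolding sum_lessThan_times tensor_length
  proof (intro sum.cong refl)
    fix i i' k k' assume *: "i \<in> {..<m}" "i' \<in> {..<m'}" "k \<in> {..<length Es}" "k' \<in> {..<length Fs}"
    have idx: "(tensor Es Fs ! (k * length Fs + k')) $$ (i * m' + i', x) = (Es ! k) $$ (i, x div n') * (Fs ! k') $$ (i', x mod n')"
      if "x < n * n'" for x
      using tensor_index[OF kraus_isometry_dims(4)[OF E] kraus_isometry_dims(4)[OF F], of k k' i i' "x div n'" "x mod n'"]
        nn[OF that] * by simp
    show "cnj ((tensor Es Fs ! (k * length Fs + k')) $$ (i * m' + i', a)) * (tensor Es Fs ! (k * length Fs + k')) $$ (i * m' + i', a')
      = (cnj ((Es ! k) $$ (i, ?a0)) * (Es ! k) $$ (i, ?b0)) * (cnj ((Fs ! k') $$ (i', ?a1)) * (Fs ! k') $$ (i', ?b1))"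
      by (simp add: idx a)
  qed
  also have "\<dots> = (\<Sum>i<m. \<Sum>k<length Es. cnj ((Es ! k) $$ (i, ?a0)) * (Es ! k) $$ (i, ?b0))
      * (\<Sum>i'<m'. \<Sum>k'<length Fs. cnj ((Fs ! k') $$ (i', ?a1)) * (Fs ! k') $$ (i', ?b1))"
    by (simp only: sum_product)
  also have "\<dots> = (if ?a0 = ?b0 then 1 else 0) * (if ?a1 = ?b1 then 1 else 0)"
    using E F nn(1,2)[OF a(1)] nn(1,2)[OF a(2)] by (simp add: kraus_isometry_def)
  also have "\<dots> = (if a = a' then 1 else 0)"
  proof -
    have "a = a' \<longleftrightarrow> ?a0 = ?b0 \<and> ?a1 = ?b1" by (metis div_mult_mod_eq)
    then show ?thesis by auto
  qed
  finally show "(\<Sum>i<m * m'. \<Sum>k<length (tensor Es Fs). cnj ((tensor Es Fs ! k) $$ (i, a)) * (tensor Es Fs ! k) $$ (i, a'))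
      = (if a = a' then 1 else 0)" .
qed

lemma kraus_isometry_id: "kraus_isometry d d (id_channel d)"
  unfolding kraus_isometry_def id_channel_def
proof (intro conjI allI impI)
  fix a a' assume "a < d" "a' < d"
  then have "(\<Sum>i<d. \<Sum>k<length [1\<^sub>m d]. cnj (([1\<^sub>m d] ! k) $$ (i, a)) * ([1\<^sub>m d] ! k) $$ (i, a'))
      = (\<Sum>i<d. if i = a then (if a = a' then 1 else 0) else 0 :: complex)"
    by (intro sum.cong) auto
  then show "(\<Sum>i<d. \<Sum>k<length [1\<^sub>m d]. cnj (([1\<^sub>m d] ! k) $$ (i, a)) * ([1\<^sub>m d] ! k) $$ (i, a'))
      = (if a = a' then 1 else 0 :: complex)" using \<open>a < d\<close> by simp
qed auto

lemma kraus_isometry_power: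
  "kraus_isometry m n Es \<Longrightarrow> kraus_isometry (m ^ N) (n ^ N) (tensor_power Es N)"
  using kraus_isometry_id[of 1] by (induction N) (simp_all add: kraus_isometry_tensor)

lemma complementary_length: "length (complementary Es) = dim_out Es"
  by (simp add: complementary_def)

lemma complementary_carrier: "set (complementary Es) \<subseteq> carrier_mat (length Es) (dim_in Es)"
  by (auto simp: complementary_def)

lemma complementary_index:
  assumes "b < dim_out Es" "k < length Es" "a < dim_in Es"
  shows "(complementary Es ! b) $$ (k, a) = (Es ! k) $$ (b, a)"
  using assms by (simp add: complementary_def stinespring_index)

lemma kraus_isometry_complementary:
  assumes "kraus_isometry m n Es" "0 < m"
  shows "kraus_isometry (length Es) n (complementary Es)"
  unfolding kraus_isometry_def
proof (intro conjI allI impI)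
  note d = kraus_isometry_dims[OF assms(1)]
  show "complementary Es \<noteq> []" using complementary_length[of Es] assms(2) d(1) by (metis length_0_conv less_not_refl)
  show "set (complementary Es) \<subseteq> carrier_mat (length Es) n" using complementary_carrier[of Es] d by simp
  fix a a' assume a: "a < n" "a' < n"
  have "(\<Sum>i<length Es. \<Sum>k<length (complementary Es). cnj ((complementary Es ! k) $$ (i, a)) * (complementary Es ! k) $$ (i, a'))
      = (\<Sum>i<length Es. \<Sum>k<m. cnj ((Es ! i) $$ (k, a)) * (Es ! i) $$ (k, a'))"
    unfolding complementary_length d(1)
    using a d(1,2) by (intro sum.cong refl) (simp add: complementary_index)
  also have "\<dots> = (if a = a' then 1 else 0)"
    using assms(1) a by (subst sum.swap) (simp add: kraus_isometry_def)
  finally show "(\<Sum>i<length Es. \<Sum>k<length (complementary Es). cnj ((complementary Es ! k) $$ (i, a)) * (complementary Es ! k) $$ (i, a'))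
      = (if a = a' then 1 else 0)" .
qed

text \<open>The complement exchanges the Kraus index with the output index. Both are composite
  indices built in the same order, so the power of the complement agrees with the complement of the
  power without any permutation of factors.\<close>

lemma complementary_power_index:
  assumes E: "kraus_isometry m n Es"
  shows "b < m ^ N \<Longrightarrow> k < length Es ^ N \<Longrightarrow> a < n ^ N \<Longrightarrow>
    (tensor_power (complementary Es) N ! b) $$ (k, a) = (tensor_power Es N ! k) $$ (b, a)"
proof (induction N arbitrary: b k a)
  case 0
  then show ?case by (simp add: id_channel_def)
next
  case (Suc N)
  note d = kraus_isometry_dims[OF E]
  let ?L = "length Es"
  have dm: "x div y ^ N < y" "x mod y ^ N < y ^ N" "x = x div y ^ N * y ^ N + x mod y ^ N"
    if "x < y ^ Suc N" for x y :: nat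
  proof -
    show "x div y ^ N < y" using that by (simp add: less_mult_imp_div_less)
    have "y ^ N \<noteq> 0" using that by (cases "y = 0") auto
    then show "x mod y ^ N < y ^ N" by simp
  qed (rule div_mult_mod_eq[symmetric])
  have len: "length (complementary Es) = m" and car: "set (complementary Es) \<subseteq> carrier_mat ?L n"
    using complementary_length[of Es] complementary_carrier[of Es] d by auto
  note b = dm[OF Suc.prems(1)] and k = dm[OF Suc.prems(2)] and a = dm[OF Suc.prems(3)]
  have "(tensor_power (complementary Es) (Suc N) ! b) $$ (k, a)
      = (complementary Es ! (b div m ^ N)) $$ (k div ?L ^ N, a div n ^ N)
        * (tensor_power (complementary Es) N ! (b mod m ^ N)) $$ (k mod ?L ^ N, a mod n ^ N)"
    using tensor_power_Suc_index[OF car, of "b div m ^ N" "b mod m ^ N" N "k div ?L ^ N" "k mod ?L ^ N"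
        "a div n ^ N" "a mod n ^ N"] b k a len by simp
  also have "\<dots> = (Es ! (k div ?L ^ N)) $$ (b div m ^ N, a div n ^ N)
        * (tensor_power Es N ! (k mod ?L ^ N)) $$ (b mod m ^ N, a mod n ^ N)"
    using b k a d by (simp add: complementary_index Suc.IH)
  also have "\<dots> = (tensor_power Es (Suc N) ! k) $$ (b, a)"
    using tensor_power_Suc_index[OF d(4), of "k div ?L ^ N" "k mod ?L ^ N" N "b div m ^ N" "b mod m ^ N"
        "a div n ^ N" "a mod n ^ N"] b k a by simp
  finally show ?case .
qed

lemma apply_channel_kraus_carrier:
  assumes "kraus_isometry m n Es" "\<rho> \<in> carrier_mat n n"
  shows "apply_channel Es \<rho> \<in> carrier_mat m m"
  using apply_channel_carrier[of Es \<rho>] kraus_isometry_dims[OF assms(1)] assms(2) by simp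

lemma apply_channel_kraus_index:
  assumes "kraus_isometry m n Es" "\<rho> \<in> carrier_mat n n" "i < m" "j < m"
  shows "apply_channel Es \<rho> $$ (i, j) = (\<Sum>k<length Es.
    \<Sum>b<n. (\<Sum>a<n. (Es ! k) $$ (i, a) * \<rho> $$ (a, b)) * cnj ((Es ! k) $$ (j, b)))"
proof -
  note d = kraus_isometry_dims[OF assms(1)]
  have car: "E * \<rho> * mat_adjoint E \<in> carrier_mat m m" if "E \<in> set Es" for E
    using d(4) that assms(2) mat_adjoint_carrier[of E m n] by auto
  have "apply_channel Es \<rho> $$ (i, j) = (\<Sum>E \<leftarrow> Es. (E * \<rho> * mat_adjoint E) $$ (i, j))"
    unfolding apply_channel_def d using car assms
    by (subst msum_index) (auto simp: comp_def)
  also have "\<dots> = (\<Sum>k<length Es. (Es ! k * \<rho> * mat_adjoint (Es ! k)) $$ (i, j))"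
    by (simp add: sum_list_sum_nth atLeast0LessThan)
  also have "\<dots> = (\<Sum>k<length Es.
    \<Sum>b<n. (\<Sum>a<n. (Es ! k) $$ (i, a) * \<rho> $$ (a, b)) * cnj ((Es ! k) $$ (j, b)))"
    using d assms by (intro sum.cong refl conj_by_index) (auto dest: nth_mem)
  finally show ?thesis .
qed

text \<open>Amplitudes are pushed through the Kraus operators: the output is again a Gram matrix,
  with the Kraus index joined to the reference index.\<close>

lemma apply_channel_gram:
  assumes E: "kraus_isometry m n Es" and \<rho>: "\<rho> \<in> carrier_mat n n"
    and W: "\<And>a b. a < n \<Longrightarrow> b < n \<Longrightarrow> \<rho> $$ (a, b) = (\<Sum>x\<in>S. W a x * cnj (W b x))"
    and ij: "i < m" "j < m"
  shows "apply_channel Es \<rho> $$ (i, j) = (\<Sum>k<length Es. \<Sum>x\<in>S.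
    (\<Sum>a<n. (Es ! k) $$ (i, a) * W a x) * cnj (\<Sum>a<n. (Es ! k) $$ (j, a) * W a x))"
  unfolding apply_channel_kraus_index[OF E \<rho> ij]
proof (rule sum.cong[OF refl])
  fix k
  let ?e = "\<lambda>i a. (Es ! k) $$ (i, a)"
  have "(\<Sum>b<n. (\<Sum>a<n. ?e i a * \<rho> $$ (a, b)) * cnj (?e j b))
      = (\<Sum>b<n. \<Sum>a<n. \<Sum>x\<in>S. (?e i a * W a x) * cnj (?e j b * W b x))"
    by (simp add: W sum_distrib_left sum_distrib_right ac_simps)
  also have "\<dots> = (\<Sum>b<n. \<Sum>x\<in>S. \<Sum>a<n. (?e i a * W a x) * cnj (?e j b * W b x))"
    by (rule sum.cong[OF refl], rule sum.swap)
  also have "\<dots> = (\<Sum>x\<in>S. \<Sum>b<n. \<Sum>a<n. (?e i a * W a x) * cnj (?e j b * W b x))"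
    by (rule sum.swap)
  also have "\<dots> = (\<Sum>x\<in>S. \<Sum>a<n. \<Sum>b<n. (?e i a * W a x) * cnj (?e j b * W b x))"
    by (rule sum.cong[OF refl], rule sum.swap)
  also have "\<dots> = (\<Sum>x\<in>S. (\<Sum>a<n. ?e i a * W a x) * cnj (\<Sum>a<n. ?e j a * W a x))"
    by (simp only: cnj_sum sum_product)
  finally show "(\<Sum>b<n. (\<Sum>a<n. ?e i a * \<rho> $$ (a, b)) * cnj (?e j b))
    = (\<Sum>x\<in>S. (\<Sum>a<n. ?e i a * W a x) * cnj (\<Sum>a<n. ?e j a * W a x))" .
qed

lemma kraus_isometry_norm:
  assumes E: "kraus_isometry m n Es"
  shows "(\<Sum>i<m. \<Sum>k<length Es. (cmod (\<Sum>a<n. (Es ! k) $$ (i, a) * v a))\<^sup>2) = (\<Sum>a<n. (cmod (v a))\<^sup>2)"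
proof -
  let ?e = "\<lambda>k i a. (Es ! k) $$ (i, a)"
  have "complex_of_real (\<Sum>i<m. \<Sum>k<length Es. (cmod (\<Sum>a<n. ?e k i a * v a))\<^sup>2)
      = (\<Sum>i<m. \<Sum>k<length Es. \<Sum>a<n. \<Sum>b<n. (?e k i a * v a) * cnj (?e k i b * v b))"
    by (simp only: of_real_sum complex_norm_square cnj_sum sum_product)
  also have "\<dots> = (\<Sum>i<m. \<Sum>a<n. \<Sum>k<length Es. \<Sum>b<n. (?e k i a * v a) * cnj (?e k i b * v b))"
    by (rule sum.cong[OF refl], rule sum.swap)
  also have "\<dots> = (\<Sum>a<n. \<Sum>i<m. \<Sum>k<length Es. \<Sum>b<n. (?e k i a * v a) * cnj (?e k i b * v b))"
    by (rule sum.swap)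
  also have "\<dots> = (\<Sum>a<n. \<Sum>i<m. \<Sum>b<n. \<Sum>k<length Es. (?e k i a * v a) * cnj (?e k i b * v b))"
    by (rule sum.cong[OF refl], rule sum.cong[OF refl], rule sum.swap)
  also have "\<dots> = (\<Sum>a<n. \<Sum>b<n. \<Sum>i<m. \<Sum>k<length Es. (?e k i a * v a) * cnj (?e k i b * v b))"
    by (rule sum.cong[OF refl], rule sum.swap)
  also have "\<dots> = (\<Sum>a<n. \<Sum>b<n. v a * cnj (v b) * (\<Sum>i<m. \<Sum>k<length Es. cnj (?e k i b) * ?e k i a))"
    by (simp add: sum_distrib_left ac_simps)
  also have "\<dots> = (\<Sum>a<n. \<Sum>b<n. if b = a then v a * cnj (v a) else 0)"
    using E by (intro sum.cong refl) (auto simp: kraus_isometry_def)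
  also have "\<dots> = complex_of_real (\<Sum>a<n. (cmod (v a))\<^sup>2)"
    by (simp only: of_real_sum complex_norm_square) simp
  finally show ?thesis by (simp only: of_real_eq_iff)
qed

lemma apply_channel_density:
  assumes E: "kraus_isometry m n Es" and \<rho>: "\<rho> \<in> density_ops n"
  shows "apply_channel Es \<rho> \<in> density_ops m"
proof -
  obtain W where W: "\<And>a b. a < n \<Longrightarrow> b < n \<Longrightarrow> \<rho> $$ (a, b) = (\<Sum>x<n. W a x * cnj (W b x))"
    "(\<Sum>a<n. \<Sum>x<n. (cmod (W a x))\<^sup>2) = 1"
    by (rule density_gram[OF \<rho>], rule that)
  have \<rho>c: "\<rho> \<in> carrier_mat n n" using \<rho> by (simp add: density_ops_def)
  let ?X = "\<lambda>i p. \<Sum>a<n. (Es ! fst p) $$ (i, a) * W a (snd p)"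
  show ?thesis
  proof (rule density_opsI_gram[OF apply_channel_kraus_carrier[OF E \<rho>c]])
    show "apply_channel Es \<rho> $$ (i, j) = (\<Sum>p\<in>{..<length Es} \<times> {..<n}. ?X i p * cnj (?X j p))"
      if "i < m" "j < m" for i j
      using apply_channel_gram[OF E \<rho>c W(1) that] by (simp add: sum.cartesian_product split_def)
    have "(\<Sum>i<m. \<Sum>p\<in>{..<length Es} \<times> {..<n}. (cmod (?X i p))\<^sup>2)
        = (\<Sum>i<m. \<Sum>k<length Es. \<Sum>x<n. (cmod (?X i (k, x)))\<^sup>2)"
      by (simp add: sum.cartesian_product split_def)
    also have "\<dots> = (\<Sum>i<m. \<Sum>x<n. \<Sum>k<length Es. (cmod (?X i (k, x)))\<^sup>2)"
      by (rule sum.cong[OF refl], rule sum.swap)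
    also have "\<dots> = (\<Sum>x<n. \<Sum>i<m. \<Sum>k<length Es. (cmod (?X i (k, x)))\<^sup>2)"
      by (rule sum.swap)
    also have "\<dots> = (\<Sum>x<n. \<Sum>a<n. (cmod (W a x))\<^sup>2)"
      using kraus_isometry_norm[OF E] by simp
    also have "\<dots> = 1" using W(2) by (subst sum.swap)
    finally show "(\<Sum>i<m. \<Sum>p\<in>{..<length Es} \<times> {..<n}. (cmod (?X i p))\<^sup>2) = 1" .
  qed
qed

subsection \<open>Holevo information\<close>

lemma ensemblesD:
  assumes "ens \<in> ensembles d"
  shows "l < length ens \<Longrightarrow> 0 \<le> fst (ens ! l)" "l < length ens \<Longrightarrow> snd (ens ! l) \<in> density_ops d"
    "(\<Sum>l<length ens. fst (ens ! l)) = 1"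
proof -
  have *: "\<forall>x\<in>set ens. 0 \<le> fst x \<and> snd x \<in> density_ops d" and s: "(\<Sum>x\<leftarrow>ens. fst x) = 1"
    using assms by (auto simp: ensembles_def case_prod_beta')
  show "l < length ens \<Longrightarrow> 0 \<le> fst (ens ! l)" "l < length ens \<Longrightarrow> snd (ens ! l) \<in> density_ops d"
    using * nth_mem by blast+
  show "(\<Sum>l<length ens. fst (ens ! l)) = 1"
    using s by (simp add: sum_list_sum_nth atLeast0LessThan)
qed

lemma ensemble_mean_index:
  assumes "ens \<in> ensembles d" "i < d" "j < d"
  shows "msum d [complex_of_real p \<cdot>\<^sub>m \<rho>. (p, \<rho>) \<leftarrow> ens] $$ (i, j)
    = (\<Sum>l<length ens. complex_of_real (fst (ens ! l)) * snd (ens ! l) $$ (i, j))"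
proof -
  have c: "snd (ens ! l) \<in> carrier_mat d d" if "l < length ens" for l
    using ensemblesD(2)[OF assms(1) that] by (simp add: density_ops_def)
  have "set (map (\<lambda>x. complex_of_real (fst x) \<cdot>\<^sub>m snd x) ens) \<subseteq> carrier_mat d d"
    using c by (force simp: in_set_conv_nth)
  then have "msum d (map (\<lambda>x. complex_of_real (fst x) \<cdot>\<^sub>m snd x) ens) $$ (i, j)
      = (\<Sum>x\<leftarrow>ens. (complex_of_real (fst x) \<cdot>\<^sub>m snd x) $$ (i, j))"
    using assms(2,3) by (subst msum_index) (auto simp: comp_def)
  also have "\<dots> = (\<Sum>l<length ens. (complex_of_real (fst (ens ! l)) \<cdot>\<^sub>m snd (ens ! l)) $$ (i, j))"
    by (simp add: sum_list_sum_nth atLeast0LessThan)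
  also have "\<dots> = (\<Sum>l<length ens. complex_of_real (fst (ens ! l)) * snd (ens ! l) $$ (i, j))"
  proof (rule sum.cong[OF refl])
    fix l assume "l \<in> {..<length ens}"
    then show "(complex_of_real (fst (ens ! l)) \<cdot>\<^sub>m snd (ens ! l)) $$ (i, j)
      = complex_of_real (fst (ens ! l)) * snd (ens ! l) $$ (i, j)"
      using c[of l] assms(2,3) by (subst index_smult_mat) auto
  qed
  finally show ?thesis by (simp add: case_prod_beta')
qed

lemma ensemble_mean_density:
  assumes "ens \<in> ensembles d"
  shows "msum d [complex_of_real p \<cdot>\<^sub>m \<rho>. (p, \<rho>) \<leftarrow> ens] \<in> density_ops d" (is "?M \<in> _")
proof -
  let ?p = "\<lambda>l. fst (ens ! l)" and ?r = "\<lambda>l. snd (ens ! l)"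
  have "\<forall>l. \<exists>W. l < length ens \<longrightarrow> (\<forall>a<d. \<forall>b<d. ?r l $$ (a, b) = (\<Sum>m<d. W a m * cnj (W b m)))
      \<and> (\<Sum>a<d. \<Sum>m<d. (cmod (W a m))\<^sup>2) = 1"
  proof
    fix l
    show "\<exists>W. l < length ens \<longrightarrow> (\<forall>a<d. \<forall>b<d. ?r l $$ (a, b) = (\<Sum>m<d. W a m * cnj (W b m)))
      \<and> (\<Sum>a<d. \<Sum>m<d. (cmod (W a m))\<^sup>2) = 1"
    proof (cases "l < length ens")
      case True
      show ?thesis by (rule density_gram[OF ensemblesD(2)[OF assms True]]) blast
    qed simp
  qed
  from choice[OF this] obtain W where W:
    "\<And>l a b. l < length ens \<Longrightarrow> a < d \<Longrightarrow> b < d \<Longrightarrow> ?r l $$ (a, b) = (\<Sum>m<d. W l a m * cnj (W l b m))"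
    "\<And>l. l < length ens \<Longrightarrow> (\<Sum>a<d. \<Sum>m<d. (cmod (W l a m))\<^sup>2) = 1"
    by blast
  let ?S = "{..<length ens} \<times> {..<d}"
  \<comment> \<open>Amplitudes of the mixture: those of the members scaled by square roots of the
    weights, with the label of the member joined to the reference index.\<close>
  let ?V = "\<lambda>a x. complex_of_real (sqrt (?p (fst x))) * W (fst x) a (snd x)"
  have sq: "complex_of_real (sqrt (?p l)) * complex_of_real (sqrt (?p l)) = complex_of_real (?p l)"
    if "l < length ens" for l
    using ensemblesD(1)[OF assms that] by (simp flip: of_real_mult)
  show ?thesis
  proof (rule density_opsI_gram)
    show "?M \<in> carrier_mat d d"
    proof (rule msum_carrier)
      show "set (map (\<lambda>(p, \<rho>). complex_of_real p \<cdot>\<^sub>m \<rho>) ens) \<subseteq> carrier_mat d d"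
        using assms by (auto simp: ensembles_def density_ops_def)
    qed
    show "?M $$ (i, j) = (\<Sum>x\<in>?S. ?V i x * cnj (?V j x))" if ij: "i < d" "j < d" for i j
    proof -
      have "?M $$ (i, j) = (\<Sum>l<length ens. \<Sum>m<d. ?V i (l, m) * cnj (?V j (l, m)))"
        unfolding ensemble_mean_index[OF assms ij]
      proof (rule sum.cong[OF refl])
        fix l assume "l \<in> {..<length ens}"
        then have l: "l < length ens" by simp
        show "complex_of_real (?p l) * ?r l $$ (i, j) = (\<Sum>m<d. ?V i (l, m) * cnj (?V j (l, m)))"
          unfolding W(1)[OF l ij] sum_distrib_left sq[OF l, symmetric]
          by (simp add: ac_simps)
      qed
      then show ?thesis by (simp add: sum.cartesian_product split_def)
    qed
    have "(\<Sum>i<d. \<Sum>x\<in>?S. (cmod (?V i x))\<^sup>2) = (\<Sum>i<d. \<Sum>l<length ens. \<Sum>m<d. (cmod (?V i (l, m)))\<^sup>2)"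
      by (simp add: sum.cartesian_product split_def)
    also have "\<dots> = (\<Sum>l<length ens. \<Sum>i<d. \<Sum>m<d. (cmod (?V i (l, m)))\<^sup>2)"
      by (rule sum.swap)
    also have "\<dots> = (\<Sum>l<length ens. ?p l * (\<Sum>i<d. \<Sum>m<d. (cmod (W l i m))\<^sup>2))"
      using ensemblesD(1)[OF assms] by (simp add: norm_mult power_mult_distrib sum_distrib_left)
    also have "\<dots> = 1" using W(2) ensemblesD(3)[OF assms] by simp
    finally show "(\<Sum>i<d. \<Sum>x\<in>?S. (cmod (?V i x))\<^sup>2) = 1" .
  qed
qed

lemma holevo_indexed:
  "holevo d ens = vn_entropy (msum d [complex_of_real p \<cdot>\<^sub>m \<rho>. (p, \<rho>) \<leftarrow> ens])
     - (\<Sum>l<length ens. fst (ens ! l) * vn_entropy (snd (ens ! l)))"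
  by (simp add: holevo_def case_prod_beta' sum_list_sum_nth atLeast0LessThan)

text \<open>Concavity of the entropy. Each member is compared with the mean by Klein's inequality in
  the eigenbasis of the mean, and the averaged cross entropies are exactly the entropy of the mean.
  Applied to the environment, this puts the private capacity below the classical one.\<close>

lemma holevo_nonneg:
  assumes ens: "ens \<in> ensembles d"
  shows "0 \<le> holevo d ens"
proof -
  let ?p = "\<lambda>l. fst (ens ! l)" and ?r = "\<lambda>l. snd (ens ! l)" and ?L = "length ens"
  let ?M = "msum d [complex_of_real p \<cdot>\<^sub>m \<rho>. (p, \<rho>) \<leftarrow> ens]"
  obtain U t where U: "unitary_on d U" "\<And>j. j < d \<Longrightarrow> 0 \<le> t j" "(\<Sum>j<d. t j) = 1"
    "\<And>a b. a < d \<Longrightarrow> b < d \<Longrightarrow> ?M $$ (a, b) = (\<Sum>j<d. complex_of_real (t j) * U j a * cnj (U j b))"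
    "vn_entropy ?M = - (\<Sum>j<d. t j * log 2 (t j))"
    by (rule density_eigenbasis[OF ensemble_mean_density[OF ens]], rule that)
  define q where "q l b = Re (\<Sum>a<d. \<Sum>a'<d. cnj (U b a) * ?r l $$ (a, a') * U b a')" for l b
  have q: "complex_of_real (q l b) = (\<Sum>a<d. \<Sum>a'<d. cnj (U b a) * ?r l $$ (a, a') * U b a') \<and> 0 \<le> q l b"
    if l: "l < ?L" for l b
  proof -
    obtain W where "\<And>a b. a < d \<Longrightarrow> b < d \<Longrightarrow> ?r l $$ (a, b) = (\<Sum>m<d. W a m * cnj (W b m))"
      "(\<Sum>a<d. \<Sum>m<d. (cmod (W a m))\<^sup>2) = 1"
      by (rule density_gram[OF ensemblesD(2)[OF ens l]], rule that)
    then have "(\<Sum>a<d. \<Sum>a'<d. cnj (U b a) * ?r l $$ (a, a') * U b a')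
      = complex_of_real (\<Sum>x<d. 1 * (cmod (\<Sum>a<d. cnj (U b a) * W a x))\<^sup>2)"
      by (intro quadratic_form_gram) simp
    then show ?thesis unfolding q_def by (simp add: sum_nonneg del: of_real_sum)
  qed
  have tq: "t b = (\<Sum>l<?L. ?p l * q l b)" if b: "b < d" for b
  proof -
    have "(\<Sum>a<d. cnj (U b a) * U j a) = (if j = b then 1 else 0)" if "j < d" for j
      using U(1) b that by (auto simp: unitary_on_def)
    then have "complex_of_real (t b) = complex_of_real (\<Sum>j<d. t j * (cmod (\<Sum>a<d. cnj (U b a) * U j a))\<^sup>2)"
      using b by (simp add: if_distrib[of cmod] if_distrib[of "\<lambda>x. x ^ 2"] if_distrib[of "times (t _)"] cong: if_cong)
    also have "\<dots> = (\<Sum>a<d. \<Sum>a'<d. cnj (U b a) * ?M $$ (a, a') * U b a')"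
      by (rule quadratic_form_gram[symmetric]) (simp add: U(4))
    also have "\<dots> = (\<Sum>a<d. \<Sum>a'<d. \<Sum>l<?L. complex_of_real (?p l) * (cnj (U b a) * ?r l $$ (a, a') * U b a'))"
      by (simp add: ensemble_mean_index[OF ens] sum_distrib_left sum_distrib_right ac_simps)
    also have "\<dots> = (\<Sum>a<d. \<Sum>l<?L. \<Sum>a'<d. complex_of_real (?p l) * (cnj (U b a) * ?r l $$ (a, a') * U b a'))"
      by (rule sum.cong[OF refl], rule sum.swap)
    also have "\<dots> = (\<Sum>l<?L. \<Sum>a<d. \<Sum>a'<d. complex_of_real (?p l) * (cnj (U b a) * ?r l $$ (a, a') * U b a'))"
      by (rule sum.swap)
    also have "\<dots> = complex_of_real (\<Sum>l<?L. ?p l * q l b)"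
      using q by (simp add: sum_distrib_left)
    finally show ?thesis by (simp only: of_real_eq_iff)
  qed
  have "?p l * vn_entropy (?r l) \<le> - (\<Sum>b<d. ?p l * q l b * log 2 (t b))" if l: "l < ?L" for l
  proof (cases "?p l = 0")
    \<comment> \<open>Only members of positive weight are known to be supported where the mean is;
      the others contribute 0.\<close>
    case False
    have "vn_entropy (?r l) \<le> - (\<Sum>b<d. q l b * log 2 (t b))"
    proof (rule vn_entropy_le_cross_entropy[OF ensemblesD(2)[OF ens l] U(1,2)])
      show "(\<Sum>b<d. t b) \<le> 1" using U(3) by simp
      fix b assume "b < d" "t b = 0"
      then have "(\<Sum>l<?L. ?p l * q l b) = 0" using tq by simp
      then have "\<forall>l\<in>{..<?L}. ?p l * q l b = 0"
        using q ensemblesD(1)[OF ens] by (subst (asm) sum_nonneg_eq_0_iff) auto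
      then show "q l b = 0" using False l by auto
    qed (use q l in auto)
    then have "?p l * vn_entropy (?r l) \<le> ?p l * - (\<Sum>b<d. q l b * log 2 (t b))"
      by (rule mult_left_mono) (rule ensemblesD(1)[OF ens l])
    then show ?thesis by (simp add: sum_distrib_left mult.assoc)
  qed simp
  then have "(\<Sum>l<?L. ?p l * vn_entropy (?r l)) \<le> (\<Sum>l<?L. - (\<Sum>b<d. ?p l * q l b * log 2 (t b)))"
    by (intro sum_mono) simp
  also have "\<dots> = - (\<Sum>b<d. \<Sum>l<?L. ?p l * q l b * log 2 (t b))"
    by (subst sum.swap) (simp add: sum_negf)
  also have "\<dots> = vn_entropy ?M"
    unfolding U(5) by (simp add: tq sum_distrib_right)
  finally show ?thesis by (simp add: holevo_indexed)
qed

text \<open>The hypothesis \<open>bound\<close> says \<open>A \<le> \<mu> diag \<sigma>\<close>, so this is the inequality between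
  relative entropy and max-relative entropy.\<close>

lemma cross_entropy_minus_entropy_le:
  assumes A: "A \<in> density_ops d" and s: "\<And>b. b < d \<Longrightarrow> 0 < \<sigma> b"
    and bound: "\<And>u. Re (\<Sum>a<d. \<Sum>b<d. cnj (u a) * A $$ (a, b) * u b) \<le> \<mu> * (\<Sum>b<d. \<sigma> b * (cmod (u b))\<^sup>2)"
  shows "- (\<Sum>b<d. Re (A $$ (b, b)) * log 2 (\<sigma> b)) - vn_entropy A \<le> log 2 \<mu>"
proof -
  obtain U t where U: "unitary_on d U" "\<And>j. j < d \<Longrightarrow> 0 \<le> t j" "(\<Sum>j<d. t j) = 1"
    "\<And>a b. a < d \<Longrightarrow> b < d \<Longrightarrow> A $$ (a, b) = (\<Sum>j<d. complex_of_real (t j) * U j a * cnj (U j b))"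
    "vn_entropy A = - (\<Sum>j<d. t j * log 2 (t j))"
    by (rule density_eigenbasis[OF A], rule that)
  have U1: "(\<Sum>b<d. (cmod (U j b))\<^sup>2) = 1" if "j < d" for j
    by (rule unitary_norm[OF U(1) that])
  \<comment> \<open>The expectation of the inverse of \<sigma> in the eigenvector
    \<open>U j\<close>.\<close>
  define X where "X j = (\<Sum>b<d. (cmod (U j b))\<^sup>2 * (1 / \<sigma> b))" for j
  have X0: "0 < X j" if j: "j < d" for j
  proof -
    have "\<exists>b<d. U j b \<noteq> 0"
    proof (rule ccontr)
      assume "\<not> (\<exists>b<d. U j b \<noteq> 0)"
      then have "(\<Sum>b<d. (cmod (U j b))\<^sup>2) = 0" by (intro sum.neutral) auto
      then show False using U1[OF j] by simp
    qed
    then obtain b where b: "b < d" "0 < (cmod (U j b))\<^sup>2" by auto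
    have "0 < (cmod (U j b))\<^sup>2 * (1 / \<sigma> b)" using b s by simp
    then show ?thesis unfolding X_def
      using b(1) s by (intro sum_pos2[of _ b]) (auto intro!: divide_nonneg_pos)
  qed
  have tX: "t j * X j \<le> \<mu>" if j: "j < d" for j
  proof -
    \<comment> \<open>Testing the operator inequality on the inverse of \<sigma> applied to
      \<open>U j\<close> makes the left side at least \<open>t j * (X j)\<^sup>2\<close> and the
      right side equal to \<open>\<mu> * X j\<close>, so that one factor \<open>X j\<close>
      cancels.\<close>
    let ?u = "\<lambda>b. U j b / complex_of_real (\<sigma> b)"
    have "(\<Sum>a<d. cnj (?u a) * U j a) = complex_of_real (X j)"
      unfolding X_def of_real_sum of_real_mult complex_norm_square by (intro sum.cong refl) simp
    then have "t j * (X j)\<^sup>2 = t j * (cmod (\<Sum>a<d. cnj (?u a) * U j a))\<^sup>2" by simp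
    also have "\<dots> \<le> (\<Sum>l<d. t l * (cmod (\<Sum>a<d. cnj (?u a) * U l a))\<^sup>2)"
      using j U(2) by (intro member_le_sum) auto
    also have "\<dots> = Re (\<Sum>a<d. \<Sum>b<d. cnj (?u a) * A $$ (a, b) * ?u b)"
      by (subst quadratic_form_gram[OF U(4)]) auto
    also have "\<dots> \<le> \<mu> * (\<Sum>b<d. \<sigma> b * (cmod (?u b))\<^sup>2)" by (rule bound)
    also have "(\<Sum>b<d. \<sigma> b * (cmod (?u b))\<^sup>2) = X j"
      unfolding X_def
    proof (rule sum.cong[OF refl])
      fix b assume "b \<in> {..<d}"
      then show "\<sigma> b * (cmod (?u b))\<^sup>2 = (cmod (U j b))\<^sup>2 * (1 / \<sigma> b)"
        using s[of b] by (simp add: norm_divide power2_eq_square)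
    qed
    finally have "(t j * X j) * X j \<le> \<mu> * X j" by (simp add: power2_eq_square mult.assoc)
    then show ?thesis using X0[OF j] by simp
  qed
  have l: "0 < \<mu>"
  proof -
    have "\<exists>j<d. t j \<noteq> 0"
    proof (rule ccontr)
      assume "\<not> (\<exists>j<d. t j \<noteq> 0)"
      then have "(\<Sum>j<d. t j) = 0" by (intro sum.neutral) auto
      then show False using U(3) by simp
    qed
    then obtain j where "j < d" "0 < t j" using U(2) by (auto simp: less_le)
    then show ?thesis using tX[of j] X0[of j] by (meson less_le_trans mult_pos_pos)
  qed
  have Ab: "Re (A $$ (b, b)) = (\<Sum>j<d. t j * (cmod (U j b))\<^sup>2)" if b: "b < d" for b
  proof -
    have "A $$ (b, b) = complex_of_real (\<Sum>j<d. t j * (cmod (U j b))\<^sup>2)"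
      by (simp only: U(4)[OF b b] of_real_sum of_real_mult complex_norm_square mult.assoc)
    then show ?thesis by simp
  qed
  have step: "t j * ((\<Sum>b<d. (cmod (U j b))\<^sup>2 * log 2 (1 / \<sigma> b)) + log 2 (t j)) \<le> t j * log 2 \<mu>" if j: "j < d" for j
  proof (cases "t j = 0")
    case False
    then have t: "0 < t j" using U(2)[OF j] by simp
    have "(\<Sum>b<d. (cmod (U j b))\<^sup>2 * log 2 (1 / \<sigma> b)) \<le> log 2 (X j)"
      unfolding X_def using U1[OF j] s by (intro sum_weighted_log_le) auto
    also have "\<dots> = log 2 (t j * X j) - log 2 (t j)" using t X0[OF j] by (simp add: log_mult)
    also have "log 2 (t j * X j) \<le> log 2 \<mu>" using tX[OF j] t X0[OF j] l by (subst log_le_cancel_iff) auto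
    finally show ?thesis using t by (intro mult_left_mono) auto
  qed simp
  have "- (\<Sum>b<d. Re (A $$ (b, b)) * log 2 (\<sigma> b)) = (\<Sum>b<d. \<Sum>j<d. t j * ((cmod (U j b))\<^sup>2 * log 2 (1 / \<sigma> b)))"
    unfolding sum_negf[symmetric]
  proof (rule sum.cong[OF refl])
    fix b assume "b \<in> {..<d}"
    then show "- (Re (A $$ (b, b)) * log 2 (\<sigma> b)) = (\<Sum>j<d. t j * ((cmod (U j b))\<^sup>2 * log 2 (1 / \<sigma> b)))"
      using s[of b] by (simp add: Ab log_divide sum_distrib_left sum_negf ac_simps)
  qed
  also have "\<dots> = (\<Sum>j<d. t j * (\<Sum>b<d. (cmod (U j b))\<^sup>2 * log 2 (1 / \<sigma> b)))"
    by (subst sum.swap) (simp add: sum_distrib_left)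
  finally have "- (\<Sum>b<d. Re (A $$ (b, b)) * log 2 (\<sigma> b)) - vn_entropy A
      = (\<Sum>j<d. t j * ((\<Sum>b<d. (cmod (U j b))\<^sup>2 * log 2 (1 / \<sigma> b)) + log 2 (t j)))"
    by (simp add: U(5) sum.distrib distrib_left)
  also have "\<dots> \<le> (\<Sum>j<d. t j * log 2 \<mu>)" using step by (intro sum_mono) simp
  also have "\<dots> = log 2 \<mu>" using U(3) by (simp flip: sum_distrib_right)
  finally show ?thesis .
qed

text \<open>The Holevo information is at most the average relative entropy of the members to any
  fixed state, here \<sigma>; a max-relative entropy bound common to all members then
  suffices.\<close>

lemma holevo_le_log:
  assumes ens: "ens \<in> ensembles d" and s: "\<And>b. b < d \<Longrightarrow> 0 < \<sigma> b" "(\<Sum>b<d. \<sigma> b) \<le> 1"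
    and bound: "\<And>l u. l < length ens \<Longrightarrow>
      Re (\<Sum>a<d. \<Sum>b<d. cnj (u a) * snd (ens ! l) $$ (a, b) * u b) \<le> \<mu> * (\<Sum>b<d. \<sigma> b * (cmod (u b))\<^sup>2)"
  shows "holevo d ens \<le> log 2 \<mu>"
proof -
  let ?p = "\<lambda>l. fst (ens ! l)" and ?r = "\<lambda>l. snd (ens ! l)" and ?L = "length ens"
  let ?M = "msum d [complex_of_real p \<cdot>\<^sub>m \<rho>. (p, \<rho>) \<leftarrow> ens]"
  have "vn_entropy ?M \<le> - (\<Sum>b<d. Re (?M $$ (b, b)) * log 2 (\<sigma> b))"
    using s by (intro vn_entropy_le_diagonal_cross_entropy[OF ensemble_mean_density[OF ens]])
      (auto intro: less_imp_le dest: s(1))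
  also have "(\<Sum>b<d. Re (?M $$ (b, b)) * log 2 (\<sigma> b)) = (\<Sum>b<d. \<Sum>l<?L. ?p l * (Re (?r l $$ (b, b)) * log 2 (\<sigma> b)))"
    by (simp add: ensemble_mean_index[OF ens] sum_distrib_right mult.assoc)
  also have "\<dots> = (\<Sum>l<?L. ?p l * (\<Sum>b<d. Re (?r l $$ (b, b)) * log 2 (\<sigma> b)))"
    by (subst sum.swap) (simp add: sum_distrib_left)
  finally have "holevo d ens \<le> (\<Sum>l<?L. ?p l * (- (\<Sum>b<d. Re (?r l $$ (b, b)) * log 2 (\<sigma> b)) - vn_entropy (?r l)))"
    by (simp add: holevo_indexed right_diff_distrib sum_subtractf sum_negf)
  also have "\<dots> \<le> (\<Sum>l<?L. ?p l * log 2 \<mu>)"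
    using ensemblesD(1)[OF ens] cross_entropy_minus_entropy_le[OF ensemblesD(2)[OF ens] s(1) bound]
    by (intro sum_mono mult_left_mono) auto
  also have "\<dots> = log 2 \<mu>" using ensemblesD(3)[OF ens] by (simp flip: sum_distrib_right)
  finally show ?thesis .
qed

lemma channel_ensemble:
  assumes "kraus_isometry m n Es" "ens \<in> ensembles n"
  shows "[(p, apply_channel Es \<rho>). (p, \<rho>) \<leftarrow> ens] \<in> ensembles m"
  using assms(2) apply_channel_density[OF assms(1)]
  by (auto simp: ensembles_def case_prod_beta' comp_def)

lemma holevo_out_nonneg:
  assumes "kraus_isometry m n Es" "ens \<in> ensembles n"
  shows "0 \<le> holevo_out Es ens"
  using holevo_nonneg[OF channel_ensemble[OF assms]] kraus_isometry_dims(1)[OF assms(1)]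
  by (simp add: holevo_out_def)

text \<open>States are replaced by vectors: for a Gram representation of the input, the operator
  inequality for the output is a sum over the reference index of bounds on a form in
  \<open>u\<close> and \<open>v\<close>. The form carries no conjugate, which suits induction over
  letters; \<open>cnj\<close> is inserted on application.\<close>

lemma holevo_out_le_log:
  assumes E: "kraus_isometry m n Es" and ens: "ens \<in> ensembles n"
    and s: "\<And>b. b < m \<Longrightarrow> 0 < \<sigma> b" "(\<Sum>b<m. \<sigma> b) \<le> 1"
    and bound: "\<And>u v. (\<Sum>k<length Es. (cmod (\<Sum>i<m. u i * (\<Sum>a<n. (Es ! k) $$ (i, a) * v a)))\<^sup>2)
      \<le> \<mu> * (\<Sum>i<m. \<sigma> i * (cmod (u i))\<^sup>2) * (\<Sum>a<n. (cmod (v a))\<^sup>2)"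
  shows "holevo_out Es ens \<le> log 2 \<mu>"
proof -
  let ?ens = "[(p, apply_channel Es \<rho>). (p, \<rho>) \<leftarrow> ens]"
  have "holevo m ?ens \<le> log 2 \<mu>"
  proof (rule holevo_le_log[OF channel_ensemble[OF E ens] s])
    fix l u assume "l < length ?ens"
    then have l: "l < length ens" by simp
    define \<rho> where "\<rho> = snd (ens ! l)"
    have \<rho>: "\<rho> \<in> density_ops n" using ensemblesD(2)[OF ens l] by (simp add: \<rho>_def)
    then have \<rho>c: "\<rho> \<in> carrier_mat n n" by (simp add: density_ops_def)
    obtain W where W: "\<And>a b. a < n \<Longrightarrow> b < n \<Longrightarrow> \<rho> $$ (a, b) = (\<Sum>m<n. W a m * cnj (W b m))"
      "(\<Sum>a<n. \<Sum>m<n. (cmod (W a m))\<^sup>2) = 1"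
      by (rule density_gram[OF \<rho>], rule that)
    let ?X = "\<lambda>i p. \<Sum>a<n. (Es ! fst p) $$ (i, a) * W a (snd p)"
    have "apply_channel Es \<rho> $$ (i, j) = (\<Sum>p\<in>{..<length Es} \<times> {..<n}. complex_of_real 1 * ?X i p * cnj (?X j p))"
      if "i < m" "j < m" for i j
      using apply_channel_gram[OF E \<rho>c W(1) that] by (simp add: sum.cartesian_product split_def)
    from quadratic_form_gram[OF this]
    have "Re (\<Sum>a<m. \<Sum>b<m. cnj (u a) * apply_channel Es \<rho> $$ (a, b) * u b)
        = (\<Sum>p\<in>{..<length Es} \<times> {..<n}. (cmod (\<Sum>i<m. cnj (u i) * ?X i p))\<^sup>2)"
      by simp
    also have "\<dots> = (\<Sum>x<n. \<Sum>k<length Es. (cmod (\<Sum>i<m. cnj (u i) * ?X i (k, x)))\<^sup>2)"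
      by (subst sum.swap) (simp add: sum.cartesian_product split_def)
    also have "\<dots> \<le> (\<Sum>x<n. \<mu> * (\<Sum>i<m. \<sigma> i * (cmod (cnj (u i)))\<^sup>2) * (\<Sum>a<n. (cmod (W a x))\<^sup>2))"
      using bound[of "\<lambda>i. cnj (u i)" "\<lambda>a. W a _"] by (intro sum_mono) simp
    also have "\<dots> = \<mu> * (\<Sum>i<m. \<sigma> i * (cmod (u i))\<^sup>2) * (\<Sum>x<n. \<Sum>a<n. (cmod (W a x))\<^sup>2)"
      by (simp add: sum_distrib_left)
    also have "(\<Sum>x<n. \<Sum>a<n. (cmod (W a x))\<^sup>2) = 1" using W(2) by (subst sum.swap)
    finally show "Re (\<Sum>a<m. \<Sum>b<m. cnj (u a) * snd (?ens ! l) $$ (a, b) * u b) \<le> \<mu> * (\<Sum>b<m. \<sigma> b * (cmod (u b))\<^sup>2)"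
      using l by (simp add: \<rho>_def case_prod_beta')
  qed
  then show ?thesis using kraus_isometry_dims(1)[OF E] by (simp add: holevo_out_def)
qed

subsection \<open>Capacities\<close>

lemma density_ops_nonempty:
  assumes "0 < d"
  shows "ketbra d 0 0 \<in> density_ops d"
  by (rule density_diagonal[where p = "\<lambda>i. if i = 0 then 1 else 0"])
    (use assms in \<open>auto simp: ketbra_def diagonal_mat_def\<close>)

lemma ensembles_nonempty:
  assumes "0 < d"
  shows "ensembles d \<noteq> {}"
proof -
  have "[(1, ketbra d 0 0)] \<in> ensembles d"
    using density_ops_nonempty[OF assms] by (simp add: ensembles_def)
  then show ?thesis by blast
qed

text \<open>A supremum of reals is informative only for nonempty bounded sets. The single bound
  \<open>real n * c\<close> serves both levels of suprema: it limits the value from above and lets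
  the one-use value count as a lower bound.\<close>

lemma regularized_sup_le:
  fixes f :: "nat \<Rightarrow> 'a \<Rightarrow> real"
  assumes "\<And>n x. 1 \<le> n \<Longrightarrow> x \<in> S n \<Longrightarrow> f n x \<le> real n * c" "\<And>n. S n \<noteq> {}"
  shows "(SUP n\<in>{1..}. 1 / real n * (SUP x\<in>S n. f n x)) \<le> c"
    and "x \<in> S 1 \<Longrightarrow> f 1 x \<le> (SUP n\<in>{1..}. 1 / real n * (SUP x\<in>S n. f n x))"
proof -
  have le: "1 / real n * (SUP x\<in>S n. f n x) \<le> c" if "n \<in> {1..}" for n
  proof -
    have "(SUP x\<in>S n. f n x) \<le> real n * c" using assms that by (intro cSUP_least) auto
    then show ?thesis using that by (simp add: field_simps)
  qed
  then show "(SUP n\<in>{1..}. 1 / real n * (SUP x\<in>S n. f n x)) \<le> c"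
    by (intro cSUP_least) auto
  assume x: "x \<in> S 1"
  have "f 1 x \<le> (SUP x\<in>S 1. f 1 x)"
    using x assms(1)[of 1] by (intro cSUP_upper) (auto intro!: bdd_aboveI2[where M = c])
  also have "\<dots> = 1 / real 1 * (SUP x\<in>S 1. f 1 x)" by simp
  also have "\<dots> \<le> (SUP n\<in>{1..}. 1 / real n * (SUP x\<in>S n. f n x))"
    using le by (intro cSUP_upper) (auto intro!: bdd_aboveI2[where M = c])
  finally show "f 1 x \<le> (SUP n\<in>{1..}. 1 / real n * (SUP x\<in>S n. f n x))" .
qed

lemma regularized_sup_mono:
  fixes f g :: "nat \<Rightarrow> 'a \<Rightarrow> real"
  assumes "\<And>n x. 1 \<le> n \<Longrightarrow> x \<in> S n \<Longrightarrow> f n x \<le> real n * c" "\<And>n. S n \<noteq> {}"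
    and "\<And>n x. 1 \<le> n \<Longrightarrow> x \<in> S n \<Longrightarrow> g n x \<le> f n x"
  shows "(SUP n\<in>{1..}. 1 / real n * (SUP x\<in>S n. g n x)) \<le> (SUP n\<in>{1..}. 1 / real n * (SUP x\<in>S n. f n x))"
proof (rule cSUP_mono)
  have "1 / real n * (SUP x\<in>S n. f n x) \<le> c" if "n \<in> {1..}" for n
  proof -
    have "(SUP x\<in>S n. f n x) \<le> real n * c" using assms that by (intro cSUP_least) auto
    then show ?thesis using that by (simp add: field_simps)
  qed
  then show "bdd_above ((\<lambda>n. 1 / real n * (SUP x\<in>S n. f n x)) ` {1..})"
    by (intro bdd_aboveI2[where M = c]) auto
  fix n :: nat assume n: "n \<in> {1..}"
  have "bdd_above (f n ` S n)"
    using assms(1) n by (intro bdd_aboveI2[where M = "real n * c"]) auto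
  then have "(SUP x\<in>S n. g n x) \<le> (SUP x\<in>S n. f n x)"
    using assms(2,3) n by (intro cSUP_mono) auto
  then show "\<exists>m\<in>{1..}. 1 / real n * (SUP x\<in>S n. g n x) \<le> 1 / real m * (SUP x\<in>S m. f m x)"
    using n by (intro bexI[of _ n] mult_left_mono) auto
qed simp

text \<open>Closes the chain from \<open>c\<close> through the private and the classical capacity
  back to \<open>c\<close>: an ensemble for a single use gives the first inequality, nonnegativity
  of the Holevo information of the environment the second, and \<open>bound\<close> the
  last.\<close>

lemma capacities_squeeze:
  assumes E: "kraus_isometry m n Es" and pos: "0 < m" "0 < n"
    and bound: "\<And>N ens. ens \<in> ensembles (n ^ N) \<Longrightarrow> holevo_out (tensor_power Es N) ens \<le> real N * c"
    and ens: "ens \<in> ensembles (n ^ 1)"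
      "holevo_out (tensor_power Es 1) ens - holevo_out (tensor_power (complementary Es) 1) ens = c"
  shows "private_capacity Es = c" "classical_capacity Es = c"
proof -
  let ?S = "\<lambda>N. ensembles (n ^ N)"
  let ?f = "\<lambda>N. holevo_out (tensor_power Es N)"
  let ?g = "\<lambda>N ens. ?f N ens - holevo_out (tensor_power (complementary Es) N) ens"
  have ne: "?S N \<noteq> {}" for N using pos by (intro ensembles_nonempty) simp
  have le: "?g N ens \<le> ?f N ens" if "ens \<in> ?S N" for N ens
    using holevo_out_nonneg[OF kraus_isometry_power[OF kraus_isometry_complementary[OF E pos(1)]] that] by simp
  have gb: "?g N ens \<le> real N * c" if "ens \<in> ?S N" for N ens
    using le[OF that] bound[OF that] by simp
  have P: "private_capacity Es = (SUP N\<in>{1..}. 1 / real N * (SUP ens\<in>?S N. ?g N ens))"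
    and C: "classical_capacity Es = (SUP N\<in>{1..}. 1 / real N * (SUP ens\<in>?S N. ?f N ens))"
    unfolding private_capacity_def classical_capacity_def kraus_isometry_dims(2)[OF E] by (rule refl)+
  have "c \<le> private_capacity Es"
    unfolding P using regularized_sup_le(2)[of ?S ?g c ens] gb ne ens by simp
  moreover have "private_capacity Es \<le> classical_capacity Es"
    unfolding P C using bound le ne by (intro regularized_sup_mono) auto
  moreover have "classical_capacity Es \<le> c"
    unfolding C using bound ne by (intro regularized_sup_le(1)) auto
  ultimately show "private_capacity Es = c" "classical_capacity Es = c" by auto
qed

lemma quantum_capacity_le:
  assumes E: "kraus_isometry m n Es" and pos: "0 < n"
    and bound: "\<And>N \<rho>. \<rho> \<in> density_ops (n ^ N) \<Longrightarrow>
      vn_entropy (apply_channel (tensor_power Es N) \<rho>) - vn_entropy (apply_channel (tensor_power (complementary Es) N) \<rho>)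
      \<le> real N * c"
  shows "quantum_capacity Es \<le> c"
proof -
  have ne: "density_ops (n ^ N) \<noteq> {}" for N using density_ops_nonempty[of "n ^ N"] pos by auto
  show ?thesis
    unfolding quantum_capacity_def kraus_isometry_dims(2)[OF E]
    using bound ne by (intro regularized_sup_le(1)) auto
qed

section \<open>Triangle and Cauchy-Schwarz inequalities for squared norms\<close>

lemma sum_cmod_add_square_le:
  fixes f g :: "'a \<Rightarrow> complex"
  shows "(\<Sum>r\<in>A. (cmod (f r + g r))\<^sup>2)
    \<le> (sqrt (\<Sum>r\<in>A. (cmod (f r))\<^sup>2) + sqrt (\<Sum>r\<in>A. (cmod (g r))\<^sup>2))\<^sup>2"
proof -
  have "(\<Sum>r\<in>A. (cmod (f r + g r))\<^sup>2) \<le> (\<Sum>r\<in>A. (cmod (f r) + cmod (g r))\<^sup>2)"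
    by (intro sum_mono power_mono norm_triangle_ineq norm_ge_zero)
  also have "\<dots> = (L2_set (\<lambda>r. cmod (f r) + cmod (g r)) A)\<^sup>2"
    by (simp add: L2_set_def sum_nonneg)
  also have "\<dots> \<le> (L2_set (\<lambda>r. cmod (f r)) A + L2_set (\<lambda>r. cmod (g r)) A)\<^sup>2"
    by (intro power_mono L2_set_triangle_ineq L2_set_nonneg)
  finally show ?thesis by (simp add: L2_set_def)
qed

lemma cmod_sum_mult_square_le:
  fixes f g :: "'a \<Rightarrow> complex"
  shows "(cmod (\<Sum>r\<in>A. f r * g r))\<^sup>2 \<le> (\<Sum>r\<in>A. (cmod (f r))\<^sup>2) * (\<Sum>r\<in>A. (cmod (g r))\<^sup>2)"
proof -
  have "cmod (\<Sum>r\<in>A. f r * g r) \<le> (\<Sum>r\<in>A. \<bar>cmod (f r)\<bar> * \<bar>cmod (g r)\<bar>)"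
    using norm_sum[of "\<lambda>r. f r * g r" A] by (simp add: norm_mult)
  also have "\<dots> \<le> L2_set (\<lambda>r. cmod (f r)) A * L2_set (\<lambda>r. cmod (g r)) A"
    by (rule L2_set_mult_ineq)
  finally have "(cmod (\<Sum>r\<in>A. f r * g r))\<^sup>2 \<le> (L2_set (\<lambda>r. cmod (f r)) A * L2_set (\<lambda>r. cmod (g r)) A)\<^sup>2"
    by (intro power_mono) auto
  then show ?thesis by (simp add: L2_set_def power_mult_distrib sum_nonneg)
qed

text \<open>Cauchy-Schwarz for two-component vectors given by the squares of their entries; the
  mixed term is controlled by the arithmetic-geometric mean inequality.\<close>

lemma sqrt_mult_add_square_le:
  fixes a b x y :: real
  assumes "0 \<le> a" "0 \<le> b" "0 \<le> x" "0 \<le> y"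
  shows "(sqrt (a * b) + sqrt (x * y))\<^sup>2 \<le> (a + x) * (b + y)"
proof -
  have "sqrt (a * b) * sqrt (x * y) = sqrt ((a * y) * (x * b))"
    by (simp add: mult_ac flip: real_sqrt_mult)
  also have "\<dots> \<le> (a * y + x * b) / 2" using assms by (intro arith_geo_mean_sqrt) auto
  finally show ?thesis using assms by (simp add: power2_sum algebra_simps)
qed

lemma sum_lessThan_3: "(\<Sum>i<(3::nat). f i) = f 0 + f 1 + f 2"
  by (simp add: numeral_3_eq_3 numeral_2_eq_2)

lemma sum_lessThan_2: "(\<Sum>i<(2::nat). f i) = f 0 + f 1"
  by (simp add: numeral_2_eq_2)

section \<open>The qutrit channel and the entries of its tensor powers\<close>

locale qutrit =
  fixes \<alpha> :: real
  assumes alpha: "0 < \<alpha>" "\<alpha> \<le> pi / 4"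
begin

definition "s = sin \<alpha>"
definition "c = cos \<alpha>"

lemma sc: "0 < s" "0 < c" "s \<le> c" "s\<^sup>2 + c\<^sup>2 = 1" "c < 1"
proof -
  show s: "0 < s" unfolding s_def using alpha by (intro sin_gt_zero) auto
  show "0 < c" unfolding c_def using alpha by (intro cos_gt_zero) auto
  show sc: "s\<^sup>2 + c\<^sup>2 = 1" by (simp add: s_def c_def)
  have "sin \<alpha> \<le> sin (pi / 2 - \<alpha>)"
    using alpha by (intro sin_monotone_2pi_le) auto
  then show "s \<le> c" by (simp add: s_def c_def sin_diff)
  have "0 < s\<^sup>2" using s by simp
  then have "c\<^sup>2 < 1" using sc by linarith
  then show "c < 1" by (simp add: power_less_one_iff abs_square_less_1)
qed

abbreviation "E k i a \<equiv> (qutrit_channel \<alpha> ! k) $$ (i, a)"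
definition "T N k i a = (tensor_power (qutrit_channel \<alpha>) N ! k) $$ (i, a)"

lemma qutrit_isometry: "kraus_isometry 3 3 (qutrit_channel \<alpha>)" "length (qutrit_channel \<alpha>) = 2"
proof -
  have "dim_in (qutrit_channel \<alpha>) = 3" "dim_out (qutrit_channel \<alpha>) = 3"
    by (auto simp: dim_in_def dim_out_def qutrit_channel_def kraus0_def ketbra_def)
  then show "kraus_isometry 3 3 (qutrit_channel \<alpha>)"
    using is_channel_kraus_isometry[OF is_channel_qutrit_channel, of \<alpha>] by simp
  show "length (qutrit_channel \<alpha>) = 2" by (simp add: qutrit_channel_def)
qed

lemma E_entries:
  "E 0 0 0 = 0" "E 0 0 1 = s" "E 0 0 2 = 0" "E 0 1 0 = 0" "E 0 1 1 = 0" "E 0 1 2 = 1"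
  "E 0 2 0 = 0" "E 0 2 1 = 0" "E 0 2 2 = 0"
  "E 1 0 0 = 0" "E 1 0 1 = 0" "E 1 0 2 = 0" "E 1 1 0 = 1" "E 1 1 1 = 0" "E 1 1 2 = 0"
  "E 1 2 0 = 0" "E 1 2 1 = c" "E 1 2 2 = 0"
  by (simp_all add: qutrit_channel_def kraus0_def kraus1_def ketbra_def s_def c_def)

lemma T_0: "T 0 0 0 0 = 1" by (simp add: T_def id_channel_def)

lemma T_Suc:
  assumes "k < 2" "l < 2 ^ N" "i < 3" "i' < 3 ^ N" "a < 3" "a' < 3 ^ N"
  shows "T (Suc N) (k * 2 ^ N + l) (i * 3 ^ N + i') (a * 3 ^ N + a') = E k i a * T N l i' a'"
  using tensor_power_Suc_index[OF kraus_isometry_dims(4)[OF qutrit_isometry(1)], of k l N i i' a a']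
    assms qutrit_isometry(2) by (simp add: T_def)

subsection \<open>The classical capacity bound\<close>

text \<open>The diagonal of \<open>2 ^ N\<close> times the \<open>N\<close>-fold tensor power of
  \<sigma>, read along the ternary digits of \<open>i\<close> from the leading one. Without the
  factor one half per letter the bilinear bound below has constant 1.\<close>

primrec weight :: "nat \<Rightarrow> nat \<Rightarrow> real" where
  "weight 0 i = 1"
| "weight (Suc N) i = (if i div 3 ^ N = 0 then s\<^sup>2 else if i div 3 ^ N = 1 then 1 else c\<^sup>2) * weight N (i mod 3 ^ N)"

lemma weight_pos: "0 < weight N i"
  using sc by (induction N arbitrary: i) auto

lemma sum_weight_Suc:
  "(\<Sum>i<3 ^ Suc N. weight (Suc N) i * f i)
    = s\<^sup>2 * (\<Sum>i<3 ^ N. weight N i * f i) + (\<Sum>i<3 ^ N. weight N i * f (3 ^ N + i))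
      + c\<^sup>2 * (\<Sum>i<3 ^ N. weight N i * f (2 * 3 ^ N + i))"
proof -
  have "(\<Sum>i<3 ^ Suc N. weight (Suc N) i * f i) = (\<Sum>i0<3. \<Sum>i<3 ^ N. weight (Suc N) (i0 * 3 ^ N + i) * f (i0 * 3 ^ N + i))"
    unfolding power_Suc by (rule sum_lessThan_times)
  then show ?thesis
    by (simp add: sum_lessThan_3 sum_distrib_left mult.assoc)
qed

lemma sum_weight: "(\<Sum>i<3 ^ N. weight N i) = 2 ^ N"
proof (induction N)
  case (Suc N)
  have "(\<Sum>i<3 ^ Suc N. weight (Suc N) i) = (s\<^sup>2 + 1 + c\<^sup>2) * 2 ^ N"
    using sum_weight_Suc[of N "\<lambda>_. 1"] Suc by (simp add: algebra_simps)
  then show ?case using sc(4) by simp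
qed simp

definition "bil N u v k = (\<Sum>i<3 ^ N. u i * (\<Sum>a<3 ^ N. T N k i a * v a))"

lemma bil_Suc:
  assumes "k < 2" "l < 2 ^ N"
  shows "bil (Suc N) u v (k * 2 ^ N + l)
    = (\<Sum>i<3. \<Sum>a<3. E k i a * bil N (\<lambda>x. u (i * 3 ^ N + x)) (\<lambda>x. v (a * 3 ^ N + x)) l)"
proof -
  have "bil (Suc N) u v (k * 2 ^ N + l) = (\<Sum>i<3. \<Sum>i'<3 ^ N. \<Sum>a<3. \<Sum>a'<3 ^ N.
      u (i * 3 ^ N + i') * (E k i a * T N l i' a' * v (a * 3 ^ N + a')))"
    unfolding bil_def power_Suc sum_lessThan_times sum_distrib_left
    using assms by (intro sum.cong refl) (simp add: T_Suc)
  also have "\<dots> = (\<Sum>i<3. \<Sum>a<3. \<Sum>i'<3 ^ N. \<Sum>a'<3 ^ N.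
      u (i * 3 ^ N + i') * (E k i a * T N l i' a' * v (a * 3 ^ N + a')))"
    by (rule sum.cong[OF refl], rule sum.swap)
  also have "\<dots> = (\<Sum>i<3. \<Sum>a<3. E k i a * bil N (\<lambda>x. u (i * 3 ^ N + x)) (\<lambda>x. v (a * 3 ^ N + x)) l)"
    unfolding bil_def sum_distrib_left by (intro sum.cong refl) (simp add: ac_simps)
  finally show ?thesis .
qed

text \<open>For one use, writing \<open>u = (x, a)\<close> and \<open>v = (y, b)\<close> with middle entries \<open>x, y\<close>, the map is
  \<open>y a + x b\<close>; the triangle inequality and Cauchy-Schwarz then survive tensor products.\<close>

lemma bil_bound:
  "(\<Sum>k<2 ^ N. (cmod (bil N u v k))\<^sup>2) \<le> (\<Sum>i<3 ^ N. weight N i * (cmod (u i))\<^sup>2) * (\<Sum>a<3 ^ N. (cmod (v a))\<^sup>2)"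
proof (induction N arbitrary: u v)
  case 0
  then show ?case by (simp add: bil_def T_0 norm_mult power_mult_distrib)
next
  case (Suc N)
  let ?u = "\<lambda>i x. u (i * 3 ^ N + x)" and ?v = "\<lambda>a x. v (a * 3 ^ N + x)"
  define U where "U i = (\<Sum>x<3 ^ N. weight N x * (cmod (?u i x))\<^sup>2)" for i
  define V where "V a = (\<Sum>x<3 ^ N. (cmod (?v a x))\<^sup>2)" for a
  have U0: "0 \<le> U i" for i unfolding U_def by (intro sum_nonneg mult_nonneg_nonneg less_imp_le[OF weight_pos]) auto
  have V0: "0 \<le> V a" for a unfolding V_def by (simp add: sum_nonneg)
  have IH: "(\<Sum>k<2 ^ N. (cmod (bil N (?u i) (?v a) k))\<^sup>2) \<le> U i * V a" for i a
    unfolding U_def V_def by (rule Suc.IH)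
  \<comment> \<open>\<open>r div 2 ^ N\<close> is the leading environment letter. \<open>f\<close>
    collects input letter 1, which gives output 0 with environment 0 or output 2 with environment 1;
    \<open>g\<close> collects the letters 2 and 0, which both give output 1.\<close>
  define f where "f r = (if r div 2 ^ N = 0 then complex_of_real s * bil N (?u 0) (?v 1) (r mod 2 ^ N)
    else complex_of_real c * bil N (?u 2) (?v 1) (r mod 2 ^ N))" for r
  define g where "g r = (if r div 2 ^ N = 0 then bil N (?u 1) (?v 2) (r mod 2 ^ N)
    else bil N (?u 1) (?v 0) (r mod 2 ^ N))" for r
  have fg: "bil (Suc N) u v r = f r + g r" if r: "r < 2 ^ Suc N" for r
  proof -
    have q: "r div 2 ^ N < 2" "r mod 2 ^ N < 2 ^ N" using r by (auto simp: less_mult_imp_div_less)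
    have "r = r div 2 ^ N * 2 ^ N + r mod 2 ^ N" by (rule div_mult_mod_eq[symmetric])
    then have "bil (Suc N) u v r = (\<Sum>i<3. \<Sum>a<3. E (r div 2 ^ N) i a * bil N (?u i) (?v a) (r mod 2 ^ N))"
      using bil_Suc[OF q, of u v] by simp
    moreover have "r div 2 ^ N = 0 \<or> r div 2 ^ N = 1" using q(1) by auto
    ultimately show ?thesis
      unfolding f_def g_def sum_lessThan_3 by (elim disjE) (simp_all only: E_entries, auto)
  qed
  have split: "(\<Sum>r<2 ^ Suc N. h r) = (\<Sum>l<2 ^ N. h l) + (\<Sum>l<2 ^ N. h (2 ^ N + l))" for h :: "nat \<Rightarrow> real"
    unfolding power_Suc sum_lessThan_times sum_lessThan_2 by simp
  have F: "(\<Sum>r<2 ^ Suc N. (cmod (f r))\<^sup>2) \<le> (s\<^sup>2 * U 0 + c\<^sup>2 * U 2) * V 1"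
  proof -
    have "(\<Sum>r<2 ^ Suc N. (cmod (f r))\<^sup>2) = s\<^sup>2 * (\<Sum>k<2 ^ N. (cmod (bil N (?u 0) (?v 1) k))\<^sup>2)
        + c\<^sup>2 * (\<Sum>k<2 ^ N. (cmod (bil N (?u 2) (?v 1) k))\<^sup>2)"
      unfolding split by (simp add: f_def norm_mult power_mult_distrib sum_distrib_left)
    also have "\<dots> \<le> s\<^sup>2 * (U 0 * V 1) + c\<^sup>2 * (U 2 * V 1)"
      by (intro add_mono mult_left_mono IH) auto
    finally show ?thesis by (simp add: algebra_simps)
  qed
  have G: "(\<Sum>r<2 ^ Suc N. (cmod (g r))\<^sup>2) \<le> U 1 * (V 2 + V 0)"
    unfolding split using IH[of 1 2] IH[of 1 0] by (simp add: g_def algebra_simps)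
  have "(\<Sum>k<2 ^ Suc N. (cmod (bil (Suc N) u v k))\<^sup>2) = (\<Sum>k<2 ^ Suc N. (cmod (f k + g k))\<^sup>2)"
    by (intro sum.cong refl) (simp only: fg lessThan_iff)
  also have "\<dots> \<le> (sqrt (\<Sum>r<2 ^ Suc N. (cmod (f r))\<^sup>2) + sqrt (\<Sum>r<2 ^ Suc N. (cmod (g r))\<^sup>2))\<^sup>2"
    by (rule sum_cmod_add_square_le)
  also have "\<dots> \<le> (sqrt ((s\<^sup>2 * U 0 + c\<^sup>2 * U 2) * V 1) + sqrt (U 1 * (V 2 + V 0)))\<^sup>2"
    using F G by (intro power_mono add_mono real_sqrt_le_mono add_nonneg_nonneg real_sqrt_ge_zero sum_nonneg) auto
  \<comment> \<open>Cauchy-Schwarz pairs the output weights of \<open>f\<close> and \<open>g\<close>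
    with their input norms. The constant is 1, so nothing accumulates as \<open>N\<close>
    grows.\<close>
  also have "\<dots> \<le> (s\<^sup>2 * U 0 + c\<^sup>2 * U 2 + U 1) * (V 1 + (V 2 + V 0))"
    using U0 V0 by (intro sqrt_mult_add_square_le add_nonneg_nonneg mult_nonneg_nonneg) auto
  also have "V 1 + (V 2 + V 0) = (\<Sum>a<3 ^ Suc N. (cmod (v a))\<^sup>2)"
    unfolding power_Suc sum_lessThan_times sum_lessThan_3 V_def by simp
  also have "s\<^sup>2 * U 0 + c\<^sup>2 * U 2 + U 1 = (\<Sum>i<3 ^ Suc N. weight (Suc N) i * (cmod (u i))\<^sup>2)"
    unfolding sum_weight_Suc U_def by simp
  finally show ?case .
qed

lemma holevo_out_power_le:
  assumes "ens \<in> ensembles (3 ^ N)"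
  shows "holevo_out (tensor_power (qutrit_channel \<alpha>) N) ens \<le> real N"
proof -
  let ?Es = "tensor_power (qutrit_channel \<alpha>) N"
  have "holevo_out ?Es ens \<le> log 2 (2 ^ N)"
  proof (rule holevo_out_le_log[OF kraus_isometry_power[OF qutrit_isometry(1)] assms])
    \<comment> \<open>Normalising the weights moves the factor \<open>2 ^ N\<close> into the
      constant, whose logarithm is \<open>N\<close>.\<close>
    show "0 < weight N b / 2 ^ N" for b using weight_pos by simp
    show "(\<Sum>b<3 ^ N. weight N b / 2 ^ N) \<le> 1" by (simp add: sum_weight flip: sum_divide_distrib)
    fix u v :: "nat \<Rightarrow> complex"
    have "2 ^ N * (\<Sum>i<3 ^ N. weight N i / 2 ^ N * (cmod (u i))\<^sup>2) = (\<Sum>i<3 ^ N. weight N i * (cmod (u i))\<^sup>2)"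
      by (simp add: sum_distrib_left)
    then show "(\<Sum>k<length ?Es. (cmod (\<Sum>i<3 ^ N. u i * (\<Sum>a<3 ^ N. (?Es ! k) $$ (i, a) * v a)))\<^sup>2)
      \<le> 2 ^ N * (\<Sum>i<3 ^ N. weight N i / 2 ^ N * (cmod (u i))\<^sup>2) * (\<Sum>a<3 ^ N. (cmod (v a))\<^sup>2)"
      using bil_bound[of N u v] by (simp add: tensor_power_length qutrit_isometry(2) bil_def T_def)
  qed
  then show ?thesis by (simp add: log_nat_power)
qed

end

subsection \<open>Coherent information\<close>

text \<open>Both sides are Tr Z^2 for the operator Z that sums the projections onto the vectors
  \<open>V _ y\<close> with real weights \<open>r y\<close>, computed once from matrix entries and
  once from inner products of pairs of vectors.\<close>

lemma frobenius_gram: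
  fixes V :: "'k \<Rightarrow> 'y \<Rightarrow> complex"
  shows "(\<Sum>k\<in>K. \<Sum>k'\<in>K. (cmod (\<Sum>y\<in>Y. complex_of_real (r y) * V k y * cnj (V k' y)))\<^sup>2)
    = (\<Sum>y\<in>Y. \<Sum>y'\<in>Y. r y * r y' * (cmod (\<Sum>k\<in>K. cnj (V k y) * V k y'))\<^sup>2)"
proof -
  let ?f = "\<lambda>k k' y y'. complex_of_real (r y * r y') * ((cnj (V k' y) * V k' y') * cnj (cnj (V k y) * V k y'))"
  have "complex_of_real (\<Sum>k\<in>K. \<Sum>k'\<in>K. (cmod (\<Sum>y\<in>Y. complex_of_real (r y) * V k y * cnj (V k' y)))\<^sup>2)
      = (\<Sum>k\<in>K. \<Sum>k'\<in>K. \<Sum>y\<in>Y. \<Sum>y'\<in>Y. ?f k k' y y')"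
    by (simp only: of_real_sum complex_norm_square cnj_sum sum_product) (simp add: ac_simps)
  also have "\<dots> = (\<Sum>k\<in>K. \<Sum>y\<in>Y. \<Sum>k'\<in>K. \<Sum>y'\<in>Y. ?f k k' y y')"
    by (rule sum.cong[OF refl], rule sum.swap)
  also have "\<dots> = (\<Sum>y\<in>Y. \<Sum>k\<in>K. \<Sum>k'\<in>K. \<Sum>y'\<in>Y. ?f k k' y y')"
    by (rule sum.swap)
  also have "\<dots> = (\<Sum>y\<in>Y. \<Sum>k\<in>K. \<Sum>y'\<in>Y. \<Sum>k'\<in>K. ?f k k' y y')"
    by (rule sum.cong[OF refl], rule sum.cong[OF refl], rule sum.swap)
  also have "\<dots> = (\<Sum>y\<in>Y. \<Sum>y'\<in>Y. \<Sum>k\<in>K. \<Sum>k'\<in>K. ?f k k' y y')"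
    by (rule sum.cong[OF refl], rule sum.swap)
  also have "\<dots> = (\<Sum>y\<in>Y. \<Sum>y'\<in>Y. \<Sum>k'\<in>K. \<Sum>k\<in>K. ?f k k' y y')"
    by (rule sum.cong[OF refl], rule sum.cong[OF refl], rule sum.swap)
  also have "\<dots> = complex_of_real (\<Sum>y\<in>Y. \<Sum>y'\<in>Y. r y * r y' * (cmod (\<Sum>k\<in>K. cnj (V k y) * V k y'))\<^sup>2)"
    by (simp only: of_real_sum of_real_mult complex_norm_square cnj_sum sum_product) (simp only: sum_distrib_left)
  finally show ?thesis by (simp only: of_real_eq_iff)
qed

text \<open>Halving the logarithm prepares for Cauchy-Schwarz: the environment eigenvalues enter as
  square roots, and the operator square root of a state has Hilbert-Schmidt norm 1.\<close>

lemma log_square_div: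
  assumes "0 < t" "0 < b"
  shows "log 2 t - log 2 b = 2 * log 2 (sqrt t / sqrt b)"
  using assms by (simp add: log_def ln_div ln_sqrt field_simps)

text \<open>The environment state is \<open>\<tau> = \<Sum>\<^sub>b \<tau>\<^sub>b\<close>, where \<open>\<tau>\<^sub>b\<close> with trace \<open>\<beta>\<^sub>b\<close> belongs to the output
  outcome \<open>b\<close>. Concavity of the logarithm and Cauchy-Schwarz bound the coherent information by the logarithm of
  \<open>Tr (\<Sum>\<^sub>b \<tau>\<^sub>b / sqrt \<beta>\<^sub>b)\<^sup>2\<close>.\<close>

lemma coherent_information_le_log:
  assumes E: "kraus_isometry m n Es" and F: "kraus_isometry (length Es) n Fs" "length Fs = m"
    and FE: "\<And>b k a. b < m \<Longrightarrow> k < length Es \<Longrightarrow> a < n \<Longrightarrow> (Fs ! b) $$ (k, a) = (Es ! k) $$ (b, a)"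
    and \<rho>: "\<rho> \<in> density_ops n"
    and W: "\<And>a b. a < n \<Longrightarrow> b < n \<Longrightarrow> \<rho> $$ (a, b) = (\<Sum>x<M. W a x * cnj (W b x))"
  defines "X \<equiv> \<lambda>b k x. \<Sum>a<n. (Es ! k) $$ (b, a) * W a x"
  defines "\<beta> \<equiv> \<lambda>b. \<Sum>k<length Es. \<Sum>x<M. (cmod (X b k x))\<^sup>2"
  assumes bound: "(\<Sum>b<m. \<Sum>b'<m. (\<Sum>x<M. \<Sum>x'<M. (cmod (\<Sum>k<length Es. cnj (X b k x) * X b' k x'))\<^sup>2)
      / (sqrt (\<beta> b) * sqrt (\<beta> b'))) \<le> \<mu>"
  shows "vn_entropy (apply_channel Es \<rho>) - vn_entropy (apply_channel Fs \<rho>) \<le> log 2 \<mu>"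
proof -
  let ?L = "length Es"
  have \<rho>c: "\<rho> \<in> carrier_mat n n" using \<rho> by (simp add: density_ops_def)
  note B = apply_channel_density[OF E \<rho>] and C = apply_channel_density[OF F(1) \<rho>]
  have Bb: "Re (apply_channel Es \<rho> $$ (b, b)) = \<beta> b" if b: "b < m" for b
  proof -
    have "apply_channel Es \<rho> $$ (b, b) = (\<Sum>k<?L. \<Sum>x<M. X b k x * cnj (X b k x))"
      unfolding X_def by (rule apply_channel_gram[OF E \<rho>c _ b b]) (rule W)
    also have "\<dots> = complex_of_real (\<beta> b)"
      by (simp only: \<beta>_def of_real_sum complex_norm_square)
    finally have "apply_channel Es \<rho> $$ (b, b) = complex_of_real (\<beta> b)" .
    then show ?thesis by simp
  qed
  have b0: "0 \<le> \<beta> b" for b unfolding \<beta>_def by (simp add: sum_nonneg)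
  have b1: "(\<Sum>b<m. \<beta> b) = 1" using density_diag(3)[OF B] Bb by simp
  have HB: "vn_entropy (apply_channel Es \<rho>) \<le> - (\<Sum>b<m. \<beta> b * log 2 (\<beta> b))"
    using vn_entropy_le_diagonal_cross_entropy[OF B, of \<beta>] b0 b1 Bb by simp
  obtain U t where U: "unitary_on ?L U" "\<And>j. j < ?L \<Longrightarrow> 0 \<le> t j" "(\<Sum>j<?L. t j) = 1"
    "\<And>a b. a < ?L \<Longrightarrow> b < ?L \<Longrightarrow> apply_channel Fs \<rho> $$ (a, b) = (\<Sum>j<?L. complex_of_real (t j) * U j a * cnj (U j b))"
    "vn_entropy (apply_channel Fs \<rho>) = - (\<Sum>j<?L. t j * log 2 (t j))"
    by (rule density_eigenbasis[OF C], rule that)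
  have orth: "(\<Sum>k<?L. cnj (U i k) * U j k) = (if i = j then 1 else 0)" if "i < ?L" "j < ?L" for i j
    using U(1) that by (simp add: unitary_on_def)
  have C_gram: "apply_channel Fs \<rho> $$ (k, k') = (\<Sum>p\<in>{..<m} \<times> {..<M}.
      complex_of_real 1 * X (fst p) k (snd p) * cnj (X (fst p) k' (snd p)))" if k: "k < ?L" "k' < ?L" for k k'
  proof -
    have "apply_channel Fs \<rho> $$ (k, k') = (\<Sum>b<length Fs. \<Sum>x<M.
        (\<Sum>a<n. (Fs ! b) $$ (k, a) * W a x) * cnj (\<Sum>a<n. (Fs ! b) $$ (k', a) * W a x))"
      by (rule apply_channel_gram[OF F(1) \<rho>c _ k]) (rule W)
    also have "\<dots> = (\<Sum>b<m. \<Sum>x<M. X b k x * cnj (X b k' x))"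
      unfolding F(2) X_def using k by (intro sum.cong refl) (simp add: FE)
    finally show ?thesis by (simp add: sum.cartesian_product split_def)
  qed
  \<comment> \<open>Joint distribution of the output outcome \<open>b\<close> and the environment
    eigenvector \<open>j\<close>; its marginals are \<open>\<beta>\<close> and
    \<open>t\<close>.\<close>
  define w where "w b j = (\<Sum>x<M. (cmod (\<Sum>k<?L. cnj (U j k) * X b k x))\<^sup>2)" for b j
  have w0: "0 \<le> w b j" for b j unfolding w_def by (simp add: sum_nonneg)
  have wt: "(\<Sum>b<m. w b j) = t j" if j: "j < ?L" for j
  proof -
    have "complex_of_real (\<Sum>b<m. w b j)
        = complex_of_real (\<Sum>p\<in>{..<m} \<times> {..<M}. 1 * (cmod (\<Sum>k<?L. cnj (U j k) * X (fst p) k (snd p)))\<^sup>2)"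
      by (simp add: w_def sum.cartesian_product split_def)
    also have "\<dots> = (\<Sum>k<?L. \<Sum>k'<?L. cnj (U j k) * apply_channel Fs \<rho> $$ (k, k') * U j k')"
      by (rule quadratic_form_gram[symmetric]) (rule C_gram)
    also have "\<dots> = complex_of_real (\<Sum>i<?L. t i * (cmod (\<Sum>k<?L. cnj (U j k) * U i k))\<^sup>2)"
      by (rule quadratic_form_gram) (rule U(4))
    also have "(\<Sum>i<?L. t i * (cmod (\<Sum>k<?L. cnj (U j k) * U i k))\<^sup>2) = (\<Sum>i<?L. if i = j then t j else 0)"
      using j by (intro sum.cong refl) (auto simp: orth)
    also have "\<dots> = t j" using j by simp
    finally show ?thesis by (simp only: of_real_eq_iff)
  qed
  have wb: "(\<Sum>j<?L. w b j) = \<beta> b" for b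
  proof -
    have "(\<Sum>j<?L. w b j) = (\<Sum>x<M. \<Sum>k<?L. (cmod (X b k x))\<^sup>2)"
      unfolding w_def by (subst sum.swap) (simp only: unitary_parseval[OF U(1)])
    then show ?thesis unfolding \<beta>_def by (subst sum.swap) simp
  qed
  let ?P = "{..<m} \<times> {..<?L}"
  have pos: "0 < t (snd p)" "0 < \<beta> (fst p)" if p: "p \<in> ?P" "0 < w (fst p) (snd p)" for p
  proof -
    show "0 < t (snd p)" using p wt[of "snd p"] w0 sum_pos2[of "{..<m}" "fst p" "\<lambda>b. w b (snd p)"] by auto
    show "0 < \<beta> (fst p)" using p wb[of "fst p"] w0 sum_pos2[of "{..<?L}" "snd p" "w (fst p)"] by auto
  qed
  have w1: "(\<Sum>p\<in>?P. w (fst p) (snd p)) = 1"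
  proof -
    have "(\<Sum>p\<in>?P. w (fst p) (snd p)) = (\<Sum>b<m. \<Sum>j<?L. w b j)"
      by (simp add: sum.cartesian_product split_def)
    then show ?thesis by (simp add: wb b1)
  qed
  let ?q = "\<lambda>p. sqrt (t (snd p)) / sqrt (\<beta> (fst p))"
  define S where "S = (\<Sum>p\<in>?P. w (fst p) (snd p) * ?q p)"
  have S: "0 < S" unfolding S_def using w0 w1 pos by (intro sum_weighted_pos) auto
  have "- (\<Sum>b<m. \<beta> b * log 2 (\<beta> b)) - vn_entropy (apply_channel Fs \<rho>)
      = (\<Sum>j<?L. \<Sum>b<m. w b j * log 2 (t j)) - (\<Sum>b<m. \<Sum>j<?L. w b j * log 2 (\<beta> b))"
    by (simp add: U(5) wt wb flip: sum_distrib_right)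
  also have "(\<Sum>j<?L. \<Sum>b<m. w b j * log 2 (t j)) = (\<Sum>b<m. \<Sum>j<?L. w b j * log 2 (t j))"
    by (rule sum.swap)
  also have "\<dots> - (\<Sum>b<m. \<Sum>j<?L. w b j * log 2 (\<beta> b))
      = (\<Sum>p\<in>?P. w (fst p) (snd p) * log 2 (t (snd p)) - w (fst p) (snd p) * log 2 (\<beta> (fst p)))"
    by (simp add: sum.cartesian_product split_def sum_subtractf)
  also have "\<dots> = (\<Sum>p\<in>?P. 2 * (w (fst p) (snd p) * log 2 (?q p)))"
  proof (rule sum.cong[OF refl])
    fix p assume p: "p \<in> ?P"
    show "w (fst p) (snd p) * log 2 (t (snd p)) - w (fst p) (snd p) * log 2 (\<beta> (fst p))
      = 2 * (w (fst p) (snd p) * log 2 (?q p))"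
    proof (cases "w (fst p) (snd p) = 0")
      case False
      then have "0 < w (fst p) (snd p)" using w0[of "fst p" "snd p"] by simp
      from log_square_div[OF pos[OF p this]] show ?thesis by (simp add: algebra_simps)
    qed simp
  qed
  also have "\<dots> = 2 * (\<Sum>p\<in>?P. w (fst p) (snd p) * log 2 (?q p))" by (simp only: sum_distrib_left)
  also have "\<dots> \<le> 2 * log 2 S"
    unfolding S_def using w0 w1 pos by (intro mult_left_mono sum_weighted_log_le) auto
  also have "\<dots> = log 2 (S\<^sup>2)" using S by (simp add: log_nat_power)
  finally have main: "- (\<Sum>b<m. \<beta> b * log 2 (\<beta> b)) - vn_entropy (apply_channel Fs \<rho>) \<le> log 2 (S\<^sup>2)" .
  \<comment> \<open>\<open>Z\<close> is the sum of the \<tau>_b / sqrt \<beta>_b and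
    \<open>R\<close> below is the square root of the environment state, so that \<open>S\<close>
    becomes Tr (Z R).\<close>
  define Z where "Z = mat ?L ?L (\<lambda>(k, k'). \<Sum>p\<in>{..<m} \<times> {..<M}.
    complex_of_real (1 / sqrt (\<beta> (fst p))) * X (fst p) k (snd p) * cnj (X (fst p) k' (snd p)))"
  define R where "R k k' = (\<Sum>j<?L. complex_of_real (sqrt (t j)) * U j k * cnj (U j k'))" for k k'
  have Zq: "complex_of_real (\<Sum>b<m. w b j * (1 / sqrt (\<beta> b)))
      = (\<Sum>k<?L. \<Sum>k'<?L. cnj (U j k) * Z $$ (k, k') * U j k')" for j
  proof -
    have "(\<Sum>b<m. w b j * (1 / sqrt (\<beta> b)))
        = (\<Sum>b<m. \<Sum>x<M. 1 / sqrt (\<beta> b) * (cmod (\<Sum>k<?L. cnj (U j k) * X b k x))\<^sup>2)"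
      unfolding w_def by (subst mult.commute) (simp only: sum_distrib_left)
    also have "\<dots> = (\<Sum>p\<in>{..<m} \<times> {..<M}. 1 / sqrt (\<beta> (fst p)) * (cmod (\<Sum>k<?L. cnj (U j k) * X (fst p) k (snd p)))\<^sup>2)"
      by (simp add: sum.cartesian_product split_def)
    finally have "(\<Sum>b<m. w b j * (1 / sqrt (\<beta> b)))
      = (\<Sum>p\<in>{..<m} \<times> {..<M}. 1 / sqrt (\<beta> (fst p)) * (cmod (\<Sum>k<?L. cnj (U j k) * X (fst p) k (snd p)))\<^sup>2)" .
    then show ?thesis
      by (simp only:) (rule quadratic_form_gram[symmetric], simp add: Z_def)
  qed
  have "complex_of_real S = (\<Sum>j<?L. complex_of_real (sqrt (t j)) * complex_of_real (\<Sum>b<m. w b j * (1 / sqrt (\<beta> b))))"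
  proof -
    have "S = (\<Sum>b<m. \<Sum>j<?L. w b j * (sqrt (t j) / sqrt (\<beta> b)))"
      by (simp add: S_def sum.cartesian_product split_def)
    also have "\<dots> = (\<Sum>j<?L. sqrt (t j) * (\<Sum>b<m. w b j * (1 / sqrt (\<beta> b))))"
      by (subst sum.swap) (simp add: sum_distrib_left ac_simps)
    finally show ?thesis by (simp only: of_real_sum of_real_mult)
  qed
  also have "\<dots> = (\<Sum>j<?L. \<Sum>k<?L. \<Sum>k'<?L. Z $$ (k, k') * (complex_of_real (sqrt (t j)) * U j k' * cnj (U j k)))"
    unfolding Zq sum_distrib_left by (simp add: ac_simps)
  also have "\<dots> = (\<Sum>k<?L. \<Sum>j<?L. \<Sum>k'<?L. Z $$ (k, k') * (complex_of_real (sqrt (t j)) * U j k' * cnj (U j k)))"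
    by (rule sum.swap)
  also have "\<dots> = (\<Sum>k<?L. \<Sum>k'<?L. \<Sum>j<?L. Z $$ (k, k') * (complex_of_real (sqrt (t j)) * U j k' * cnj (U j k)))"
    by (rule sum.cong[OF refl], rule sum.swap)
  also have "\<dots> = (\<Sum>p\<in>{..<?L} \<times> {..<?L}. Z $$ p * R (snd p) (fst p))"
    unfolding sum_Times fst_conv snd_conv R_def sum_distrib_left ..
  finally have "S\<^sup>2 = (cmod (\<Sum>p\<in>{..<?L} \<times> {..<?L}. Z $$ p * R (snd p) (fst p)))\<^sup>2"
    by (metis norm_of_real power2_abs)
  \<comment> \<open>Cauchy-Schwarz for the Hilbert-Schmidt inner product; the second factor is the
    trace of the environment state, hence 1.\<close>
  also have "\<dots> \<le> (\<Sum>p\<in>{..<?L} \<times> {..<?L}. (cmod (Z $$ p))\<^sup>2) * (\<Sum>p\<in>{..<?L} \<times> {..<?L}. (cmod (R (snd p) (fst p)))\<^sup>2)"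
    by (rule cmod_sum_mult_square_le)
  also have "(\<Sum>p\<in>{..<?L} \<times> {..<?L}. (cmod (R (snd p) (fst p)))\<^sup>2) = (\<Sum>k<?L. \<Sum>k'<?L. (cmod (R k k'))\<^sup>2)"
    by (subst sum.swap) (simp add: sum.cartesian_product split_def)
  also have "\<dots> = (\<Sum>j<?L. \<Sum>j'<?L. sqrt (t j) * sqrt (t j') * (cmod (\<Sum>k<?L. cnj (U j k) * U j' k))\<^sup>2)"
    unfolding R_def by (rule frobenius_gram)
  also have "\<dots> = (\<Sum>j<?L. \<Sum>j'<?L. if j' = j then t j else 0)"
    using U(2) by (intro sum.cong refl) (auto simp: orth)
  also have "\<dots> = 1" using U(3) by simp
  also have "(\<Sum>p\<in>{..<?L} \<times> {..<?L}. (cmod (Z $$ p))\<^sup>2) = (\<Sum>k<?L. \<Sum>k'<?L. (cmod (\<Sum>p\<in>{..<m} \<times> {..<M}.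
    complex_of_real (1 / sqrt (\<beta> (fst p))) * X (fst p) k (snd p) * cnj (X (fst p) k' (snd p))))\<^sup>2)"
    unfolding sum_Times[of _ "{..<?L}"] by (intro sum.cong refl) (auto simp: Z_def)
  also have "\<dots> = (\<Sum>p\<in>{..<m} \<times> {..<M}. \<Sum>p'\<in>{..<m} \<times> {..<M}. 1 / sqrt (\<beta> (fst p)) * (1 / sqrt (\<beta> (fst p')))
      * (cmod (\<Sum>k<?L. cnj (X (fst p) k (snd p)) * X (fst p') k (snd p')))\<^sup>2)"
    by (rule frobenius_gram)
  also have "\<dots> = (\<Sum>b<m. \<Sum>x<M. \<Sum>b'<m. \<Sum>x'<M. 1 / sqrt (\<beta> b) * (1 / sqrt (\<beta> b'))
      * (cmod (\<Sum>k<?L. cnj (X b k x) * X b' k x'))\<^sup>2)"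
    unfolding sum_Times fst_conv snd_conv ..
  also have "\<dots> = (\<Sum>b<m. \<Sum>b'<m. \<Sum>x<M. \<Sum>x'<M. 1 / sqrt (\<beta> b) * (1 / sqrt (\<beta> b'))
      * (cmod (\<Sum>k<?L. cnj (X b k x) * X b' k x'))\<^sup>2)"
    by (rule sum.cong[OF refl], rule sum.swap)
  also have "\<dots> = (\<Sum>b<m. \<Sum>b'<m. (\<Sum>x<M. \<Sum>x'<M. (cmod (\<Sum>k<?L. cnj (X b k x) * X b' k x'))\<^sup>2)
      / (sqrt (\<beta> b) * sqrt (\<beta> b')))"
    by (simp add: sum_divide_distrib)
  also note bound
  finally have "S\<^sup>2 \<le> \<mu>" by simp
  then have "log 2 (S\<^sup>2) \<le> log 2 \<mu>" using S by (subst log_le_cancel_iff) (auto intro: less_le_trans[of 0 "S\<^sup>2"])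
  then show ?thesis using HB main by simp
qed

type_synonym amplitudes = "nat \<Rightarrow> nat \<Rightarrow> nat \<Rightarrow> complex"

context qutrit
begin

subsection \<open>The quantum capacity bound\<close>

text \<open>Amplitudes \<open>W k a m\<close> carry an input index \<open>a < 3 ^ N\<close>, an index \<open>k\<close> of a system held by the
  environment, and an index \<open>m\<close> of a system that is traced out. An input letter 0 or 2 reaches the environment
  unchanged, so the induction moves it into \<open>k\<close>, or into \<open>m\<close> when the environment factor is summed over.\<close>

definition kout :: "nat \<Rightarrow> amplitudes \<Rightarrow> nat \<Rightarrow> nat \<Rightarrow> nat \<Rightarrow> nat \<Rightarrow> complex" where
  "kout N W b k e m = (\<Sum>a<3 ^ N. T N e b a * W k a m)"
definition knorm :: "nat \<Rightarrow> nat \<Rightarrow> nat \<Rightarrow> amplitudes \<Rightarrow> nat \<Rightarrow> real" where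
  "knorm N \<kappa> \<mu> W b = (\<Sum>k<\<kappa>. \<Sum>e<2 ^ N. \<Sum>m<\<mu>. (cmod (kout N W b k e m))\<^sup>2)"
text \<open>Tr (\<tau>_b \<tau>'_b') for the unnormalised conditional operators on \<open>k\<close>
  and the environment, with \<open>m\<close> traced out. Two families of amplitudes are needed
  because the cross terms of the recursion pair different input letters; they share the system
  \<open>k\<close> but may differ in what is traced out.\<close>

definition overlap :: "nat \<Rightarrow> nat \<Rightarrow> nat \<Rightarrow> nat \<Rightarrow> amplitudes \<Rightarrow> amplitudes \<Rightarrow> nat \<Rightarrow> nat \<Rightarrow> real" where
  "overlap N \<kappa> \<mu> \<mu>' W W' b b' = (\<Sum>m<\<mu>. \<Sum>m'<\<mu>'.
  (cmod (\<Sum>k<\<kappa>. \<Sum>e<2 ^ N. cnj (kout N W b k e m) * kout N W' b' k e m'))\<^sup>2)"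
definition nover :: "nat \<Rightarrow> nat \<Rightarrow> nat \<Rightarrow> nat \<Rightarrow> amplitudes \<Rightarrow> amplitudes \<Rightarrow> nat \<Rightarrow> nat \<Rightarrow> real" where
  "nover N \<kappa> \<mu> \<mu>' W W' b b'
  = overlap N \<kappa> \<mu> \<mu>' W W' b b' / (sqrt (knorm N \<kappa> \<mu> W b) * sqrt (knorm N \<kappa> \<mu>' W' b'))"
definition energy :: "nat \<Rightarrow> nat \<Rightarrow> nat \<Rightarrow> amplitudes \<Rightarrow> real" where
  "energy N \<kappa> \<mu> W = (\<Sum>k<\<kappa>. \<Sum>a<3 ^ N. \<Sum>m<\<mu>. (cmod (W k a m))\<^sup>2)"
definition shift :: "nat \<Rightarrow> nat \<Rightarrow> amplitudes \<Rightarrow> amplitudes" where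
  "shift N j W k a m = W k (j * 3 ^ N + a) m"
text \<open>Environment letter 0 comes from input letter 2 and environment letter 1 from input
  letter 0; the value is the offset of that input letter.\<close>

definition pass :: "nat \<Rightarrow> nat \<Rightarrow> nat" where
  "pass N e = (if e = 0 then 2 else 0) * 3 ^ N"
definition stackK :: "nat \<Rightarrow> amplitudes \<Rightarrow> amplitudes" where
  "stackK N W k a m = W (k div 2) (pass N (k mod 2) + a) m"
definition stackM :: "nat \<Rightarrow> amplitudes \<Rightarrow> amplitudes" where
  "stackM N W k a m = W k (pass N (m mod 2) + a) (m div 2)"

lemma sum_lessThan_double: "(\<Sum>k<n * (2::nat). f k) = (\<Sum>k<n. f (k * 2) + f (Suc (k * 2)))"
  unfolding sum_lessThan_times[of _ n 2] sum_lessThan_2 by simp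

lemma sum_lessThan_pow2_Suc: "(\<Sum>e<(2::nat) ^ Suc N. f e) = (\<Sum>e<2 ^ N. f e + f (2 ^ N + e))"
  unfolding power_Suc sum_lessThan_times sum_lessThan_2 by (simp add: sum.distrib)

lemma kout_Suc:
  assumes "e < 2" "f < 2 ^ N" "i < 3" "b < 3 ^ N"
  shows "kout (Suc N) W (i * 3 ^ N + b) k (e * 2 ^ N + f) m = (\<Sum>j<3. E e i j * kout N (shift N j W) b k f m)"
  unfolding kout_def power_Suc sum_lessThan_times sum_distrib_left
  using assms by (intro sum.cong refl) (simp add: T_Suc shift_def)

lemma kout_Suc_cases:
  assumes "f < 2 ^ N" "b < 3 ^ N"
  shows "kout (Suc N) W b k f m = s * kout N (shift N 1 W) b k f m"
    "kout (Suc N) W b k (2 ^ N + f) m = 0"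
    "kout (Suc N) W (3 ^ N + b) k f m = kout N (shift N 2 W) b k f m"
    "kout (Suc N) W (3 ^ N + b) k (2 ^ N + f) m = kout N (shift N 0 W) b k f m"
    "kout (Suc N) W (2 * 3 ^ N + b) k f m = 0"
    "kout (Suc N) W (2 * 3 ^ N + b) k (2 ^ N + f) m = c * kout N (shift N 1 W) b k f m"
  using kout_Suc[of 0 f N 0 b W k m] kout_Suc[of 1 f N 0 b W k m] kout_Suc[of 0 f N 1 b W k m]
    kout_Suc[of 1 f N 1 b W k m] kout_Suc[of 0 f N 2 b W k m] kout_Suc[of 1 f N 2 b W k m] assms
  by (simp_all only: sum_lessThan_3 E_entries) simp_all

lemma kout_stack:
  "kout N (stackK N W) b (k * 2) e m = kout N (shift N 2 W) b k e m"
  "kout N (stackK N W) b (Suc (k * 2)) e m = kout N (shift N 0 W) b k e m"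
  "kout N (stackM N W) b k e (m * 2) = kout N (shift N 2 W) b k e m"
  "kout N (stackM N W) b k e (Suc (m * 2)) = kout N (shift N 0 W) b k e m"
proof -
  have "Suc (x * 2) div 2 = x" "Suc (x * 2) mod 2 = 1" for x :: nat by presburger+
  then show "kout N (stackK N W) b (k * 2) e m = kout N (shift N 2 W) b k e m"
    "kout N (stackK N W) b (Suc (k * 2)) e m = kout N (shift N 0 W) b k e m"
    "kout N (stackM N W) b k e (m * 2) = kout N (shift N 2 W) b k e m"
    "kout N (stackM N W) b k e (Suc (m * 2)) = kout N (shift N 0 W) b k e m"
    by (simp_all add: kout_def stackK_def stackM_def shift_def pass_def)
qed

text \<open>The last equation holds because a norm does not see whether a letter sits in
  \<open>k\<close> or in \<open>m\<close>; it gives both ways of stacking the same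
  normalisation.\<close>

lemma knorm_Suc:
  assumes "b < 3 ^ N"
  shows "knorm (Suc N) \<kappa> \<mu> W b = s\<^sup>2 * knorm N \<kappa> \<mu> (shift N 1 W) b"
    "knorm (Suc N) \<kappa> \<mu> W (3 ^ N + b) = knorm N (\<kappa> * 2) \<mu> (stackK N W) b"
    "knorm (Suc N) \<kappa> \<mu> W (2 * 3 ^ N + b) = c\<^sup>2 * knorm N \<kappa> \<mu> (shift N 1 W) b"
    "knorm N \<kappa> (\<mu> * 2) (stackM N W) b = knorm N (\<kappa> * 2) \<mu> (stackK N W) b"
  unfolding knorm_def sum_lessThan_pow2_Suc sum_lessThan_double
  using assms
  by (simp_all add: kout_Suc_cases kout_stack norm_mult power_mult_distrib sum_distrib_left sum.distrib)

text \<open>Outputs 0 and 2 leave the environment in the orthogonal letters 0 and 1, so their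
  overlap vanishes. Against output 1 a single environment letter survives and selects input letter 2
  or 0, while two outputs 1 keep both letters coherently, hence \<open>stackK\<close>.\<close>

lemma overlap_Suc:
  assumes "b < 3 ^ N" "b' < 3 ^ N"
  shows "overlap (Suc N) \<kappa> \<mu> \<mu>' W W' b b' = s ^ 4 * overlap N \<kappa> \<mu> \<mu>' (shift N 1 W) (shift N 1 W') b b'"
    "overlap (Suc N) \<kappa> \<mu> \<mu>' W W' (2 * 3 ^ N + b) (2 * 3 ^ N + b')
      = c ^ 4 * overlap N \<kappa> \<mu> \<mu>' (shift N 1 W) (shift N 1 W') b b'"
    "overlap (Suc N) \<kappa> \<mu> \<mu>' W W' b (2 * 3 ^ N + b') = 0"
    "overlap (Suc N) \<kappa> \<mu> \<mu>' W W' (2 * 3 ^ N + b) b' = 0"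
    "overlap (Suc N) \<kappa> \<mu> \<mu>' W W' (3 ^ N + b) (3 ^ N + b')
      = overlap N (\<kappa> * 2) \<mu> \<mu>' (stackK N W) (stackK N W') b b'"
    "overlap (Suc N) \<kappa> \<mu> \<mu>' W W' b (3 ^ N + b')
      = s\<^sup>2 * overlap N \<kappa> \<mu> \<mu>' (shift N 1 W) (shift N 2 W') b b'"
    "overlap (Suc N) \<kappa> \<mu> \<mu>' W W' (2 * 3 ^ N + b) (3 ^ N + b')
      = c\<^sup>2 * overlap N \<kappa> \<mu> \<mu>' (shift N 1 W) (shift N 0 W') b b'"
proof -
  have scale: "(\<Sum>m<\<mu>. \<Sum>m'<\<mu>'. (cmod (\<Sum>k<\<kappa>. \<Sum>e<2 ^ N. complex_of_real r * f m m' k e))\<^sup>2)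
      = r\<^sup>2 * (\<Sum>m<\<mu>. \<Sum>m'<\<mu>'. (cmod (\<Sum>k<\<kappa>. \<Sum>e<2 ^ N. f m m' k e))\<^sup>2)" for r f
    by (simp add: norm_mult power_mult_distrib flip: sum_distrib_left)
  note [simp] = kout_Suc_cases[OF _ assms(1)] kout_Suc_cases[OF _ assms(2)]
  have p4: "x ^ 4 = (x\<^sup>2)\<^sup>2" for x :: real by simp
  show "overlap (Suc N) \<kappa> \<mu> \<mu>' W W' b b' = s ^ 4 * overlap N \<kappa> \<mu> \<mu>' (shift N 1 W) (shift N 1 W') b b'"
    unfolding overlap_def sum_lessThan_pow2_Suc p4 scale[symmetric]
    by (simp add: power2_eq_square mult_ac)
  show "overlap (Suc N) \<kappa> \<mu> \<mu>' W W' (2 * 3 ^ N + b) (2 * 3 ^ N + b')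
      = c ^ 4 * overlap N \<kappa> \<mu> \<mu>' (shift N 1 W) (shift N 1 W') b b'"
    unfolding overlap_def sum_lessThan_pow2_Suc p4 scale[symmetric]
    by (simp add: power2_eq_square mult_ac)
  show "overlap (Suc N) \<kappa> \<mu> \<mu>' W W' b (2 * 3 ^ N + b') = 0"
    "overlap (Suc N) \<kappa> \<mu> \<mu>' W W' (2 * 3 ^ N + b) b' = 0"
    unfolding overlap_def sum_lessThan_pow2_Suc by simp_all
  show "overlap (Suc N) \<kappa> \<mu> \<mu>' W W' (3 ^ N + b) (3 ^ N + b')
      = overlap N (\<kappa> * 2) \<mu> \<mu>' (stackK N W) (stackK N W') b b'"
    unfolding overlap_def sum_lessThan_pow2_Suc sum_lessThan_double
    by (simp add: kout_stack sum.distrib)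
  show "overlap (Suc N) \<kappa> \<mu> \<mu>' W W' b (3 ^ N + b')
      = s\<^sup>2 * overlap N \<kappa> \<mu> \<mu>' (shift N 1 W) (shift N 2 W') b b'"
    unfolding overlap_def sum_lessThan_pow2_Suc scale[symmetric] by (simp add: mult_ac)
  show "overlap (Suc N) \<kappa> \<mu> \<mu>' W W' (2 * 3 ^ N + b) (3 ^ N + b')
      = c\<^sup>2 * overlap N \<kappa> \<mu> \<mu>' (shift N 1 W) (shift N 0 W') b b'"
    unfolding overlap_def sum_lessThan_pow2_Suc scale[symmetric] by (simp add: mult_ac)
qed

text \<open>A letter in the traced-out system is summed outside the modulus, so overlaps add. This
  turns the two cross terms, one for each passed letter, into a single instance of the same
  functional.\<close>

lemma overlap_stackM:
  "overlap N \<kappa> \<mu> (\<mu>' * 2) W (stackM N W') b b'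
    = overlap N \<kappa> \<mu> \<mu>' W (shift N 2 W') b b' + overlap N \<kappa> \<mu> \<mu>' W (shift N 0 W') b b'"
  unfolding overlap_def sum_lessThan_double by (simp add: kout_stack sum.distrib)

lemma overlap_commute: "overlap N \<kappa> \<mu> \<mu>' W W' b b' = overlap N \<kappa> \<mu>' \<mu> W' W b' b"
proof -
  have "(\<Sum>k<\<kappa>. \<Sum>e<2 ^ N. cnj (kout N W b k e m) * kout N W' b' k e m')
      = cnj (\<Sum>k<\<kappa>. \<Sum>e<2 ^ N. cnj (kout N W' b' k e m') * kout N W b k e m)" for m m'
    by (simp add: mult.commute)
  then have eq: "(cmod (\<Sum>k<\<kappa>. \<Sum>e<2 ^ N. cnj (kout N W b k e m) * kout N W' b' k e m'))\<^sup>2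
      = (cmod (\<Sum>k<\<kappa>. \<Sum>e<2 ^ N. cnj (kout N W' b' k e m') * kout N W b k e m))\<^sup>2" for m m'
    by (simp only: complex_mod_cnj)
  show ?thesis
    unfolding overlap_def by (rule trans[OF sum.swap], intro sum.cong refl eq)
qed

lemma overlap_nonneg: "0 \<le> overlap N \<kappa> \<mu> \<mu>' W W' b b'"
  unfolding overlap_def by (intro sum_nonneg) simp

lemma knorm_nonneg: "0 \<le> knorm N \<kappa> \<mu> W b"
  unfolding knorm_def by (intro sum_nonneg) simp

lemma nover_commute: "nover N \<kappa> \<mu> \<mu>' W W' b b' = nover N \<kappa> \<mu>' \<mu> W' W b' b"
  unfolding nover_def by (subst overlap_commute) (simp add: mult.commute)

text \<open>The source of the matrix entries. Normalisation turns \<open>s ^ 4\<close> and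
  \<open>c ^ 4\<close> into \<open>s\<^sup>2\<close> and \<open>c\<^sup>2\<close>, which add up to
  the diagonal entry 1, and turns the factors \<open>s\<^sup>2\<close> and \<open>c\<^sup>2\<close>
  of the cross terms into \<open>s\<close> and \<open>c\<close>, both at most the off-diagonal entry
  \<open>c\<close>.\<close>

lemma nover_Suc:
  assumes "b < 3 ^ N" "b' < 3 ^ N"
  shows "nover (Suc N) \<kappa> \<mu> \<mu>' W W' b b' + nover (Suc N) \<kappa> \<mu> \<mu>' W W' (2 * 3 ^ N + b) (2 * 3 ^ N + b')
      = nover N \<kappa> \<mu> \<mu>' (shift N 1 W) (shift N 1 W') b b'"
    "nover (Suc N) \<kappa> \<mu> \<mu>' W W' b (2 * 3 ^ N + b') = 0"
    "nover (Suc N) \<kappa> \<mu> \<mu>' W W' (2 * 3 ^ N + b) b' = 0"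
    "nover (Suc N) \<kappa> \<mu> \<mu>' W W' (3 ^ N + b) (3 ^ N + b')
      = nover N (\<kappa> * 2) \<mu> \<mu>' (stackK N W) (stackK N W') b b'"
    "nover (Suc N) \<kappa> \<mu> \<mu>' W W' b (3 ^ N + b') + nover (Suc N) \<kappa> \<mu> \<mu>' W W' (2 * 3 ^ N + b) (3 ^ N + b')
      \<le> c * nover N \<kappa> \<mu> (\<mu>' * 2) (shift N 1 W) (stackM N W') b b'"
proof -
  let ?x = "sqrt (knorm N \<kappa> \<mu> (shift N 1 W) b)" and ?y = "sqrt (knorm N \<kappa> \<mu>' (shift N 1 W') b')"
    and ?z = "sqrt (knorm N (\<kappa> * 2) \<mu>' (stackK N W') b')"
  note simps = nover_def overlap_Suc[OF assms] knorm_Suc[OF assms(1)] knorm_Suc[OF assms(2)] real_sqrt_mult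
  have sq: "sqrt (s\<^sup>2) = s" "sqrt (c\<^sup>2) = c" using sc by simp_all
  have fr: "a ^ 4 * o' / (a * x * (a * y)) = a\<^sup>2 * (o' / (x * y))" "a\<^sup>2 * o' / (a * x * z) = a * (o' / (x * z))"
    if "0 < a" for a o' x y z :: real
    using that by (simp_all add: power2_eq_square power4_eq_xxxx)
  have "nover (Suc N) \<kappa> \<mu> \<mu>' W W' b b' + nover (Suc N) \<kappa> \<mu> \<mu>' W W' (2 * 3 ^ N + b) (2 * 3 ^ N + b')
      = (s\<^sup>2 + c\<^sup>2) * nover N \<kappa> \<mu> \<mu>' (shift N 1 W) (shift N 1 W') b b'"
    unfolding simps sq fr[OF sc(1)] fr[OF sc(2)] by (simp only: distrib_right)
  then show "nover (Suc N) \<kappa> \<mu> \<mu>' W W' b b' + nover (Suc N) \<kappa> \<mu> \<mu>' W W' (2 * 3 ^ N + b) (2 * 3 ^ N + b')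
      = nover N \<kappa> \<mu> \<mu>' (shift N 1 W) (shift N 1 W') b b'" by (simp add: sc(4))
  show "nover (Suc N) \<kappa> \<mu> \<mu>' W W' b (2 * 3 ^ N + b') = 0"
    "nover (Suc N) \<kappa> \<mu> \<mu>' W W' (2 * 3 ^ N + b) b' = 0"
    "nover (Suc N) \<kappa> \<mu> \<mu>' W W' (3 ^ N + b) (3 ^ N + b')
      = nover N (\<kappa> * 2) \<mu> \<mu>' (stackK N W) (stackK N W') b b'"
    unfolding simps by simp_all
  let ?o = "\<lambda>j. overlap N \<kappa> \<mu> \<mu>' (shift N 1 W) (shift N j W') b b' / (?x * ?z)"
  have o: "0 \<le> ?o j" for j using overlap_nonneg knorm_nonneg by simp
  have "nover (Suc N) \<kappa> \<mu> \<mu>' W W' b (3 ^ N + b') + nover (Suc N) \<kappa> \<mu> \<mu>' W W' (2 * 3 ^ N + b) (3 ^ N + b')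
      = s * ?o 2 + c * ?o 0"
    unfolding simps sq fr[OF sc(1)] fr[OF sc(2)] ..
  \<comment> \<open>The restriction \<alpha> \<le> pi / 4 enters here, as
    \<open>s \<le> c\<close>.\<close>
  also have "\<dots> \<le> c * ?o 2 + c * ?o 0"
    by (intro add_right_mono mult_right_mono sc(3) o)
  also have "\<dots> = c * nover N \<kappa> \<mu> (\<mu>' * 2) (shift N 1 W) (stackM N W') b b'"
    unfolding nover_def overlap_stackM knorm_Suc(4)[OF assms(2)] by (simp only: add_divide_distrib distrib_left)
  finally show "nover (Suc N) \<kappa> \<mu> \<mu>' W W' b (3 ^ N + b') + nover (Suc N) \<kappa> \<mu> \<mu>' W W' (2 * 3 ^ N + b) (3 ^ N + b')
      \<le> c * nover N \<kappa> \<mu> (\<mu>' * 2) (shift N 1 W) (stackM N W') b b'" .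
qed

lemma energy_Suc:
  "energy (Suc N) \<kappa> \<mu> W = energy N \<kappa> \<mu> (shift N 1 W) + energy N (\<kappa> * 2) \<mu> (stackK N W)"
  "energy N \<kappa> (\<mu> * 2) (stackM N W) = energy N (\<kappa> * 2) \<mu> (stackK N W)"
proof -
  have d: "Suc (x * 2) div 2 = x" "Suc (x * 2) mod 2 = 1" for x :: nat by presburger+
  show "energy (Suc N) \<kappa> \<mu> W = energy N \<kappa> \<mu> (shift N 1 W) + energy N (\<kappa> * 2) \<mu> (stackK N W)"
    "energy N \<kappa> (\<mu> * 2) (stackM N W) = energy N (\<kappa> * 2) \<mu> (stackK N W)"
    unfolding energy_def power_Suc sum_lessThan_times[of _ 3] sum_lessThan_3 sum_lessThan_double
    by (simp_all add: shift_def stackK_def stackM_def pass_def d sum.distrib)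
qed

lemma energy_nonneg: "0 \<le> energy N \<kappa> \<mu> W"
  unfolding energy_def by (intro sum_nonneg) simp

text \<open>For positive operators Tr (\<tau> \<tau>') is at most Tr \<tau> Tr \<tau>', by
  Cauchy-Schwarz for each pair of vectors. With no letters left, norm and energy coincide.\<close>

lemma nover_0_le:
  "nover 0 \<kappa> \<mu> \<mu>' W W' 0 0 \<le> sqrt (energy 0 \<kappa> \<mu> W * energy 0 \<kappa> \<mu>' W')"
proof -
  have ko: "kout 0 V 0 k 0 m = V k 0 m" for V :: "nat \<Rightarrow> nat \<Rightarrow> nat \<Rightarrow> complex" and k m
    by (simp add: kout_def T_0)
  have kn: "knorm 0 \<kappa> \<nu> V 0 = energy 0 \<kappa> \<nu> V" for \<nu> V
    by (simp add: knorm_def energy_def ko)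
  have "overlap 0 \<kappa> \<mu> \<mu>' W W' 0 0 \<le> (\<Sum>m<\<mu>. \<Sum>m'<\<mu>'. (\<Sum>k<\<kappa>. (cmod (W k 0 m))\<^sup>2) * (\<Sum>k<\<kappa>. (cmod (W' k 0 m'))\<^sup>2))"
    unfolding overlap_def
  proof (intro sum_mono)
    fix m m'
    show "(cmod (\<Sum>k<\<kappa>. \<Sum>e<2 ^ 0. cnj (kout 0 W 0 k e m) * kout 0 W' 0 k e m'))\<^sup>2
      \<le> (\<Sum>k<\<kappa>. (cmod (W k 0 m))\<^sup>2) * (\<Sum>k<\<kappa>. (cmod (W' k 0 m'))\<^sup>2)"
      using cmod_sum_mult_square_le[of "\<lambda>k. cnj (W k 0 m)" "\<lambda>k. W' k 0 m'" "{..<\<kappa>}"] by (simp add: ko)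
  qed
  also have "\<dots> = (\<Sum>m<\<mu>. \<Sum>k<\<kappa>. (cmod (W k 0 m))\<^sup>2) * (\<Sum>m'<\<mu>'. \<Sum>k<\<kappa>. (cmod (W' k 0 m'))\<^sup>2)"
    by (simp only: sum_product)
  also have "\<dots> = energy 0 \<kappa> \<mu> W * energy 0 \<kappa> \<mu>' W'"
    unfolding energy_def by (simp add: sum.swap[of _ "{..<\<kappa>}"])
  finally have le: "overlap 0 \<kappa> \<mu> \<mu>' W W' 0 0 \<le> energy 0 \<kappa> \<mu> W * energy 0 \<kappa> \<mu>' W'" .
  define r where "r = sqrt (energy 0 \<kappa> \<mu> W * energy 0 \<kappa> \<mu>' W')"
  have r: "0 \<le> r" "energy 0 \<kappa> \<mu> W * energy 0 \<kappa> \<mu>' W' = r * r"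
    using energy_nonneg by (simp_all add: r_def)
  \<comment> \<open>For \<open>r = 0\<close> the quotient is 0 as well, so
    \<open>(r * r) / r\<close> is always \<open>r\<close>.\<close>
  have "nover 0 \<kappa> \<mu> \<mu>' W W' 0 0 \<le> (r * r) / r"
    unfolding nover_def kn real_sqrt_mult[symmetric] r_def[symmetric]
    using le r by (intro divide_right_mono) simp_all
  then show ?thesis by (simp add: r_def[symmetric])
qed

text \<open>Square roots of the energies of the letter 1 part and of the rest form a vector for
  \<open>W\<close> and one for \<open>W'\<close>, and the recursion pairs these by the symmetric
  matrix with entries 1 and \<open>c\<close>. The statement ranges over all dimensions and both
  families because passing a letter enlarges \<open>k\<close> or \<open>m\<close> and the cross
  terms make the families differ.\<close>

lemma nover_sum_le:
  "(\<Sum>b<3 ^ N. \<Sum>b'<3 ^ N. nover N \<kappa> \<mu> \<mu>' W W' b b') \<le> (1 + c) ^ N * sqrt (energy N \<kappa> \<mu> W * energy N \<kappa> \<mu>' W')"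
proof (induction N arbitrary: \<kappa> \<mu> \<mu>' W W')
  case 0
  then show ?case using nover_0_le by simp
next
  case (Suc N)
  let ?n = "nover (Suc N) \<kappa> \<mu> \<mu>' W W'" and ?B = "{..<(3::nat) ^ N}" and ?q = "(3::nat) ^ N"
  let ?P = "energy N \<kappa> \<mu> (shift N 1 W)" and ?Q = "energy N (\<kappa> * 2) \<mu> (stackK N W)"
    and ?P' = "energy N \<kappa> \<mu>' (shift N 1 W')" and ?Q' = "energy N (\<kappa> * 2) \<mu>' (stackK N W')"
  let ?l = "(1 + c) ^ N"
  have l: "0 \<le> ?l" using sc by simp
  \<comment> \<open>The nine blocks of output letters, grouped to match the clauses of
    \<open>nover_Suc\<close>; the last bracket is the transposed cross term.\<close>
  have "(\<Sum>b<3 ^ Suc N. \<Sum>b'<3 ^ Suc N. ?n b b')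
      = (\<Sum>b\<in>?B. \<Sum>b'\<in>?B. (?n b b' + ?n (2 * ?q + b) (2 * ?q + b')) + ?n b (2 * ?q + b') + ?n (2 * ?q + b) b'
          + ?n (?q + b) (?q + b') + (?n b (?q + b') + ?n (2 * ?q + b) (?q + b')) + (?n (?q + b) b' + ?n (?q + b) (2 * ?q + b')))"
    unfolding power_Suc sum_lessThan_times[of _ 3] sum_lessThan_3 by (simp add: sum.distrib)
  also have "\<dots> \<le> (\<Sum>b\<in>?B. \<Sum>b'\<in>?B. nover N \<kappa> \<mu> \<mu>' (shift N 1 W) (shift N 1 W') b b'
      + nover N (\<kappa> * 2) \<mu> \<mu>' (stackK N W) (stackK N W') b b'
      + c * nover N \<kappa> \<mu> (\<mu>' * 2) (shift N 1 W) (stackM N W') b b'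
      + c * nover N \<kappa> \<mu>' (\<mu> * 2) (shift N 1 W') (stackM N W) b' b)"
  proof (intro sum_mono)
    fix b b' assume "b \<in> ?B" "b' \<in> ?B"
    then have b: "b < 3 ^ N" "b' < 3 ^ N" by auto
    show "(?n b b' + ?n (2 * ?q + b) (2 * ?q + b')) + ?n b (2 * ?q + b') + ?n (2 * ?q + b) b'
          + ?n (?q + b) (?q + b') + (?n b (?q + b') + ?n (2 * ?q + b) (?q + b')) + (?n (?q + b) b' + ?n (?q + b) (2 * ?q + b'))
        \<le> nover N \<kappa> \<mu> \<mu>' (shift N 1 W) (shift N 1 W') b b'
      + nover N (\<kappa> * 2) \<mu> \<mu>' (stackK N W) (stackK N W') b b'
      + c * nover N \<kappa> \<mu> (\<mu>' * 2) (shift N 1 W) (stackM N W') b b'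
      + c * nover N \<kappa> \<mu>' (\<mu> * 2) (shift N 1 W') (stackM N W) b' b"
      using nover_Suc[OF b, of \<kappa> \<mu> \<mu>' W W'] nover_Suc(5)[OF b(2,1), of \<kappa> \<mu>' \<mu> W' W]
        nover_commute[of "Suc N" \<kappa> \<mu> \<mu>' W W' "?q + b" b'] nover_commute[of "Suc N" \<kappa> \<mu> \<mu>' W W' "?q + b" "2 * ?q + b'"]
      by linarith
  qed
  also have "\<dots> = (\<Sum>b\<in>?B. \<Sum>b'\<in>?B. nover N \<kappa> \<mu> \<mu>' (shift N 1 W) (shift N 1 W') b b')
      + (\<Sum>b\<in>?B. \<Sum>b'\<in>?B. nover N (\<kappa> * 2) \<mu> \<mu>' (stackK N W) (stackK N W') b b')
      + c * (\<Sum>b\<in>?B. \<Sum>b'\<in>?B. nover N \<kappa> \<mu> (\<mu>' * 2) (shift N 1 W) (stackM N W') b b')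
      + c * (\<Sum>b'\<in>?B. \<Sum>b\<in>?B. nover N \<kappa> \<mu>' (\<mu> * 2) (shift N 1 W') (stackM N W) b' b)"
    by (simp only: sum.distrib sum_distrib_left)
      (subst (4) sum.swap, rule refl)
  also have "\<dots> \<le> ?l * sqrt (?P * ?P') + ?l * sqrt (?Q * ?Q') + c * (?l * sqrt (?P * ?Q')) + c * (?l * sqrt (?P' * ?Q))"
    using sc(2) Suc.IH[of \<kappa> \<mu> \<mu>' "shift N 1 W" "shift N 1 W'"] Suc.IH[of "\<kappa> * 2" \<mu> \<mu>' "stackK N W" "stackK N W'"]
      Suc.IH[of \<kappa> \<mu> "\<mu>' * 2" "shift N 1 W" "stackM N W'"] Suc.IH[of \<kappa> \<mu>' "\<mu> * 2" "shift N 1 W'" "stackM N W"]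
    unfolding energy_Suc(2) by (intro add_mono mult_left_mono) auto
  also have "\<dots> = ?l * ((sqrt (?P * ?P') + sqrt (?Q * ?Q')) + c * (sqrt (?P * ?Q') + sqrt (?Q * ?P')))"
    by (simp add: algebra_simps)
  \<comment> \<open>The diagonal and the antidiagonal pairing are each at most the product of the
    two Euclidean norms, which produces the factor \<open>1 + c\<close>.\<close>
  also have "\<dots> \<le> ?l * (sqrt ((?P + ?Q) * (?P' + ?Q')) + c * sqrt ((?P + ?Q) * (?Q' + ?P')))"
    using l sc(2) energy_nonneg
    by (intro mult_left_mono add_mono real_le_rsqrt sqrt_mult_add_square_le) auto
  also have "\<dots> = (1 + c) ^ Suc N * sqrt (energy (Suc N) \<kappa> \<mu> W * energy (Suc N) \<kappa> \<mu>' W')"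
    unfolding energy_Suc(1) by (simp add: algebra_simps)
  finally show ?case .
qed

lemma quantum_capacity_qutrit_le: "quantum_capacity (qutrit_channel \<alpha>) \<le> log 2 (1 + c)"
proof (rule quantum_capacity_le[OF qutrit_isometry(1)])
  fix N :: nat and \<rho> assume \<rho>: "\<rho> \<in> density_ops (3 ^ N)"
  let ?Q = "qutrit_channel \<alpha>"
  let ?Es = "tensor_power ?Q N" and ?Fs = "tensor_power (complementary ?Q) N"
  have E: "kraus_isometry (3 ^ N) (3 ^ N) ?Es" by (rule kraus_isometry_power[OF qutrit_isometry(1)])
  have L: "length ?Es = 2 ^ N" by (simp add: tensor_power_length qutrit_isometry(2))
  have F: "kraus_isometry (2 ^ N) (3 ^ N) ?Fs"
    using kraus_isometry_power[OF kraus_isometry_complementary[OF qutrit_isometry(1)], of N] qutrit_isometry(2) by simp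
  have LF: "length ?Fs = 3 ^ N"
    by (simp add: tensor_power_length complementary_length kraus_isometry_dims(1)[OF qutrit_isometry(1)])
  obtain W where W: "\<And>a b. a < 3 ^ N \<Longrightarrow> b < 3 ^ N \<Longrightarrow> \<rho> $$ (a, b) = (\<Sum>m<(3::nat) ^ N. W a m * cnj (W b m))"
    "(\<Sum>a<3 ^ N. \<Sum>m<(3::nat) ^ N. (cmod (W a m))\<^sup>2) = 1"
    by (rule density_gram[OF \<rho>], rule that)
  \<comment> \<open>At the start the environment holds no extra system, so \<open>k\<close> takes
    one value, and \<open>m\<close> is the reference index of the Gram representation of
    \<rho>.\<close>
  let ?V = "\<lambda>k::nat. W"
  have "vn_entropy (apply_channel ?Es \<rho>) - vn_entropy (apply_channel ?Fs \<rho>) \<le> log 2 ((1 + c) ^ N)"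
  proof (rule coherent_information_le_log[OF E _ LF _ \<rho> W(1)])
    show "kraus_isometry (length ?Es) (3 ^ N) ?Fs" using F L by simp
    show "?Fs ! b $$ (k, a) = ?Es ! k $$ (b, a)" if "b < 3 ^ N" "k < length ?Es" "a < 3 ^ N" for b k a
      using complementary_power_index[OF qutrit_isometry(1) that(1) _ that(3), of k] that(2) L qutrit_isometry(2) by simp
    have "energy N 1 (3 ^ N) ?V = 1" using W(2) by (simp add: energy_def)
    then have "(\<Sum>b<3 ^ N. \<Sum>b'<3 ^ N. nover N 1 (3 ^ N) (3 ^ N) ?V ?V b b') \<le> (1 + c) ^ N"
      using nover_sum_le[of N 1 "3 ^ N" "3 ^ N" ?V ?V] by simp
    then show "(\<Sum>b<3 ^ N. \<Sum>b'<3 ^ N. (\<Sum>x<3 ^ N. \<Sum>x'<3 ^ N. (cmod (\<Sum>k<length ?Es.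
        cnj (\<Sum>a<3 ^ N. ?Es ! k $$ (b, a) * W a x) * (\<Sum>a<3 ^ N. ?Es ! k $$ (b', a) * W a x')))\<^sup>2)
      / (sqrt (\<Sum>k<length ?Es. \<Sum>x<3 ^ N. (cmod (\<Sum>a<3 ^ N. ?Es ! k $$ (b, a) * W a x))\<^sup>2)
        * sqrt (\<Sum>k<length ?Es. \<Sum>x<3 ^ N. (cmod (\<Sum>a<3 ^ N. ?Es ! k $$ (b', a) * W a x))\<^sup>2))) \<le> (1 + c) ^ N"
      by (simp add: nover_def overlap_def knorm_def kout_def T_def L)
  qed
  also have "log 2 ((1 + c) ^ N) = real N * log 2 (1 + c)" using sc by (simp add: log_nat_power)
  finally show "vn_entropy (apply_channel ?Es \<rho>) - vn_entropy (apply_channel ?Fs \<rho>) \<le> real N * log 2 (1 + c)" .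
qed simp

end

subsection \<open>Entanglement-assisted capacity\<close>

lemma vn_entropy_transpose:
  assumes "A \<in> carrier_mat n n"
  shows "vn_entropy (transpose_mat A) = vn_entropy A"
proof -
  have "char_poly (transpose_mat A) = char_poly A" using char_poly_transpose_mat[OF assms] .
  then show ?thesis
    using spectrum_root_char_poly[OF assms] spectrum_root_char_poly[of "transpose_mat A" n] assms
    by (simp add: vn_entropy_def)
qed

text \<open>Arrange the vector (id tensor V) \<phi> as a matrix \<open>\<Psi>\<close> with reference
  and output as rows and the environment as columns. \<open>\<Psi>\<close> times its adjoint is the
  state of reference and output, the reversed product is the transposed environment state, and
  swapping factors keeps the entropy. The reference dimension \<open>r\<close> thereby drops
  out.\<close>

lemma purification_entropy:
  assumes E: "kraus_isometry m n Es" and m: "0 < m" and \<rho>: "\<rho> \<in> carrier_mat n n"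
    and pur: "purification r n \<phi> \<rho>"
  shows "vn_entropy (apply_channel (tensor (id_channel r) Es) (pure_state \<phi>))
    = vn_entropy (apply_channel (complementary Es) \<rho>)"
proof -
  let ?L = "length Es"
  note d = kraus_isometry_dims[OF E]
  have \<phi>: "\<phi> \<in> carrier_vec (r * n)" and pt: "ptrace1 r n (pure_state \<phi>) = \<rho>"
    using pur by (auto simp: purification_def)
  have idx: "i * n + a < r * n" if "i < r" "a < n" for i a using that by (rule pair_index_less)
  have \<rho>\<phi>: "\<rho> $$ (a, b) = (\<Sum>i<r. \<phi> $ (i * n + a) * cnj (\<phi> $ (i * n + b)))" if "a < n" "b < n" for a b
    unfolding pt[symmetric] using that \<phi> by (simp add: ptrace1_def pure_state_def idx)
  define \<Psi> where "\<Psi> = mat (r * m) ?L (\<lambda>(x, k). \<Sum>a<n. (Es ! k) $$ (x mod m, a) * \<phi> $ (x div m * n + a))"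
  have \<Psi>c: "\<Psi> \<in> carrier_mat (r * m) ?L" by (simp add: \<Psi>_def)
  note \<Psi>a = mat_adjoint_carrier[OF \<Psi>c]
  have \<Psi>i: "\<Psi> $$ (i * m + b, k) = (\<Sum>a<n. (Es ! k) $$ (b, a) * \<phi> $ (i * n + a))"
    if "i < r" "b < m" "k < ?L" for i b k
    using that pair_index_less[of i r b m] by (simp add: \<Psi>_def)
  have ti: "kraus_isometry (r * m) (r * n) (tensor (id_channel r) Es)"
    by (rule kraus_isometry_tensor[OF kraus_isometry_id E])
  have pc: "pure_state \<phi> \<in> carrier_mat (r * n) (r * n)" using \<phi> by (simp add: pure_state_def)
  have idc: "set (id_channel r) \<subseteq> carrier_mat r r" "length (id_channel r) = 1" by (auto simp: id_channel_def)
  have out: "(\<Sum>y<r * n. (tensor (id_channel r) Es ! k) $$ (x, y) * \<phi> $ y) = \<Psi> $$ (x, k)"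
    if x: "x < r * m" and k: "k < ?L" for x k
  proof -
    have xm: "x div m < r" "x mod m < m" "x = x div m * m + x mod m"
      using x m by (auto simp: less_mult_imp_div_less)
    have "(\<Sum>y<r * n. (tensor (id_channel r) Es ! k) $$ (x, y) * \<phi> $ y)
        = (\<Sum>j<r. \<Sum>a<n. (if j = x div m then (Es ! k) $$ (x mod m, a) * \<phi> $ (x div m * n + a) else 0))"
      unfolding sum_lessThan_times
    proof (intro sum.cong refl)
      fix j a assume "j \<in> {..<r}" "a \<in> {..<n}"
      then have ja: "j < r" "a < n" by auto
      have "(tensor (id_channel r) Es ! (0 * ?L + k)) $$ (x div m * m + x mod m, j * n + a)
          = (id_channel r ! 0) $$ (x div m, j) * (Es ! k) $$ (x mod m, a)"
        using idc xm(1,2) ja k by (intro tensor_index[OF idc(1) d(4)]) auto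
      then have "(tensor (id_channel r) Es ! k) $$ (x, j * n + a) = (if x div m = j then 1 else 0) * (Es ! k) $$ (x mod m, a)"
        using xm ja by (simp add: id_channel_def)
      then show "(tensor (id_channel r) Es ! k) $$ (x, j * n + a) * \<phi> $ (j * n + a)
        = (if j = x div m then (Es ! k) $$ (x mod m, a) * \<phi> $ (x div m * n + a) else 0)" by simp
    qed
    also have "\<dots> = (\<Sum>j<r. if j = x div m then (\<Sum>a<n. (Es ! k) $$ (x mod m, a) * \<phi> $ (x div m * n + a)) else 0)"
      by (intro sum.cong refl) simp
    also have "\<dots> = \<Psi> $$ (x, k)" using xm(1) x k by (simp add: \<Psi>_def)
    finally show ?thesis .
  qed
  have "apply_channel (tensor (id_channel r) Es) (pure_state \<phi>) = \<Psi> * mat_adjoint \<Psi>"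
  proof (rule eq_matI)
    fix x y assume "x < dim_row (\<Psi> * mat_adjoint \<Psi>)" "y < dim_col (\<Psi> * mat_adjoint \<Psi>)"
    then have xy: "x < r * m" "y < r * m" using \<Psi>c \<Psi>a by auto
    have "apply_channel (tensor (id_channel r) Es) (pure_state \<phi>) $$ (x, y)
        = (\<Sum>k<length (tensor (id_channel r) Es). \<Sum>z<Suc 0.
          (\<Sum>a<r * n. (tensor (id_channel r) Es ! k) $$ (x, a) * \<phi> $ a)
          * cnj (\<Sum>a<r * n. (tensor (id_channel r) Es ! k) $$ (y, a) * \<phi> $ a))"
      using \<phi> by (intro apply_channel_gram[OF ti pc _ xy]) (simp add: pure_state_def)
    also have "\<dots> = (\<Sum>k<?L. \<Psi> $$ (x, k) * cnj (\<Psi> $$ (y, k)))"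
      by (simp add: tensor_length idc out xy)
    also have "\<dots> = (\<Psi> * mat_adjoint \<Psi>) $$ (x, y)"
      using xy \<Psi>c \<Psi>a by (auto simp: scalar_prod_def complex_mat_adjoint_index atLeast0LessThan)
    finally show "apply_channel (tensor (id_channel r) Es) (pure_state \<phi>) $$ (x, y) = (\<Psi> * mat_adjoint \<Psi>) $$ (x, y)" .
  qed (use apply_channel_kraus_carrier[OF ti pc] \<Psi>c \<Psi>a in auto)
  moreover have "mat_adjoint \<Psi> * \<Psi> = transpose_mat (apply_channel (complementary Es) \<rho>)"
  proof (rule eq_matI)
    note C = kraus_isometry_complementary[OF E m]
    note Cc = apply_channel_kraus_carrier[OF C \<rho>]
    show "dim_row (mat_adjoint \<Psi> * \<Psi>) = dim_row (transpose_mat (apply_channel (complementary Es) \<rho>))"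
      "dim_col (mat_adjoint \<Psi> * \<Psi>) = dim_col (transpose_mat (apply_channel (complementary Es) \<rho>))"
      using Cc \<Psi>c \<Psi>a by auto
    fix l k assume "l < dim_row (transpose_mat (apply_channel (complementary Es) \<rho>))"
      "k < dim_col (transpose_mat (apply_channel (complementary Es) \<rho>))"
    then have lk: "l < ?L" "k < ?L" using Cc by auto
    have "apply_channel (complementary Es) \<rho> $$ (k, l) = (\<Sum>b<length (complementary Es). \<Sum>i<r.
        (\<Sum>a<n. (complementary Es ! b) $$ (k, a) * \<phi> $ (i * n + a)) * cnj (\<Sum>a<n. (complementary Es ! b) $$ (l, a) * \<phi> $ (i * n + a)))"
      by (rule apply_channel_gram[OF C \<rho> _ lk(2,1)]) (rule \<rho>\<phi>)
    also have "\<dots> = (\<Sum>b<m. \<Sum>i<r. \<Psi> $$ (i * m + b, k) * cnj (\<Psi> $$ (i * m + b, l)))"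
      unfolding complementary_length d(1)
      using lk d by (intro sum.cong refl) (simp add: complementary_index \<Psi>i)
    also have "\<dots> = (\<Sum>x<r * m. cnj (\<Psi> $$ (x, l)) * \<Psi> $$ (x, k))"
      unfolding sum_lessThan_times by (subst sum.swap) (simp add: mult.commute)
    also have "\<dots> = (mat_adjoint \<Psi> * \<Psi>) $$ (l, k)"
      using lk \<Psi>c \<Psi>a by (auto simp: scalar_prod_def complex_mat_adjoint_index atLeast0LessThan)
    finally show "(mat_adjoint \<Psi> * \<Psi>) $$ (l, k) = transpose_mat (apply_channel (complementary Es) \<rho>) $$ (l, k)"
      using lk Cc by simp
  qed
  moreover have "apply_channel (complementary Es) \<rho> \<in> carrier_mat ?L ?L"
    by (rule apply_channel_kraus_carrier[OF kraus_isometry_complementary[OF E m] \<rho>])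
  ultimately show ?thesis
    using vn_entropy_mult_swap[OF \<Psi>c \<Psi>a] vn_entropy_transpose by metis
qed

text \<open>Measuring the input, the output and the environment in their eigenbases gives a joint distribution
  \<open>w\<close> to which concavity of the logarithm applies.\<close>

lemma mutual_information_le_log:
  assumes E: "kraus_isometry m n Es" and m: "0 < m" and \<rho>: "\<rho> \<in> density_ops n"
    and s: "\<And>b. b < m \<Longrightarrow> 0 < \<sigma> b" "(\<Sum>b<m. \<sigma> b) \<le> 1"
    and bound: "\<And>g. (\<Sum>b<m. (\<Sum>a<n. (cmod (\<Sum>k<length Es. g k * (Es ! k) $$ (b, a)))\<^sup>2) / \<sigma> b)
      \<le> \<mu> * (\<Sum>k<length Es. (cmod (g k))\<^sup>2)"
  shows "vn_entropy \<rho> + vn_entropy (apply_channel Es \<rho>) - vn_entropy (apply_channel (complementary Es) \<rho>) \<le> log 2 \<mu>"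
proof -
  let ?L = "length Es" and ?B = "apply_channel Es \<rho>" and ?C = "apply_channel (complementary Es) \<rho>"
  note d = kraus_isometry_dims[OF E] and FI = kraus_isometry_complementary[OF E m]
  have \<rho>c: "\<rho> \<in> carrier_mat n n" using \<rho> by (simp add: density_ops_def)
  note B = apply_channel_density[OF E \<rho>] and C = apply_channel_density[OF FI \<rho>]
  obtain f q where f: "unitary_on n f" "\<And>j. j < n \<Longrightarrow> 0 \<le> q j" "(\<Sum>j<n. q j) = 1"
    "\<And>a b. a < n \<Longrightarrow> b < n \<Longrightarrow> \<rho> $$ (a, b) = (\<Sum>j<n. complex_of_real (q j) * f j a * cnj (f j b))"
    "vn_entropy \<rho> = - (\<Sum>j<n. q j * log 2 (q j))"
    by (rule density_eigenbasis[OF \<rho>], rule that)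
  obtain g t where g: "unitary_on ?L g" "\<And>j. j < ?L \<Longrightarrow> 0 \<le> t j" "(\<Sum>j<?L. t j) = 1"
    "\<And>a b. a < ?L \<Longrightarrow> b < ?L \<Longrightarrow> ?C $$ (a, b) = (\<Sum>j<?L. complex_of_real (t j) * g j a * cnj (g j b))"
    "vn_entropy ?C = - (\<Sum>j<?L. t j * log 2 (t j))"
    by (rule density_eigenbasis[OF C], rule that)
  define W where "W a j = complex_of_real (sqrt (q j)) * f j a" for a j
  have W: "\<rho> $$ (a, b) = (\<Sum>j<n. W a j * cnj (W b j))" if "a < n" "b < n" for a b
    unfolding f(4)[OF that]
  proof (rule sum.cong[OF refl])
    fix j assume "j \<in> {..<n}"
    then have "complex_of_real (q j) = complex_of_real (sqrt (q j)) * complex_of_real (sqrt (q j))"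
      using f(2) by (simp flip: of_real_mult)
    then show "complex_of_real (q j) * f j a * cnj (f j b) = W a j * cnj (W b j)"
      by (simp only: W_def complex_cnj_mult complex_cnj_complex_of_real ac_simps)
  qed
  define X where "X b k j = (\<Sum>a<n. (Es ! k) $$ (b, a) * W a j)" for b k j
  \<comment> \<open>Joint probability of the input eigenvector \<open>j\<close>, the output outcome
    \<open>b\<close> in the standard basis, where the comparison state \<sigma> is diagonal, and the
    environment eigenvector \<open>\<kappa>\<close>.\<close>
  define w where "w j b \<kappa> = (cmod (\<Sum>k<?L. cnj (g \<kappa> k) * X b k j))\<^sup>2" for j b \<kappa>
  have w0: "0 \<le> w j b \<kappa>" for j b \<kappa> by (simp add: w_def)
  have ww: "w j b \<kappa> = q j * (cmod (\<Sum>a<n. (\<Sum>k<?L. cnj (g \<kappa> k) * (Es ! k) $$ (b, a)) * f j a))\<^sup>2"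
    if j: "j < n" for j b \<kappa>
  proof -
    have "(\<Sum>k<?L. cnj (g \<kappa> k) * X b k j)
        = complex_of_real (sqrt (q j)) * (\<Sum>k<?L. \<Sum>a<n. cnj (g \<kappa> k) * (Es ! k) $$ (b, a) * f j a)"
      by (simp add: X_def W_def sum_distrib_left ac_simps)
    also have "(\<Sum>k<?L. \<Sum>a<n. cnj (g \<kappa> k) * (Es ! k) $$ (b, a) * f j a)
        = (\<Sum>a<n. (\<Sum>k<?L. cnj (g \<kappa> k) * (Es ! k) $$ (b, a)) * f j a)"
      by (subst sum.swap) (simp add: sum_distrib_right)
    finally show ?thesis using f(2)[OF j] by (simp add: w_def norm_mult power_mult_distrib)
  qed
  have sum_\<kappa>: "(\<Sum>\<kappa><?L. w j b \<kappa>) = (\<Sum>k<?L. (cmod (X b k j))\<^sup>2)" for j b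
    unfolding w_def by (rule unitary_parseval[OF g(1)])
  have mq: "(\<Sum>b<m. \<Sum>\<kappa><?L. w j b \<kappa>) = q j" if j: "j < n" for j
  proof -
    have "(\<Sum>b<m. \<Sum>\<kappa><?L. w j b \<kappa>) = (\<Sum>a<n. (cmod (W a j))\<^sup>2)"
      unfolding sum_\<kappa> X_def by (rule kraus_isometry_norm[OF E])
    also have "\<dots> = q j * (\<Sum>a<n. (cmod (f j a))\<^sup>2)"
      using f(2)[OF j] by (simp add: W_def norm_mult power_mult_distrib sum_distrib_left)
    also have "(\<Sum>a<n. (cmod (f j a))\<^sup>2) = 1"
      by (rule unitary_norm[OF f(1) j])
    finally show ?thesis by simp
  qed
  have mB: "(\<Sum>j<n. \<Sum>\<kappa><?L. w j b \<kappa>) = Re (?B $$ (b, b))" if b: "b < m" for b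
  proof -
    have "?B $$ (b, b) = (\<Sum>k<?L. \<Sum>j<n. X b k j * cnj (X b k j))"
      unfolding X_def by (rule apply_channel_gram[OF E \<rho>c _ b b]) (rule W)
    also have "\<dots> = complex_of_real (\<Sum>k<?L. \<Sum>j<n. (cmod (X b k j))\<^sup>2)"
      by (simp only: of_real_sum complex_norm_square)
    finally show ?thesis unfolding sum_\<kappa> by (subst sum.swap) simp
  qed
  have mt: "(\<Sum>j<n. \<Sum>b<m. w j b \<kappa>) = t \<kappa>" if \<kappa>: "\<kappa> < ?L" for \<kappa>
  proof -
    have gram: "?C $$ (k, l) = (\<Sum>p\<in>{..<m} \<times> {..<n}. complex_of_real 1 * X (fst p) k (snd p) * cnj (X (fst p) l (snd p)))"
      if k: "k < ?L" "l < ?L" for k l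
    proof -
      have "?C $$ (k, l) = (\<Sum>b<length (complementary Es). \<Sum>j<n.
          (\<Sum>a<n. (complementary Es ! b) $$ (k, a) * W a j) * cnj (\<Sum>a<n. (complementary Es ! b) $$ (l, a) * W a j))"
        by (rule apply_channel_gram[OF FI \<rho>c _ k]) (rule W)
      also have "\<dots> = (\<Sum>b<m. \<Sum>j<n. X b k j * cnj (X b l j))"
        unfolding complementary_length d(1) X_def using k d by (intro sum.cong refl) (simp add: complementary_index)
      finally show ?thesis by (simp add: sum_Times)
    qed
    have orth: "(\<Sum>k<?L. cnj (g \<kappa> k) * g j k) = (if \<kappa> = j then 1 else 0)" if "j < ?L" for j
      using g(1) \<kappa> that by (simp add: unitary_on_def)
    have "complex_of_real (\<Sum>j<n. \<Sum>b<m. w j b \<kappa>) = complex_of_real (\<Sum>p\<in>{..<m} \<times> {..<n}.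
        1 * (cmod (\<Sum>k<?L. cnj (g \<kappa> k) * X (fst p) k (snd p)))\<^sup>2)"
      unfolding sum_Times fst_conv snd_conv w_def mult_1_left by (subst sum.swap) (rule refl)
    also have "\<dots> = (\<Sum>k<?L. \<Sum>l<?L. cnj (g \<kappa> k) * ?C $$ (k, l) * g \<kappa> l)"
      by (rule quadratic_form_gram[symmetric]) (rule gram)
    also have "\<dots> = complex_of_real (\<Sum>j<?L. t j * (cmod (\<Sum>k<?L. cnj (g \<kappa> k) * g j k))\<^sup>2)"
      by (rule quadratic_form_gram) (rule g(4))
    also have "(\<Sum>j<?L. t j * (cmod (\<Sum>k<?L. cnj (g \<kappa> k) * g j k))\<^sup>2) = (\<Sum>j<?L. if j = \<kappa> then t \<kappa> else 0)"
      by (intro sum.cong refl) (auto simp: orth)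
    also have "\<dots> = t \<kappa>" using \<kappa> by simp
    finally show ?thesis by (simp only: of_real_eq_iff)
  qed
  let ?P = "{..<n} \<times> {..<m} \<times> {..<?L}"
  let ?w = "\<lambda>p. w (fst p) (fst (snd p)) (snd (snd p))"
  \<comment> \<open>The logarithm of this ratio averages to the input entropy plus the output cross
    entropy minus the environment entropy, so one application of Jensen treats all three.\<close>
  let ?x = "\<lambda>p. t (snd (snd p)) / (q (fst p) * \<sigma> (fst (snd p)))"
  have P: "(\<Sum>p\<in>?P. h (fst p) (fst (snd p)) (snd (snd p))) = (\<Sum>j<n. \<Sum>b<m. \<Sum>\<kappa><?L. h j b \<kappa>)"
    for h :: "nat \<Rightarrow> nat \<Rightarrow> nat \<Rightarrow> real" by (simp add: sum_Times)
  have pos: "0 < q (fst p)" "0 < \<sigma> (fst (snd p))" "0 < t (snd (snd p))" if p: "p \<in> ?P" "0 < ?w p" for p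
  proof -
    obtain j b \<kappa> where jb: "p = (j, b, \<kappa>)" "j < n" "b < m" "\<kappa> < ?L" "0 < w j b \<kappa>" using p by (cases p) auto
    have "0 < q j" using jb ww[of j b \<kappa>] f(2)[of j] by (auto simp: less_le)
    moreover have "0 < t \<kappa>"
    proof -
      have "w j b \<kappa> \<le> (\<Sum>b<m. w j b \<kappa>)" using jb w0 by (intro member_le_sum) auto
      also have "\<dots> \<le> (\<Sum>j<n. \<Sum>b<m. w j b \<kappa>)"
        using jb w0 member_le_sum[of j "{..<n}" "\<lambda>j. \<Sum>b<m. w j b \<kappa>"] by (simp add: sum_nonneg)
      finally show ?thesis using jb mt by simp
    qed
    ultimately show "0 < q (fst p)" "0 < \<sigma> (fst (snd p))" "0 < t (snd (snd p))" using jb s(1) by simp_all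
  qed
  have w1: "(\<Sum>p\<in>?P. ?w p) = 1" unfolding P using mq f(3) by simp
  have x0: "0 < ?x p" if "p \<in> ?P" "0 < ?w p" for p using pos[OF that] by simp
  have "vn_entropy \<rho> + vn_entropy ?B - vn_entropy ?C
      \<le> vn_entropy \<rho> - (\<Sum>b<m. Re (?B $$ (b, b)) * log 2 (\<sigma> b)) - vn_entropy ?C"
    using vn_entropy_le_diagonal_cross_entropy[OF B less_imp_le[OF s(1)] s(2)] s(1) by fastforce
  also have "\<dots> = (\<Sum>p\<in>?P. ?w p * log 2 (t (snd (snd p)))) - (\<Sum>p\<in>?P. ?w p * log 2 (q (fst p)))
      - (\<Sum>p\<in>?P. ?w p * log 2 (\<sigma> (fst (snd p))))"
  proof -
    have "(\<Sum>p\<in>?P. ?w p * log 2 (q (fst p))) = (\<Sum>j<n. q j * log 2 (q j))"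
      unfolding P[of "\<lambda>j b \<kappa>. w j b \<kappa> * log 2 (q j)"] using mq by (simp flip: sum_distrib_right)
    moreover have "(\<Sum>p\<in>?P. ?w p * log 2 (\<sigma> (fst (snd p)))) = (\<Sum>b<m. Re (?B $$ (b, b)) * log 2 (\<sigma> b))"
      unfolding P[of "\<lambda>j b \<kappa>. w j b \<kappa> * log 2 (\<sigma> b)"]
      using mB by (subst sum.swap) (simp flip: sum_distrib_right)
    moreover have "(\<Sum>p\<in>?P. ?w p * log 2 (t (snd (snd p)))) = (\<Sum>\<kappa><?L. t \<kappa> * log 2 (t \<kappa>))"
    proof -
      have "(\<Sum>p\<in>?P. ?w p * log 2 (t (snd (snd p)))) = (\<Sum>j<n. \<Sum>\<kappa><?L. \<Sum>b<m. w j b \<kappa> * log 2 (t \<kappa>))"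
        unfolding P[of "\<lambda>j b \<kappa>. w j b \<kappa> * log 2 (t \<kappa>)"] by (rule sum.cong[OF refl], rule sum.swap)
      also have "\<dots> = (\<Sum>\<kappa><?L. \<Sum>j<n. \<Sum>b<m. w j b \<kappa> * log 2 (t \<kappa>))" by (rule sum.swap)
      also have "\<dots> = (\<Sum>\<kappa><?L. t \<kappa> * log 2 (t \<kappa>))" using mt by (simp flip: sum_distrib_right)
      finally show ?thesis .
    qed
    ultimately show ?thesis by (simp add: f(5) g(5))
  qed
  also have "\<dots> = (\<Sum>p\<in>?P. ?w p * log 2 (?x p))"
    unfolding sum_subtractf[symmetric]
  proof (rule sum.cong[OF refl])
    fix p assume p: "p \<in> ?P"
    show "?w p * log 2 (t (snd (snd p))) - ?w p * log 2 (q (fst p)) - ?w p * log 2 (\<sigma> (fst (snd p)))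
      = ?w p * log 2 (?x p)"
    proof (cases "?w p = 0")
      case False
      then have "0 < ?w p" using w0[of "fst p" "fst (snd p)" "snd (snd p)"] by simp
      from pos[OF p this] show ?thesis by (simp add: log_divide log_mult algebra_simps)
    qed simp
  qed
  also have "\<dots> \<le> log 2 (\<Sum>p\<in>?P. ?w p * ?x p)"
    using w0 w1 x0 by (intro sum_weighted_log_le) auto
  also have "\<dots> \<le> log 2 \<mu>"
  proof (subst log_le_cancel_iff)
    show px: "0 < (\<Sum>p\<in>?P. ?w p * ?x p)" using w0 w1 x0 by (intro sum_weighted_pos) auto
    let ?A = "\<lambda>j b \<kappa>. (cmod (\<Sum>a<n. (\<Sum>k<?L. cnj (g \<kappa> k) * (Es ! k) $$ (b, a)) * f j a))\<^sup>2"
    have "(\<Sum>p\<in>?P. ?w p * ?x p) = (\<Sum>j<n. \<Sum>b<m. \<Sum>\<kappa><?L. w j b \<kappa> * (t \<kappa> / (q j * \<sigma> b)))"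
      by (rule P[of "\<lambda>j b \<kappa>. w j b \<kappa> * (t \<kappa> / (q j * \<sigma> b))"])
    \<comment> \<open>The eigenvalue \<open>q j\<close> contained in \<open>w\<close> cancels,
      leaving squared coefficients in the complete basis \<open>f\<close>, which Parseval sums.
      Hence the bound no longer depends on the input state.\<close>
    also have "\<dots> \<le> (\<Sum>j<n. \<Sum>b<m. \<Sum>\<kappa><?L. t \<kappa> * (?A j b \<kappa> / \<sigma> b))"
    proof (intro sum_mono)
      fix j b \<kappa> assume "j \<in> {..<n}" "b \<in> {..<m}" "\<kappa> \<in> {..<?L}"
      then have *: "j < n" "0 < \<sigma> b" "0 \<le> t \<kappa>" using s(1) g(2) by auto
      then show "w j b \<kappa> * (t \<kappa> / (q j * \<sigma> b)) \<le> t \<kappa> * (?A j b \<kappa> / \<sigma> b)"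
        unfolding ww[OF *(1)] by (cases "q j = 0") (auto simp: mult.commute)
    qed
    also have "\<dots> = (\<Sum>j<n. \<Sum>\<kappa><?L. \<Sum>b<m. t \<kappa> * (?A j b \<kappa> / \<sigma> b))"
      by (rule sum.cong[OF refl], rule sum.swap)
    also have "\<dots> = (\<Sum>\<kappa><?L. \<Sum>j<n. \<Sum>b<m. t \<kappa> * (?A j b \<kappa> / \<sigma> b))"
      by (rule sum.swap)
    also have "\<dots> = (\<Sum>\<kappa><?L. \<Sum>b<m. \<Sum>j<n. t \<kappa> * (?A j b \<kappa> / \<sigma> b))"
      by (rule sum.cong[OF refl], rule sum.swap)
    also have "\<dots> = (\<Sum>\<kappa><?L. t \<kappa> * (\<Sum>b<m. (\<Sum>j<n. ?A j b \<kappa>) / \<sigma> b))"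
      by (simp only: sum_distrib_left sum_divide_distrib)
    also have "\<dots> \<le> (\<Sum>\<kappa><?L. t \<kappa> * \<mu>)"
    proof (intro sum_mono mult_left_mono)
      fix \<kappa> assume "\<kappa> \<in> {..<?L}"
      then have \<kappa>: "\<kappa> < ?L" by simp
      then show "0 \<le> t \<kappa>" by (rule g(2))
      have "(\<Sum>j<n. ?A j b \<kappa>) = (\<Sum>a<n. (cmod (\<Sum>k<?L. cnj (g \<kappa> k) * (Es ! k) $$ (b, a)))\<^sup>2)" for b
        by (rule unitary_parseval_cnj[OF f(1)])
      then have "(\<Sum>b<m. (\<Sum>j<n. ?A j b \<kappa>) / \<sigma> b) \<le> \<mu> * (\<Sum>k<?L. (cmod (cnj (g \<kappa> k)))\<^sup>2)"
        using bound[of "\<lambda>k. cnj (g \<kappa> k)"] by simp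
      also have "(\<Sum>k<?L. (cmod (cnj (g \<kappa> k)))\<^sup>2) = 1"
        unfolding complex_mod_cnj by (rule unitary_norm[OF g(1) \<kappa>])
      finally show "(\<Sum>b<m. (\<Sum>j<n. ?A j b \<kappa>) / \<sigma> b) \<le> \<mu>" by simp
    qed
    also have "\<dots> = \<mu>" using g(3) by (simp flip: sum_distrib_right)
    finally show le: "(\<Sum>p\<in>?P. ?w p * ?x p) \<le> \<mu>" .
    show "0 < \<mu>" using px le by linarith
  qed auto
  finally show ?thesis .
qed

subsection \<open>Capacity-achieving diagonal states\<close>

definition dmat :: "nat \<Rightarrow> (nat \<Rightarrow> real) \<Rightarrow> complex mat" where
  "dmat d p = mat d d (\<lambda>(i, j). if i = j then complex_of_real (p i) else 0)"

lemma dmat_carrier: "dmat d p \<in> carrier_mat d d"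
  by (simp add: dmat_def)

lemma dmat_index: "i < d \<Longrightarrow> j < d \<Longrightarrow> dmat d p $$ (i, j) = (if i = j then complex_of_real (p i) else 0)"
  by (simp add: dmat_def)

lemma diagonal_dmat: "diagonal_mat (dmat d p)"
  by (simp add: dmat_def diagonal_mat_def)

lemma dmat_density:
  assumes "\<And>i. i < d \<Longrightarrow> 0 \<le> p i" "(\<Sum>i<d. p i) = 1"
  shows "dmat d p \<in> density_ops d"
  by (rule density_diagonal[OF dmat_carrier diagonal_dmat _ assms]) (simp add: dmat_index)

lemma vn_entropy_dmat: "vn_entropy (dmat d p) = - (\<Sum>i<d. p i * log 2 (p i))"
  unfolding vn_entropy_diagonal[OF dmat_carrier diagonal_dmat] by (simp add: dmat_index)

lemma dmat_cong: "(\<And>i. i < d \<Longrightarrow> p i = q i) \<Longrightarrow> dmat d p = dmat d q"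
  by (intro eq_matI) (auto simp: dmat_def)

lemma apply_channel_dmat_index:
  assumes E: "kraus_isometry m n Es" and ij: "i < m" "j < m"
  shows "apply_channel Es (dmat n p) $$ (i, j)
    = (\<Sum>k<length Es. \<Sum>a<n. (Es ! k) $$ (i, a) * complex_of_real (p a) * cnj ((Es ! k) $$ (j, a)))"
  unfolding apply_channel_kraus_index[OF E dmat_carrier ij]
proof (intro sum.cong refl)
  fix k b assume "b \<in> {..<n}"
  then have b: "b < n" by simp
  have "(\<Sum>a<n. (Es ! k) $$ (i, a) * dmat n p $$ (a, b)) = (\<Sum>a<n. if a = b then (Es ! k) $$ (i, b) * complex_of_real (p b) else 0)"
    using b by (intro sum.cong refl) (auto simp: dmat_index)
  then show "(\<Sum>a<n. (Es ! k) $$ (i, a) * dmat n p $$ (a, b)) * cnj ((Es ! k) $$ (j, b))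
    = (Es ! k) $$ (i, b) * complex_of_real (p b) * cnj ((Es ! k) $$ (j, b))" using b by simp
qed

lemma holevo_dmat_pair:
  "holevo d [(1 / 2, dmat d p), (1 / 2, dmat d q)]
    = vn_entropy (dmat d (\<lambda>i. (p i + q i) / 2)) - (vn_entropy (dmat d p) + vn_entropy (dmat d q)) / 2"
proof -
  have "msum d [complex_of_real (1 / 2) \<cdot>\<^sub>m dmat d p, complex_of_real (1 / 2) \<cdot>\<^sub>m dmat d q] = dmat d (\<lambda>i. (p i + q i) / 2)"
    by (intro eq_matI) (auto simp: msum_def dmat_def field_simps)
  then show ?thesis by (simp add: holevo_def field_simps)
qed

lemma tensor_power_1:
  assumes "set Es \<subseteq> carrier_mat m n"
  shows "tensor_power Es 1 = Es"
proof -
  have "kron F (1\<^sub>m 1) = F" for F by (intro eq_matI) (auto simp: kron_def)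
  then show ?thesis by (simp add: tensor_def id_channel_def)
qed

lemma log2_half: "0 < x \<Longrightarrow> log 2 (x / 2) = log 2 x - 1"
  by (simp add: log_divide)

context qutrit
begin

text \<open>Binary entropy of \<open>s\<^sup>2\<close>, the entropy of the environment in the states
  that attain the capacities.\<close>

definition "h = - (s\<^sup>2 * log 2 (s\<^sup>2) + c\<^sup>2 * log 2 (c\<^sup>2))"

lemma complementary_qutrit:
  "kraus_isometry 2 3 (complementary (qutrit_channel \<alpha>))" "length (complementary (qutrit_channel \<alpha>)) = 3"
  "b < 3 \<Longrightarrow> k < 2 \<Longrightarrow> a < 3 \<Longrightarrow> (complementary (qutrit_channel \<alpha>) ! b) $$ (k, a) = E k b a"
  using kraus_isometry_complementary[OF qutrit_isometry(1)] qutrit_isometry(2)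
    kraus_isometry_dims[OF qutrit_isometry(1)] complementary_length[of "qutrit_channel \<alpha>"]
  by (simp_all add: complementary_index)

lemma qutrit_dmat:
  "apply_channel (qutrit_channel \<alpha>) (dmat 3 p)
    = dmat 3 (\<lambda>i. if i = 0 then s\<^sup>2 * p 1 else if i = 1 then p 0 + p 2 else c\<^sup>2 * p 1)" (is "?A = ?D")
proof (rule eq_matI)
  fix i j assume "i < dim_row ?D" "j < dim_col ?D"
  then have ij: "i < 3" "j < 3" by (simp_all add: dmat_def)
  then have "i = 0 \<or> i = 1 \<or> i = 2" "j = 0 \<or> j = 1 \<or> j = 2" by auto
  then show "?A $$ (i, j) = ?D $$ (i, j)"
    unfolding apply_channel_dmat_index[OF qutrit_isometry(1) ij] dmat_index[OF ij] qutrit_isometry(2)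
      sum_lessThan_2 sum_lessThan_3
    by (elim disjE; simp only: E_entries; simp add: power2_eq_square)
qed (use apply_channel_kraus_carrier[OF qutrit_isometry(1) dmat_carrier] in \<open>auto simp: dmat_def\<close>)

lemma complementary_qutrit_dmat:
  "apply_channel (complementary (qutrit_channel \<alpha>)) (dmat 3 p)
    = dmat 2 (\<lambda>i. if i = 0 then s\<^sup>2 * p 1 + p 2 else c\<^sup>2 * p 1 + p 0)" (is "?A = ?D")
proof (rule eq_matI)
  fix i j assume "i < dim_row ?D" "j < dim_col ?D"
  then have ij: "i < 2" "j < 2" by (simp_all add: dmat_def)
  then have cases: "i = 0 \<or> i = 1" "j = 0 \<or> j = 1" by auto
  have eq: "?A $$ (i, j) = (\<Sum>b<3. \<Sum>a<3. E i b a * complex_of_real (p a) * cnj (E j b a))"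
    unfolding apply_channel_dmat_index[OF complementary_qutrit(1) ij] complementary_qutrit(2)
    using ij by (intro sum.cong refl) (simp add: complementary_qutrit(3))
  show "?A $$ (i, j) = ?D $$ (i, j)"
    using cases unfolding eq dmat_index[OF ij] sum_lessThan_3
    by (elim disjE; simp only: E_entries; simp add: power2_eq_square mult_ac)
qed (use apply_channel_kraus_carrier[OF complementary_qutrit(1) dmat_carrier] in \<open>auto simp: dmat_def\<close>)

text \<open>Chain rule: whether the letter is 1 is a fair bit, and in the other half of the cases a
  further entropy \<open>h\<close> remains. The first spectrum is that of the average output, the
  second, with the weights exchanged, that of the average input.\<close>

lemma entropy_flag: "vn_entropy (dmat 3 (\<lambda>i. if i = 0 then s\<^sup>2 / 2 else if i = 1 then 1 / 2 else c\<^sup>2 / 2)) = 1 + h / 2"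
  "vn_entropy (dmat 3 (\<lambda>i. if i = 0 then c\<^sup>2 / 2 else if i = 1 then 1 / 2 else s\<^sup>2 / 2)) = 1 + h / 2"
proof -
  have l: "log 2 (s\<^sup>2 / 2) = log 2 (s\<^sup>2) - 1" "log 2 (c\<^sup>2 / 2) = log 2 (c\<^sup>2) - 1" "log 2 (1 / 2) = -1"
    using sc log2_half[of 1] by (simp_all add: log2_half)
  have e: "- (s\<^sup>2 / 2 * (x - 1) + 1 / 2 * (-1) + c\<^sup>2 / 2 * (y - 1)) = 1 + - (s\<^sup>2 * x + c\<^sup>2 * y) / 2"
    "- (c\<^sup>2 / 2 * (y - 1) + 1 / 2 * (-1) + s\<^sup>2 / 2 * (x - 1)) = 1 + - (s\<^sup>2 * x + c\<^sup>2 * y) / 2" for x y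
    using sc(4) by (simp_all add: field_simps)
  have "vn_entropy (dmat 3 (\<lambda>i. if i = 0 then s\<^sup>2 / 2 else if i = 1 then 1 / 2 else c\<^sup>2 / 2))
      = - (s\<^sup>2 / 2 * log 2 (s\<^sup>2 / 2) + 1 / 2 * log 2 (1 / 2) + c\<^sup>2 / 2 * log 2 (c\<^sup>2 / 2))"
    unfolding vn_entropy_dmat sum_lessThan_3 by simp
  also have "\<dots> = 1 + h / 2" unfolding l h_def by (rule e)
  finally show "vn_entropy (dmat 3 (\<lambda>i. if i = 0 then s\<^sup>2 / 2 else if i = 1 then 1 / 2 else c\<^sup>2 / 2)) = 1 + h / 2" .
  have "vn_entropy (dmat 3 (\<lambda>i. if i = 0 then c\<^sup>2 / 2 else if i = 1 then 1 / 2 else s\<^sup>2 / 2))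
      = - (c\<^sup>2 / 2 * log 2 (c\<^sup>2 / 2) + 1 / 2 * log 2 (1 / 2) + s\<^sup>2 / 2 * log 2 (s\<^sup>2 / 2))"
    unfolding vn_entropy_dmat sum_lessThan_3 by simp
  also have "\<dots> = 1 + h / 2" unfolding l h_def by (rule e)
  finally show "vn_entropy (dmat 3 (\<lambda>i. if i = 0 then c\<^sup>2 / 2 else if i = 1 then 1 / 2 else s\<^sup>2 / 2)) = 1 + h / 2" .
qed

lemma entropy_env: "vn_entropy (dmat 2 (\<lambda>i. if i = 0 then s\<^sup>2 else c\<^sup>2)) = h"
  unfolding vn_entropy_dmat sum_lessThan_2 h_def by simp

lemma private_classical_capacity:
  "private_capacity (qutrit_channel \<alpha>) = 1" "classical_capacity (qutrit_channel \<alpha>) = 1"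
proof -
  let ?Q = "qutrit_channel \<alpha>"
  define p :: "nat \<Rightarrow> real" where "p = (\<lambda>i. if i = 1 then 1 else 0)"
  \<comment> \<open>The weights are crossed because letter 0 becomes environment letter 1 and letter
    2 becomes environment letter 0; the environment then has the same spectrum
    \<open>s\<^sup>2\<close>, \<open>c\<^sup>2\<close> in the same order as for letter 1.\<close>
  define q where "q = (\<lambda>i::nat. if i = 0 then c\<^sup>2 else if i = 1 then 0 else s\<^sup>2)"
  define ens where "ens = [(1 / 2 :: real, dmat 3 p), (1 / 2, dmat 3 q)]"
  have "dmat 3 p \<in> density_ops 3" "dmat 3 q \<in> density_ops 3"
    using sc by (auto intro!: dmat_density simp: p_def q_def sum_lessThan_3)
  then have ens: "ens \<in> ensembles (3 ^ 1)"
    by (simp add: ens_def ensembles_def)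
  have one: "tensor_power ?Q 1 = ?Q" "tensor_power (complementary ?Q) 1 = complementary ?Q"
    by (rule tensor_power_1[OF kraus_isometry_dims(4)[OF qutrit_isometry(1)]],
        rule tensor_power_1[OF kraus_isometry_dims(4)[OF complementary_qutrit(1)]])
  have B: "apply_channel ?Q (dmat 3 p) = dmat 3 (\<lambda>i. if i = 0 then s\<^sup>2 else if i = 1 then 0 else c\<^sup>2)"
    "apply_channel ?Q (dmat 3 q) = dmat 3 (\<lambda>i. if i = 1 then 1 else 0)"
    unfolding qutrit_dmat using sc(4) by (auto intro!: dmat_cong simp: p_def q_def)
  have C: "apply_channel (complementary ?Q) (dmat 3 p) = dmat 2 (\<lambda>i. if i = 0 then s\<^sup>2 else c\<^sup>2)"
    "apply_channel (complementary ?Q) (dmat 3 q) = dmat 2 (\<lambda>i. if i = 0 then s\<^sup>2 else c\<^sup>2)"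
    unfolding complementary_qutrit_dmat by (auto intro!: dmat_cong simp: p_def q_def)
  have e0: "vn_entropy (dmat 3 (\<lambda>i. if i = 0 then s\<^sup>2 else if i = 1 then 0 else c\<^sup>2)) = h"
    "vn_entropy (dmat 3 (\<lambda>i. if i = 1 then 1 else 0)) = 0"
    unfolding vn_entropy_dmat sum_lessThan_3 h_def by simp_all
  have "holevo_out ?Q ens = holevo 3 [(1 / 2, dmat 3 (\<lambda>i. if i = 0 then s\<^sup>2 else if i = 1 then 0 else c\<^sup>2)),
      (1 / 2, dmat 3 (\<lambda>i. if i = 1 then 1 else 0))]"
    by (simp add: holevo_out_def ens_def B kraus_isometry_dims(1)[OF qutrit_isometry(1)])
  also have "\<dots> = vn_entropy (dmat 3 (\<lambda>i. if i = 0 then s\<^sup>2 / 2 else if i = 1 then 1 / 2 else c\<^sup>2 / 2)) - h / 2"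
    unfolding holevo_dmat_pair e0
    by (intro arg_cong2[where f = minus] arg_cong[where f = vn_entropy] dmat_cong) auto
  finally have hB: "holevo_out ?Q ens = 1" by (simp add: entropy_flag)
  have "holevo_out (complementary ?Q) ens
      = holevo 2 [(1 / 2, dmat 2 (\<lambda>i. if i = 0 then s\<^sup>2 else c\<^sup>2)), (1 / 2, dmat 2 (\<lambda>i. if i = 0 then s\<^sup>2 else c\<^sup>2))]"
    by (simp add: holevo_out_def ens_def C kraus_isometry_dims(1)[OF complementary_qutrit(1)])
  then have hC: "holevo_out (complementary ?Q) ens = 0"
    unfolding holevo_dmat_pair by simp
  have diff: "holevo_out (tensor_power ?Q 1) ens - holevo_out (tensor_power (complementary ?Q) 1) ens = 1"
    unfolding one using hB hC by simp
  have bound: "holevo_out (tensor_power ?Q N) e \<le> real N * 1" if "e \<in> ensembles (3 ^ N)" for N e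
    using holevo_out_power_le[OF that] by simp
  show "private_capacity ?Q = 1" "classical_capacity ?Q = 1"
    by (rule capacities_squeeze[OF qutrit_isometry(1) _ _ bound ens diff]; simp)+
qed

text \<open>Each Kraus operator has two nonzero entries, and each squared entry divided by the
  matching value of \<sigma> is 2. The required bound therefore holds with equality for the constant
  4.\<close>

lemma mutual_information_qutrit_le:
  assumes "\<rho> \<in> density_ops 3"
  shows "vn_entropy \<rho> + vn_entropy (apply_channel (qutrit_channel \<alpha>) \<rho>)
    - vn_entropy (apply_channel (complementary (qutrit_channel \<alpha>)) \<rho>) \<le> 2"
proof -
  let ?\<sigma> = "\<lambda>b::nat. if b = 0 then s\<^sup>2 / 2 else if b = 1 then 1 / 2 else c\<^sup>2 / 2"
  have "vn_entropy \<rho> + vn_entropy (apply_channel (qutrit_channel \<alpha>) \<rho>)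
    - vn_entropy (apply_channel (complementary (qutrit_channel \<alpha>)) \<rho>) \<le> log 2 4"
  proof (rule mutual_information_le_log[OF qutrit_isometry(1) _ assms, of ?\<sigma>])
    show "0 < ?\<sigma> b" for b using sc by auto
    show "(\<Sum>b<3. ?\<sigma> b) \<le> 1" unfolding sum_lessThan_3 using sc(4) by (simp add: field_simps)
    fix g :: "nat \<Rightarrow> complex"
    show "(\<Sum>b<3. (\<Sum>a<3. (cmod (\<Sum>k<length (qutrit_channel \<alpha>). g k * E k b a))\<^sup>2) / ?\<sigma> b)
      \<le> 4 * (\<Sum>k<length (qutrit_channel \<alpha>). (cmod (g k))\<^sup>2)"
      unfolding qutrit_isometry(2) sum_lessThan_2 sum_lessThan_3 E_entries
      using sc(1,2) by (simp add: norm_mult power_mult_distrib)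
  qed simp
  also have "log 2 4 = (2::real)" using log_nat_power[of 2 2 2] by simp
  finally show ?thesis .
qed

lemma entanglement_assisted_capacity_qutrit: "entanglement_assisted_capacity (qutrit_channel \<alpha>) = 2"
proof -
  let ?Q = "qutrit_channel \<alpha>"
  define I where "I \<rho> r \<phi> = vn_entropy \<rho> + vn_entropy (apply_channel ?Q \<rho>)
    - vn_entropy (apply_channel (tensor (id_channel r) ?Q) (pure_state \<phi>))" for \<rho> r \<phi>
  note dim = kraus_isometry_dims(2)[OF qutrit_isometry(1)]
  have I: "I \<rho> r \<phi> = vn_entropy \<rho> + vn_entropy (apply_channel ?Q \<rho>) - vn_entropy (apply_channel (complementary ?Q) \<rho>)"
    if "\<rho> \<in> density_ops 3" "purification r 3 \<phi> \<rho>" for \<rho> r \<phi>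
    using purification_entropy[OF qutrit_isometry(1) _ _ that(2)] that(1) by (simp add: I_def density_ops_def)
  \<comment> \<open>Spectrum of the average input of the ensemble used for the private capacity. Its
    output is \<sigma> and its environment entropy is \<open>h\<close>, so the value is 2 (1 + h /
    2) - h = 2.\<close>
  define p :: "nat \<Rightarrow> real" where "p = (\<lambda>i. if i = 0 then c\<^sup>2 / 2 else if i = 1 then 1 / 2 else s\<^sup>2 / 2)"
  define \<phi> where "\<phi> = vec (3 * 3) (\<lambda>x. if x div 3 = x mod 3 then complex_of_real (sqrt (p (x div 3))) else 0)"
  have p0: "0 \<le> p i" for i by (simp add: p_def)
  have p1: "(\<Sum>i<3. p i) = 1" unfolding sum_lessThan_3 using sc(4) by (simp add: p_def field_simps)
  have dens: "dmat 3 p \<in> density_ops 3" by (rule dmat_density[OF p0 p1])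
  have \<phi>i: "\<phi> $ (i * 3 + k) = (if i = k then complex_of_real (sqrt (p i)) else 0)" if "i < 3" "k < 3" for i k
  proof -
    have dm: "(i * 3 + k) div 3 = i" "(i * 3 + k) mod 3 = k" using that by auto
    show ?thesis unfolding \<phi>_def index_vec[OF pair_index_less[OF that]] by (simp only: dm)
  qed
  have pur: "purification 3 3 \<phi> (dmat 3 p)"
    unfolding purification_def
  proof (intro conjI eq_matI)
    show "\<phi> \<in> carrier_vec (3 * 3)" by (simp add: \<phi>_def)
    fix k l assume "k < dim_row (dmat 3 p)" "l < dim_col (dmat 3 p)"
    then have kl: "k < 3" "l < 3" by (simp_all add: dmat_def)
    have "dim_vec \<phi> = 3 * 3" by (simp add: \<phi>_def)
    then have "ptrace1 3 3 (pure_state \<phi>) $$ (k, l) = (\<Sum>i<3. \<phi> $ (i * 3 + k) * cnj (\<phi> $ (i * 3 + l)))"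
      using kl pair_index_less[of _ 3 _ 3] by (simp add: ptrace1_def pure_state_def)
    also have "\<dots> = (\<Sum>i<3. if i = k then (if k = l then complex_of_real (p k) else 0) else 0)"
      using kl p0 by (intro sum.cong refl) (auto simp: \<phi>i simp flip: of_real_mult)
    also have "\<dots> = dmat 3 p $$ (k, l)" using kl by (simp add: dmat_index)
    finally show "ptrace1 3 3 (pure_state \<phi>) $$ (k, l) = dmat 3 p $$ (k, l)" .
  qed (simp_all add: ptrace1_def dmat_def)
  have "vn_entropy (dmat 3 p) = 1 + h / 2" unfolding p_def by (rule entropy_flag(2))
  moreover have "vn_entropy (apply_channel ?Q (dmat 3 p)) = 1 + h / 2"
    unfolding qutrit_dmat entropy_flag(1)[symmetric] using sc(4)
    by (intro arg_cong[where f = vn_entropy] dmat_cong) (auto simp: p_def field_simps)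
  moreover have "vn_entropy (apply_channel (complementary ?Q) (dmat 3 p)) = h"
    unfolding complementary_qutrit_dmat entropy_env[symmetric]
    by (intro arg_cong[where f = vn_entropy] dmat_cong) (auto simp: p_def)
  ultimately have max: "I (dmat 3 p) 3 \<phi> = 2" by (simp add: I[OF dens pur])
  have "entanglement_assisted_capacity ?Q = Sup {I \<rho> r \<phi> | \<rho> r \<phi>. \<rho> \<in> density_ops 3 \<and> purification r 3 \<phi> \<rho>}"
    unfolding entanglement_assisted_capacity_def dim I_def ..
  also have "\<dots> = 2"
  proof (rule cSup_eq_maximum)
    show "2 \<in> {I \<rho> r \<phi> | \<rho> r \<phi>. \<rho> \<in> density_ops 3 \<and> purification r 3 \<phi> \<rho>}"
      using max dens pur by (metis (mono_tags, lifting) mem_Collect_eq)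
    fix x assume "x \<in> {I \<rho> r \<phi> | \<rho> r \<phi>. \<rho> \<in> density_ops 3 \<and> purification r 3 \<phi> \<rho>}"
    then obtain \<rho> r \<phi> where "x = I \<rho> r \<phi>" "\<rho> \<in> density_ops 3" "purification r 3 \<phi> \<rho>" by blast
    then show "x \<le> 2" using mutual_information_qutrit_le by (simp add: I)
  qed
  finally show ?thesis .
qed

end

theorem proposition16:
  fixes \<alpha> :: real
  assumes "0 < \<alpha>" and "\<alpha> \<le> pi / 4"
  shows "private_capacity (qutrit_channel \<alpha>) = 1 \<and>
         quantum_capacity (qutrit_channel \<alpha>) \<le> log 2 (1 + cos \<alpha>) \<and>
         log 2 (1 + cos \<alpha>) < 1 \<and>
         1 = private_capacity (qutrit_channel \<alpha>) \<and>
         private_capacity (qutrit_channel \<alpha>) = classical_capacity (qutrit_channel \<alpha>) \<and>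
         classical_capacity (qutrit_channel \<alpha>) = 1 / 2 * entanglement_assisted_capacity (qutrit_channel \<alpha>)"
proof -
  interpret qutrit \<alpha> using assms by unfold_locales
  \<comment> \<open>Strict because \<open>c < 1\<close>, which comes from \<alpha> > 0.\<close>
  have "log 2 (1 + c) < log 2 2" using sc by (subst log_less_cancel_iff) auto
  then show ?thesis
    using private_classical_capacity quantum_capacity_qutrit_le entanglement_assisted_capacity_qutrit
    by (simp add: c_def)
qed

end
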